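(* For all $z$ in the upper half plane, with $q=e^{2\pi iz}$: (i) $$\frac{4}{\Theta(z+1/2)}\sum_{n\in\mathbb{Z}}\frac{(-1)^nq^{n^2+n}}{(1+q^n)^2}-\frac{8}{\Theta(z)}\sum_{n\ge0}\frac{nq^{n^2}(1-q^{2n})}{1+q^{2n}}=\Theta^3(z+1/2).$$ (ii) $$\frac{4}{\Theta(z+1/2)}\sum_{n\in\mathbb{Z}}\frac{(-1)^nq^{n^2+2n}}{(1+q^{2n})^2}+4\prod_{n=1}^{\infty}\frac{1-q^{4n-2}}{1-q^{4n}}\sum_{n\ge0}\frac{q^{n^2+3n+1}}{(1-q^{2n+1})^2}=\Theta^3(z).$$ (iii) $$\frac{4}{\Theta(z)}\sum_{n\in\mathbb{Z}}\frac{(-1)^nq^{n^2+n}}{(1+(-q)^n)^2}-\frac{8}{\Theta(z+1/2)}\sum_{n\in\mathbb{Z}}\frac{(-1)^nq^{n^2+2n}}{(1+q^{2n})^2}=-\Theta^3(z).$$ (iv) $$\frac{1}{\Theta(z)}\sum_{n\in\mathbb{Z}}\frac{(-1)^nq^{n^2+n}}{(1+(-q)^n)^2}+\frac{1}{\Theta(z+1/2)}\sum_{n\in\mathbb{Z}}\frac{(-1)^nq^{n^2+2n}}{(1+q^{2n})^2}=-6\,\mathcal{H}(q).$$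
   Context: $\Theta(z)=\sum_{n=-\infty}^{\infty}q^{n^2}$ with $q=e^{2\pi iz}$, so that $\Theta(z+1/2)=\sum_{n=-\infty}^\infty(-1)^nq^{n^2}$; $\Theta^3(\cdot)$ denotes the cube of $\Theta(\cdot)$. For $n\ge1$, $H(n)$ is the Hurwitz class number: the number of $SL_2(\mathbb{Z})$-classes of (not necessarily primitive) positive definite integral binary quadratic forms of discriminant $-n$, where the classes of forms $a(x^2+y^2)$ are counted with weight $1/2$ and those of $a(x^2+xy+y^2)$ with weight $1/3$. Put $$\mathcal{H}(q)=-\frac1{12}+\sum_{n\ge1,\ n\equiv0,3\ (\mathrm{mod}\ 4)}H(n)q^n.$$ *)

theory Defs
  imports "HOL-Analysis.Analysis"
begin

definition theta :: "complex \<Rightarrow> complex" where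
  "theta z = (\<Sum>\<^sub>\<infinity>n\<in>(UNIV :: int set). exp (2 * complex_of_real pi * \<i> * z) powi (n\<^sup>2))"

text \<open>The triple $(a,b,c)$ stands for the binary quadratic form $a x^2 + b x y + c y^2$.\<close>

type_synonym bqf = "int \<times> int \<times> int"

fun bqf_eval :: "bqf \<Rightarrow> int \<Rightarrow> int \<Rightarrow> int" where
  "bqf_eval (a, b, c) x y = a * x\<^sup>2 + b * x * y + c * y\<^sup>2"

fun bqf_disc :: "bqf \<Rightarrow> int" where
  "bqf_disc (a, b, c) = b\<^sup>2 - 4 * a * c"

definition bqf_pos_def :: "bqf \<Rightarrow> bool" where
  "bqf_pos_def f \<longleftrightarrow> (\<forall>x y. (x, y) \<noteq> (0, 0) \<longrightarrow> bqf_eval f x y > 0)"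

definition SL2Z_equivalent :: "bqf \<Rightarrow> bqf \<Rightarrow> bool" where
  "SL2Z_equivalent f g \<longleftrightarrow>
     (\<exists>\<alpha> \<beta> \<gamma> \<delta> :: int. \<alpha> * \<delta> - \<beta> * \<gamma> = 1 \<and>
        (\<forall>x y. bqf_eval g x y = bqf_eval f (\<alpha> * x + \<beta> * y) (\<gamma> * x + \<delta> * y)))"

definition pos_def_forms :: "nat \<Rightarrow> bqf set" where
  "pos_def_forms n = {f. bqf_pos_def f \<and> bqf_disc f = - int n}"

definition form_classes :: "nat \<Rightarrow> bqf set set" where
  "form_classes n =
     pos_def_forms n // {(f, g) \<in> pos_def_forms n \<times> pos_def_forms n. SL2Z_equivalent f g}"

definition class_weight :: "bqf set \<Rightarrow> real" where
  "class_weight C =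
     (if \<exists>a. (a, 0, a) \<in> C then 1 / 2
      else if \<exists>a. (a, a, a) \<in> C then 1 / 3
      else 1)"

definition hurwitz_class_number :: "nat \<Rightarrow> real" where
  "hurwitz_class_number n = (\<Sum>C\<in>form_classes n. class_weight C)"

definition hurwitz_series :: "complex \<Rightarrow> complex" where
  "hurwitz_series q =
     - 1 / 12 + (\<Sum>\<^sub>\<infinity>n\<in>{n. n \<ge> 1 \<and> (n mod 4 = 0 \<or> n mod 4 = 3)}.
                    complex_of_real (hurwitz_class_number n) * q ^ n)"

end

theory Submission
  imports Defs
begin

text \<open>
  Let t and c stand for hyperbolic tangent and cotangent quotients in powers of q. Multiplying
  the finite theta sums \<open>h N = \<Sum> q ^ (x * (N - x))\<close> (end terms halved) by a full theta series and
  shifting the summation variable makes the sum over x geometric, so the product is a single series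
  with terms \<open>q powi (m\<^sup>2)\<close> times t (N + 2 m) or c (N + 2 m). Multiplying by t N and summing
  over all N of a fixed parity, the addition theorems of t and c turn the inner sums over N into
  telescoping ones. Thus the product of a theta series with the sum V a of t N * h N - 1 over all N
  congruent to a modulo 2 becomes, up to a divisor-sum rearrangement, each of the series in (i)-(iii).
  The same telescoping, combined with Jacobi's two-square theorem, evaluates the cube of theta as
  V 1 - V 0; this yields (i)-(iii).

  For (iv), V 0 and V 1 are sums over triples (x, y, z) of powers of q with exponent
  x y + y z + z x, and such triples of equal parity are the Selling parameters of reduced forms, so
  that they count three times the Hurwitz class number.
\<close>

subsection \<open>Hyperbolic quotients in powers of q\<close>

text \<open>The theorem becomes linear algebra because the same sums V 0 and V 1 can be multiplied
  by different theta series, with a different outcome each time. Replacing q by -q exchanges theta z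
  and theta (z + 1/2), called \<open>th\<close> and \<open>th4\<close> below; (i) is read at q, the
  other parts at -q. Let A, B, C, D be the series \<open>ser_A\<close>, \<open>ser_B\<close>,
  \<open>ser_C\<close>, \<open>ser_D\<close>, P the product in (ii) and H the Hurwitz series. At q:
  4 A = - th4 (V 0 + V 1), 4 C = - th V 1, th4^3 = V 1 - V 0. At -q: 4 A(-q) = - th (V 0 + V 1), 4 B
  = - th4 V 0, 4 P D = V 1, th^3 = V 1 - V 0, 24 H = 2 V 0 + V 1. Each part only compares the
  coefficients of V 0 and V 1. The constant -1/12 comes from the term N = 0 of V 0, which is -1 and
  contributes -2 to 24 H. The obstacle is convergence: products of the hyperbolic quotients tend to
  1, and coth has a pole at 0. Hence the -1 in V a, the restriction to sums of differences, and the
  bookkeeping of the pole, whose value is set to 0 and which re-enters as an explicit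
  correction.\<close>

lemma summable_on_int_majorant:
  fixes r :: real
  assumes "0 < r" "r < 1"
  shows "(\<lambda>n::int. (1 + \<bar>of_int n\<bar>) * r ^ nat \<bar>n\<bar>) summable_on UNIV"
proof -
  let ?f = "\<lambda>n::int. (1 + \<bar>of_int n\<bar> :: real) * r ^ nat \<bar>n\<bar>"
  have "summable (\<lambda>n. (1 + real n) * r ^ n)"
    using geometric_deriv_sums[of r] assms by (auto simp: sums_iff)
  then have nat: "(\<lambda>n. (1 + real n) * r ^ n) summable_on UNIV"
    using assms by (intro summable_nonneg_imp_summable_on) auto
  have "?f summable_on range int"
    using nat by (subst summable_on_reindex) (auto simp: o_def inj_on_def)
  moreover have "?f summable_on range (\<lambda>n. - int n)"
    using nat by (subst summable_on_reindex) (auto simp: o_def inj_on_def)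
  ultimately have "?f summable_on (range int \<union> range (\<lambda>n. - int n))"
    by (rule summable_on_union)
  also have "range int \<union> range (\<lambda>n. - int n) = UNIV"
    by (auto simp: image_iff) (metis int_cases2)
  finally show ?thesis .
qed

lemma abs_summable_on_int:
  fixes f :: "int \<Rightarrow> 'a::banach"
  assumes "0 < r" "r < 1" "\<And>n. norm (f n) \<le> C * ((1 + \<bar>of_int n\<bar>) * r ^ nat \<bar>n\<bar>)"
  shows "f abs_summable_on UNIV"
  by (rule Infinite_Sum.abs_summable_on_comparison_test'[OF summable_on_cmult_right[OF
        summable_on_int_majorant[OF assms(1,2)]]]) (use assms(3) in auto)

lemma abs_summable_on_int_exp:
  fixes f :: "int \<Rightarrow> 'a::banach"
  assumes r: "0 < r" "r < 1" and f: "\<And>n. norm (f n) \<le> C * r ^ nat \<bar>n\<bar>"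
  shows "f abs_summable_on UNIV"
proof (rule abs_summable_on_int[OF r])
  fix n
  have "norm (f n) \<le> C * r ^ nat \<bar>n\<bar>" by (rule f)
  moreover have "C \<ge> 0" using f[of 0] by (auto intro: order_trans[OF norm_ge_zero])
  then have "C * (1 * r ^ nat \<bar>n\<bar>) \<le> C * ((1 + \<bar>of_int n\<bar>) * r ^ nat \<bar>n\<bar>)"
    using r by (intro mult_left_mono mult_right_mono) auto
  ultimately show "norm (f n) \<le> C * ((1 + \<bar>of_int n\<bar>) * r ^ nat \<bar>n\<bar>)" by simp
qed

lemma summable_on_product_bound:
  fixes f :: "'a \<times> 'b \<Rightarrow> 'c::banach"
  assumes "g summable_on A" "h summable_on B"
    and "\<And>x y. x \<in> A \<Longrightarrow> y \<in> B \<Longrightarrow> norm (f (x, y)) \<le> g x * h y"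
    and "\<And>x. x \<in> A \<Longrightarrow> 0 \<le> g x" "\<And>y. y \<in> B \<Longrightarrow> 0 \<le> (h y :: real)"
  shows "f summable_on A \<times> B"
proof -
  have "(\<lambda>(x, y). g x * h y) summable_on A \<times> B"
    by (rule summable_on_SigmaI[where g = "\<lambda>x. g x * infsum h B"])
      (use assms in \<open>auto intro!: has_sum_cmult_right summable_on_cmult_left mult_nonneg_nonneg\<close>)
  then have "f abs_summable_on A \<times> B"
    by (rule Infinite_Sum.abs_summable_on_comparison_test') (use assms in auto)
  then show ?thesis by (rule abs_summable_summable)
qed

lemma summable_on_progression:
  fixes f :: "int \<Rightarrow> 'a::banach"
  assumes "f summable_on UNIV"
  shows "(\<lambda>n. f (2 * n + a)) summable_on UNIV"
proof -
  have "f summable_on range (\<lambda>n. 2 * n + a)"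
    using assms by (rule summable_on_subset_banach) auto
  then show ?thesis by (subst (asm) summable_on_reindex) (auto simp: o_def inj_on_def)
qed

lemma infsum_int_reflect:
  fixes f :: "int \<Rightarrow> complex"
  shows "infsum f UNIV = (\<Sum>\<^sub>\<infinity>n. f (- n - a))"
  by (rule infsum_reindex_bij_witness[of _ "\<lambda>n. - n - a" "\<lambda>n. - n - a"]) auto

lemma has_sum_0_if_reflect:
  fixes f :: "int \<Rightarrow> complex"
  assumes "f summable_on UNIV" "\<And>n. f (- n - a) = - f n"
  shows "(f has_sum 0) UNIV"
proof -
  have "infsum f UNIV = - infsum f UNIV"
    using infsum_int_reflect[of f a] assms(2) by (simp add: infsum_uminus)
  then show ?thesis using assms(1) by (simp add: has_sum_iff)
qed

text \<open>Since \<open>sgn 0 = 0\<close>, the jump of the sign function is split into two unit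
  steps; raising a by 1 therefore changes exactly one summand, and by exactly 1. The integer
  coefficients of the telescoped series originate here.\<close>

lemma has_sum_sgn_telescope:
  "((\<lambda>n::int. of_int (sgn (2 * n + a) - sgn (2 * n)) :: complex) has_sum of_int a) UNIV"
proof -
  have step: "((\<lambda>n::int. of_int (sgn (2 * n + (a + 1)) - sgn (2 * n + a)) :: complex) has_sum 1) UNIV" for a
  proof (rule has_sum_finite_neutralI[where B = "{- ((a + 1) div 2)}"])
    fix n :: int assume "n \<in> UNIV - {- ((a + 1) div 2)}"
    then have "2 * n + a \<noteq> 0" "2 * n + a \<noteq> - 1" by auto
    then have "sgn (2 * n + (a + 1)) = sgn (2 * n + a)" by (auto simp: sgn_if)
    then show "of_int (sgn (2 * n + (a + 1)) - sgn (2 * n + a)) = (0::complex)" by simp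
  next
    have "2 * ((a + 1) div 2) = a \<or> 2 * ((a + 1) div 2) = a + 1" by auto
    then have "sgn (2 * - ((a + 1) div 2) + (a + 1)) - sgn (2 * - ((a + 1) div 2) + a) = 1"
      by (elim disjE) (auto simp: sgn_if)
    then show "(1::complex) = (\<Sum>n\<in>{- ((a + 1) div 2)}. of_int (sgn (2 * n + (a + 1)) - sgn (2 * n + a)))"
      by (simp del: of_int_diff)
  qed auto
  show ?thesis
  proof (induction a rule: int_induct[where k = 0])
    case (step1 i)
    show ?case using has_sum_add[OF step1(2) step[of i]] by (simp add: algebra_simps)
  next
    case (step2 i)
    show ?case
      using has_sum_add[OF step2(2) has_sum_uminusI[OF step[of "i - 1"]]] by (simp add: algebra_simps)
  qed simp
qed

text \<open>With q = exp (- 2 u), the quotients for s = -1 and s = 1 are tanh (N u) and coth (N u).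
  Division by 0 makes the value at s = 1, N = 0 equal to 0, so both are odd functions of N.\<close>

definition hyp :: "complex \<Rightarrow> complex \<Rightarrow> int \<Rightarrow> complex" where
  "hyp q s N = (1 + s * q powi N) / (1 - s * q powi N)"

text \<open>In classical notation \<open>gtheta q 1 0\<close> and \<open>gtheta q (-1) 0\<close> are
  theta_3 and theta_4, and \<open>gtheta q 1 1\<close> is theta_2 divided by q^(1/4).\<close>

definition gtheta :: "complex \<Rightarrow> complex \<Rightarrow> int \<Rightarrow> complex" where
  "gtheta q s \<mu> = (\<Sum>\<^sub>\<infinity>m. s powi m * q powi (m\<^sup>2 + \<mu> * m))"

locale nome =
  fixes q :: complex
  assumes q_nz [simp]: "q \<noteq> 0" and q_lt: "norm q < 1"
begin

abbreviation "\<rho> \<equiv> norm q"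

lemma rho: "0 < \<rho>" "\<rho> < 1" "0 \<le> \<rho>" "\<rho> \<le> 1" using q_lt by auto

lemma rho_power_summable: "(\<lambda>n::int. C * \<rho> ^ nat \<bar>n\<bar>) summable_on UNIV"
  by (rule summable_on_cmult_right, rule abs_summable_summable,
      rule abs_summable_on_int_exp[OF rho(1,2), where C = 1]) auto

lemma rho_powi_le: "k \<ge> l \<Longrightarrow> \<rho> powi k \<le> \<rho> powi l"
  using rho by (intro power_int_decreasing) auto

lemma rho_powi_pos: "0 < \<rho> powi k" by (simp add: zero_less_power_int)

lemma q_powi_ne: 
  assumes "k \<noteq> 0" shows "q powi k \<noteq> 1" "q powi k \<noteq> -1" "1 - q powi k \<noteq> 0" "1 + q powi k \<noteq> 0"
proof -
  have "norm (q powi k) \<noteq> 1"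
  proof (cases "k > 0")
    case True
    then show ?thesis using power_int_strict_decreasing[of 0 k \<rho>] rho by (auto simp: norm_power_int)
  next
    case False
    then show ?thesis using assms power_int_strict_decreasing[of k 0 \<rho>] rho by (auto simp: norm_power_int)
  qed
  then show "q powi k \<noteq> 1" "q powi k \<noteq> -1" by auto
  then show "1 - q powi k \<noteq> 0" "1 + q powi k \<noteq> 0" by (auto simp: add_eq_0_iff minus_equation_iff)
qed

lemma hyp_minus:
  assumes "s = 1 \<or> s = -1"
  shows "hyp q s (- N) = - hyp q s N"
proof (cases "N = 0")
  case True
  then show ?thesis using assms by (auto simp: hyp_def)
next
  case False
  show ?thesis
    using assms q_powi_ne[OF False] by (auto simp: hyp_def power_int_minus divide_simps minus_equation_iff eq_commute[of 1]) (auto simp: algebra_simps)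
qed

lemma hyp_zero: "s = 1 \<or> s = -1 \<Longrightarrow> hyp q s 0 = 0"
  by (auto simp: hyp_def)

text \<open>The sign is the non-decaying part of both quotients, and what remains after its removal
  is summable over all N. At N = 0 the default value of division by zero agrees with
  \<open>sgn 0\<close>.\<close>

lemma hyp_sgn:
  assumes "s = 1 \<or> s = -1"
  shows "norm (hyp q s N - of_int (sgn N)) \<le> 2 / (1 - \<rho>) * \<rho> ^ nat \<bar>N\<bar>"
proof -
  have pos: "norm (hyp q s N - 1) \<le> 2 / (1 - \<rho>) * \<rho> ^ nat \<bar>N\<bar>" if N: "N > 0" for N
  proof -
    have nz: "1 - s * q powi N \<noteq> 0" using assms q_powi_ne[of N] N by (auto simp: minus_equation_iff)
    then have "hyp q s N - 1 = 2 * s * q powi N / (1 - s * q powi N)"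
      by (simp add: hyp_def field_simps)
    moreover have "norm (1 - s * q powi N) \<ge> 1 - \<rho>"
    proof -
      have "norm (s * q powi N) = \<rho> powi N" using assms by (auto simp: norm_mult norm_power_int)
      also have "\<dots> \<le> \<rho> powi 1" using N by (intro rho_powi_le) auto
      finally have "norm (s * q powi N) \<le> \<rho>" by simp
      then show ?thesis using norm_triangle_ineq2[of 1 "s * q powi N"] by simp
    qed
    ultimately have "norm (hyp q s N - 1) \<le> 2 * \<rho> powi N / (1 - \<rho>)"
      using assms rho by (auto simp: norm_divide norm_mult norm_power_int intro!: divide_left_mono mult_pos_pos)
    then show ?thesis using N by (simp add: power_int_def)
  qed
  consider "N > 0" | "N = 0" | "N < 0" by linarith
  then show ?thesis
  proof cases
    case 3
    then have "norm (hyp q s N - of_int (sgn N)) = norm (hyp q s (-N) - 1)"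
      using hyp_minus[OF assms, of N] by (simp add: norm_minus_commute add.commute)
    then show ?thesis using pos[of "-N"] 3 by simp
  qed (use pos rho hyp_zero[OF assms] in auto)
qed

lemma hyp_bound:
  assumes "s = 1 \<or> s = -1"
  shows "norm (hyp q s N) \<le> 3 / (1 - \<rho>)"
proof -
  have "norm (hyp q s N) \<le> norm (hyp q s N - of_int (sgn N)) + norm (of_int (sgn N) :: complex)"
    by norm
  also have "norm (of_int (sgn N) :: complex) \<le> 1" by (simp add: sgn_if)
  also have "1 \<le> 1 / (1 - \<rho>)" using rho by simp
  also have "norm (hyp q s N - of_int (sgn N)) \<le> 2 / (1 - \<rho>) * 1"
    using hyp_sgn[OF assms, of N] rho
    by (elim order_trans) (intro mult_left_mono power_le_one, auto)
  finally show ?thesis by (simp add: field_simps)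
qed

text \<open>After subtraction of the sign, each quotient is a summable function that is odd under n
  -> - n - a, so it sums to 0 and only the signs telescope. This is why the total depends neither on
  q nor on the choice between tanh and coth, and why the two may be mixed.\<close>

lemma hyp_telescope:
  assumes s: "s = 1 \<or> s = -1" and s': "s' = 1 \<or> s' = -1"
  shows "((\<lambda>n. hyp q s (2 * n + a) - hyp q s' (2 * n + b)) has_sum of_int (a - b)) UNIV"
proof -
  have sgn0: "((\<lambda>n. hyp q s (2 * n + a) - of_int (sgn (2 * n + a))) has_sum 0) UNIV"
    if s: "s = 1 \<or> s = -1" for s a
  proof (rule has_sum_0_if_reflect[where a = a])
    have "(\<lambda>N. hyp q s N - of_int (sgn N)) summable_on UNIV"
      by (rule abs_summable_summable, rule abs_summable_on_int_exp[OF rho(1,2) hyp_sgn[OF s]])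
    then show "(\<lambda>n. hyp q s (2 * n + a) - of_int (sgn (2 * n + a))) summable_on UNIV"
      by (rule summable_on_progression)
  next
    fix n
    have *: "2 * (- n - a) + a = - (2 * n + a)" by simp
    show "hyp q s (2 * (- n - a) + a) - of_int (sgn (2 * (- n - a) + a)) =
        - (hyp q s (2 * n + a) - of_int (sgn (2 * n + a)))"
      unfolding * hyp_minus[OF s] by (simp add: sgn_if)
  qed
  show ?thesis
    using has_sum_add[OF has_sum_add[OF sgn0[OF s, of a] has_sum_sgn_telescope[of a]]
        has_sum_uminusI[OF has_sum_add[OF sgn0[OF s', of b] has_sum_sgn_telescope[of b]]]] by simp
qed

end

lemma nome_minus: "nome q \<Longrightarrow> nome (- q)"
  by (simp add: nome_def)

subsection \<open>Theta series times truncated theta sums\<close>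

lemma has_sum_finite_sum:
  fixes f :: "'a \<Rightarrow> 'b \<Rightarrow> complex"
  assumes "finite X" "\<And>x. x \<in> X \<Longrightarrow> (f x has_sum S x) A"
  shows "((\<lambda>m. \<Sum>x\<in>X. f x m) has_sum (\<Sum>x\<in>X. S x)) A"
  using assms by (induction X rule: finite_induct) (auto intro!: has_sum_add)

text \<open>Halving the end terms is what turns the usual 1 / (1 - y) into (1 + y) / (1 - y), which
  for y = s q^N is the odd function \<open>hyp q s N\<close>.\<close>

lemma trapezoid_geometric_sum:
  fixes y :: complex
  assumes "y \<noteq> 1"
  shows "(\<Sum>x\<le>N. y ^ x) - 1 / 2 - y ^ N / 2 = (1 - y ^ N) / 2 * ((1 + y) / (1 - y))"
  using assms by (simp add: sum_gp0 field_simps)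

definition theta_term :: "complex \<Rightarrow> complex \<Rightarrow> int \<Rightarrow> int \<Rightarrow> complex" where
  "theta_term q s \<mu> m = s powi m * q powi (m\<^sup>2 + \<mu> * m)"

text \<open>For N > 0 this is the sum over x = 0, ..., N with both end terms halved (trapezoidal rule); it is
  extended to an odd function of N.\<close>

definition trapezoid :: "complex \<Rightarrow> int \<Rightarrow> complex" where
  "trapezoid q N = of_int (sgn N) * ((\<Sum>x\<le>nat \<bar>N\<bar>. q ^ (x * (nat \<bar>N\<bar> - x))) - 1)"

text \<open>This is V a of the overview. Both factors tend to the sign of the argument (in
  \<open>trapezoid\<close> the two end terms contribute 1/2 each), so the product tends to 1 and the
  subtraction makes the series converge.\<close>

definition tanh_sum :: "complex \<Rightarrow> int \<Rightarrow> complex" where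
  "tanh_sum q a = (\<Sum>\<^sub>\<infinity>n. hyp q (-1) (2 * n + a) * trapezoid q (2 * n + a) - 1)"

abbreviation tnh :: "complex \<Rightarrow> int \<Rightarrow> complex" where "tnh q \<equiv> hyp q (-1)"
abbreviation cth :: "complex \<Rightarrow> int \<Rightarrow> complex" where "cth q \<equiv> hyp q 1"

text \<open>In these three cases the theta terms are invariant under m -> - m - \<mu>. In the
  remaining case s = -1, \<mu> = 1 they change sign and the series vanishes.\<close>

definition theta_char :: "complex \<Rightarrow> int \<Rightarrow> bool" where
  "theta_char s \<mu> \<longleftrightarrow> (s = 1 \<and> \<mu> = 1) \<or> (s = 1 \<and> \<mu> = 0) \<or> (s = -1 \<and> \<mu> = 0)"

lemma trapezoid_minus: "trapezoid q (- N) = - trapezoid q N"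
  by (simp add: trapezoid_def sgn_minus)

context nome
begin

lemma one_plus_q_powi [simp]: "1 + q powi k \<noteq> 0"
  using q_powi_ne(4)[of k] by (cases "k = 0") auto

lemma theta_term_norm:
  assumes "theta_char s \<mu>"
  shows "norm (theta_term q s \<mu> m) = \<rho> powi (m\<^sup>2 + \<mu> * m)"
  using assms by (auto simp: theta_char_def theta_term_def norm_mult norm_power_int)

lemma theta_term_bound:
  assumes "theta_char s \<mu>"
  shows "norm (theta_term q s \<mu> m) \<le> 1 / \<rho> * \<rho> ^ nat \<bar>m\<bar>"
proof -
  \<comment> \<open>The exponent is lowered by 1 because of the case \<mu> = 1, m = -1, where m^2 +
    m = 0.\<close>
  have "norm (theta_term q s \<mu> m) \<le> \<rho> powi (\<bar>m\<bar> - 1)"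
    unfolding theta_term_norm[OF assms]
  proof (rule rho_powi_le)
    have "0 \<le> (\<bar>m\<bar> - 1)^2" "\<mu> * m \<ge> -\<bar>m\<bar>" using assms by (auto simp: theta_char_def)
    moreover have "m^2 \<ge> \<bar>m\<bar>" using mult_left_mono[of 1 "\<bar>m\<bar>" "\<bar>m\<bar>"] by (cases "m = 0") (auto simp: power2_eq_square)
    moreover have "m^2 + m \<ge> \<bar>m\<bar> - 1"
    proof (cases "m \<ge> 0")
      case False
      then have "(m + 1)^2 \<ge> 0" by simp
      then show ?thesis using False by (simp add: power2_eq_square algebra_simps)
    qed (simp add: order_trans[of _ 0])
    ultimately show "\<bar>m\<bar> - 1 \<le> m\<^sup>2 + \<mu> * m" using assms by (auto simp: theta_char_def)
  qed
  also have "\<dots> = 1 / \<rho> * \<rho> ^ nat \<bar>m\<bar>"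
    using power_int_diff[of \<rho> "\<bar>m\<bar>" 1] by (simp add: power_int_def)
  finally show ?thesis .
qed

lemma theta_term_has_sum:
  assumes "theta_char s \<mu>"
  shows "(theta_term q s \<mu> has_sum gtheta q s \<mu>) UNIV"
proof -
  have "theta_term q s \<mu> summable_on UNIV"
    by (rule abs_summable_summable, rule abs_summable_on_int_exp[OF rho(1,2) theta_term_bound[OF assms]])
  then show ?thesis by (simp add: has_sum_iff gtheta_def theta_term_def[abs_def])
qed

lemma theta_term_reflect:
  assumes "theta_char s \<mu>"
  shows "theta_term q s \<mu> (- m - \<mu>) = theta_term q s \<mu> m"
  using assms by (auto simp: theta_char_def theta_term_def power2_eq_square algebra_simps power_int_minus_one_minus)

lemma theta_term_hyp_summable:
  assumes "theta_char s \<mu>" "s' = 1 \<or> s' = -1"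
  shows "(\<lambda>m. theta_term q s \<mu> m * hyp q s' (f m)) summable_on UNIV"
proof (rule abs_summable_summable, rule abs_summable_on_int_exp[OF rho(1,2)])
  fix m
  have "norm (theta_term q s \<mu> m * hyp q s' (f m)) \<le> (1 / \<rho> * \<rho> ^ nat \<bar>m\<bar>) * (3 / (1 - \<rho>))"
    unfolding norm_mult using hyp_bound[OF assms(2)] theta_term_bound[OF assms(1)]
    by (intro mult_mono) auto
  then show "norm (theta_term q s \<mu> m * hyp q s' (f m)) \<le> (3 / (1 - \<rho>) / \<rho>) * \<rho> ^ nat \<bar>m\<bar>"
    by (simp add: field_simps)
qed

lemma theta_char_s: "theta_char s \<mu> \<Longrightarrow> s = 1 \<or> s = -1"
  by (auto simp: theta_char_def)

text \<open>Put k = m + x in the theta series, so that the exponent becomes linear in x and the sum over x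
  is geometric; the two resulting halves agree after the reflection of m.\<close>

lemma theta_times_trapezoid_nat:
  assumes sm: "theta_char s \<mu>"
  shows "((\<lambda>m. theta_term q s \<mu> m * (hyp q s (int N + (2 * m + \<mu>)) + of_bool (s = 1 \<and> int N + (2 * m + \<mu>) = 0) * of_nat N))
           has_sum gtheta q s \<mu> * trapezoid q (int N)) UNIV"
proof -
  define e where "e = theta_term q s \<mu>"
  define G where "G = gtheta q s \<mu>"
  define y where "y m = s * q powi (int N + (2 * m + \<mu>))" for m
  define k where "k m = hyp q s (int N + (2 * m + \<mu>))" for m
  note s = theta_char_s[OF sm]
  have snz: "s \<noteq> 0" using s by auto
  have shift: "e (m + int x) * q ^ (x * (N - x)) = e m * y m ^ x" if "x \<le> N" for m x
  proof -
    have "q ^ (x * (N - x)) = q powi (int x * (int N - int x))"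
      using that by (simp add: power_int_def nat_mult_distrib flip: of_nat_diff)
    moreover have "y m ^ x = s powi int x * q powi ((int N + (2 * m + \<mu>)) * int x)"
      by (simp add: y_def power_mult_distrib power_int_mult)
    moreover have "s powi (m + int x) = s powi m * s powi int x"
      using snz by (simp add: power_int_add)
    moreover have "q powi ((m + int x)^2 + \<mu> * (m + int x)) * q powi (int x * (int N - int x))
        = q powi (m^2 + \<mu> * m) * q powi ((int N + (2 * m + \<mu>)) * int x)"
      by (subst (1 2) power_int_add[symmetric]) (auto simp: power2_eq_square algebra_simps)
    ultimately show ?thesis
      by (simp only: e_def theta_term_def mult_ac)
  qed
  have G: "(e has_sum G) UNIV" unfolding e_def G_def by (rule theta_term_has_sum[OF sm])
  have Gx: "((\<lambda>m. e m * y m ^ x) has_sum G * q ^ (x * (N - x))) UNIV" if "x \<le> N" for x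
  proof -
    have "((\<lambda>m. e (m + int x)) has_sum G) UNIV = (e has_sum G) UNIV"
      by (rule has_sum_reindex_bij_witness[of _ "\<lambda>m. m - int x" "\<lambda>m. m + int x"]) auto
    then have "((\<lambda>m. e (m + int x) * q ^ (x * (N - x))) has_sum G * q ^ (x * (N - x))) UNIV"
      using G by (intro has_sum_cmult_left) simp
    then show ?thesis using shift[OF that] by simp
  qed
  have y1: "y m = 1 \<longleftrightarrow> s = 1 \<and> int N + (2 * m + \<mu>) = 0" for m
    by (cases "int N + (2 * m + \<mu>) = 0")
      (use s q_powi_ne[of "int N + (2 * m + \<mu>)"] in \<open>auto simp: y_def minus_equation_iff\<close>)
  have ky: "k m = (1 + y m) / (1 - y m)" for m by (simp add: k_def y_def hyp_def)
  \<comment> \<open>At y = 1 all N + 1 terms are 1, so the trapezoidal sum is N, whereas division by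
    zero makes \<open>k m\<close> vanish: the value N has to be added by hand.\<close>
  have trap: "e m * ((\<Sum>x\<le>N. y m ^ x) - 1 / 2 - y m ^ N / 2)
       = e m * k m / 2 - e m * y m ^ N * k m / 2 + e m * (of_bool (y m = 1) * of_nat N)" for m
  proof (cases "y m = 1")
    case True
    then show ?thesis by (simp add: ky)
  next
    case False
    then show ?thesis unfolding trapezoid_geometric_sum[OF False] ky[symmetric]
      using False by (simp add: algebra_simps diff_divide_distrib)
  qed
  have "((\<lambda>m. e m * ((\<Sum>x\<le>N. y m ^ x) - 1 / 2 - y m ^ N / 2)) has_sum
      ((\<Sum>x\<le>N. G * q ^ (x * (N - x))) - G * (1/2) - G * q ^ (N * (N - N)) * (1 / 2))) UNIV"
    using has_sum_add[OF has_sum_add[OF has_sum_finite_sum[OF _ Gx, of "{..N}" "\<lambda>x. x"] has_sum_uminusI[OF has_sum_cmult_left[OF G, of "1/2"]]]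
       has_sum_uminusI[OF has_sum_cmult_left[OF Gx[of N], of "1/2"]]]
    by (simp add: algebra_simps sum_distrib_left)
  also have "(\<Sum>x\<le>N. G * q ^ (x * (N - x))) - G * (1/2) - G * q ^ (N * (N - N)) * (1 / 2) = G * trapezoid q (int N)"
    by (cases "N = 0") (simp_all add: trapezoid_def sum_distrib_left algebra_simps)
  finally have main: "((\<lambda>m. e m * k m / 2 - e m * y m ^ N * k m / 2 + e m * (of_bool (y m = 1) * of_nat N)) has_sum G * trapezoid q (int N)) UNIV"
    unfolding trap .
  obtain K where K: "((\<lambda>m. e m * k m) has_sum K) UNIV"
    using theta_term_hyp_summable[OF sm s, of "\<lambda>m. int N + (2 * m + \<mu>)"]
    by (auto simp: summable_on_def e_def k_def)
  \<comment> \<open>This map combines the shift by x = N with the reflection of the theta terms; it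
    exchanges the two ends of the geometric sum, and the sign comes from the oddness of
    \<open>hyp\<close>.\<close>
  have refl: "e (- m - int N - \<mu>) * y (- m - int N - \<mu>) ^ N * k (- m - int N - \<mu>) = - (e m * k m)" for m
  proof -
    have "e (- m - int N - \<mu>) * y (- m - int N - \<mu>) ^ N = e (- m - \<mu>)"
      using shift[of N "- m - int N - \<mu>"] by simp
    moreover have "int N + (2 * (- m - int N - \<mu>) + \<mu>) = - (int N + (2 * m + \<mu>))" by simp
    then have "k (- m - int N - \<mu>) = - k m"
      unfolding k_def by (simp only: hyp_minus[OF s])
    ultimately show ?thesis using theta_term_reflect[OF sm, of m] by (simp add: e_def)
  qed
  have "((\<lambda>m. - (e m * k m)) has_sum - K) UNIV = ((\<lambda>m. e m * y m ^ N * k m) has_sum - K) UNIV"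
    by (rule has_sum_reindex_bij_witness[of _ "\<lambda>m. - m - int N - \<mu>" "\<lambda>m. - m - int N - \<mu>"]) (use refl in auto)
  then have K': "((\<lambda>m. e m * y m ^ N * k m) has_sum - K) UNIV"
    using has_sum_uminusI[OF K] by simp
  have "((\<lambda>m. e m * (k m + of_bool (y m = 1) * of_nat N)) has_sum G * trapezoid q (int N)) UNIV"
    using has_sum_add[OF has_sum_add[OF main has_sum_divide_const[OF K, of 2]] has_sum_divide_const[OF K', of 2]]
    by (simp add: algebra_simps)
  then show ?thesis unfolding y1 by (simp add: e_def k_def G_def)
qed

text \<open>Both sides are odd in N, provided that m is replaced by - m - \<mu> at the same time;
  this carries the case N \<ge> 0 over to negative N.\<close>

lemma theta_times_trapezoid:
  assumes sm: "theta_char s \<mu>"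
  shows "((\<lambda>m. theta_term q s \<mu> m * (hyp q s (N + (2 * m + \<mu>)) + of_bool (s = 1 \<and> N + (2 * m + \<mu>) = 0) * of_int N))
           has_sum gtheta q s \<mu> * trapezoid q N) UNIV"
proof (cases "N \<ge> 0")
  case True
  then show ?thesis using theta_times_trapezoid_nat[OF sm, of "nat N"] by simp
next
  case False
  define f where "f N m = theta_term q s \<mu> m * (hyp q s (N + (2 * m + \<mu>)) + of_bool (s = 1 \<and> N + (2 * m + \<mu>) = 0) * of_int N)" for N m
  have *: "f N (- m - \<mu>) = - f (- N) m" for m
  proof -
    have e: "N + (2 * (- m - \<mu>) + \<mu>) = - (- N + (2 * m + \<mu>))" by simp
    show ?thesis
      unfolding f_def theta_term_reflect[OF sm] e hyp_minus[OF theta_char_s[OF sm]] neg_equal_0_iff_equal of_int_minus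
      by (simp only: ring_distribs mult_minus_right minus_add_distrib minus_minus)
  qed
  have "((\<lambda>m. - f (- N) m) has_sum - (gtheta q s \<mu> * trapezoid q (- N))) UNIV = (f N has_sum gtheta q s \<mu> * trapezoid q N) UNIV"
    by (rule has_sum_reindex_bij_witness[of _ "\<lambda>m. - m - \<mu>" "\<lambda>m. - m - \<mu>"]) (use * in \<open>auto simp: trapezoid_minus\<close>)
  moreover have "(f (- N) has_sum gtheta q s \<mu> * trapezoid q (- N)) UNIV"
    using theta_times_trapezoid_nat[OF sm, of "nat (- N)"] False unfolding f_def by simp
  ultimately show ?thesis unfolding f_def by (simp add: has_sum_uminusI)
qed

subsection \<open>Telescoping\<close>

text \<open>The subtraction theorem of tanh for the difference M = (N + M) - N, solved for the
  product. M = 0 is excluded because coth has its pole there.\<close>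

lemma tnh_times_tnh:
  assumes "M \<noteq> 0"
  shows "tnh q N * tnh q (N + M) - 1 = cth q M * (tnh q N - tnh q (N + M))"
proof -
  have "q powi (N + M) = q powi N * q powi M" by (simp add: power_int_add)
  then show ?thesis
    using q_powi_ne[OF assms] one_plus_q_powi[of N] one_plus_q_powi[of "N + M"]
    by (simp add: hyp_def divide_simps) (simp add: algebra_simps)
qed

text \<open>The corresponding addition theorem for a mixed product. At N + M = 0 the coth is
  replaced by its default value 0, and the last term repairs the identity there.\<close>

lemma tnh_times_cth:
  "tnh q N * cth q (N + M) - 1
     = - tnh q M * (cth q (N + M) - tnh q N) + of_bool (N + M = 0) * ((tnh q M)\<^sup>2 - 1)"
proof (cases "N + M = 0")
  case True
  then have N: "N = - M" by simp
  show ?thesis unfolding N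
    using hyp_minus[of "-1" M] hyp_zero[of 1] by (simp add: power2_eq_square)
next
  case False
  have "q powi (N + M) = q powi N * q powi M" by (simp add: power_int_add)
  then show ?thesis
    using q_powi_ne[OF False] one_plus_q_powi[of N] one_plus_q_powi[of M] False
    by (simp add: hyp_def divide_simps) (simp add: algebra_simps)
qed

text \<open>If |N| > |M|, then N and N + M have the same sign, and both factors lie within a
  multiple of \<rho>^(|N| - |M|) of it; otherwise the exponent is not positive and boundedness
  suffices. The loss of \<rho>^(- |M|) is paid for by the quadratic exponents of the theta
  terms.\<close>

lemma hyp_product_bound:
  assumes "s = 1 \<or> s = -1"
  shows "norm (tnh q N * hyp q s (N + M) - 1) \<le> (3 / (1 - \<rho>) + 1)\<^sup>2 * \<rho> powi (\<bar>N\<bar> - \<bar>M\<bar>)"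
proof -
  define K where "K = 3 / (1 - \<rho>)"
  have K: "K \<ge> 1" unfolding K_def using rho by (subst le_divide_eq_1_pos) linarith+
  have b: "norm (hyp q s N) \<le> K" "norm (hyp q s N - of_int (sgn N)) \<le> K * \<rho> powi \<bar>N\<bar>"
    if s: "s = 1 \<or> s = -1" for s N
  proof -
    show "norm (hyp q s N) \<le> K" using hyp_bound[OF s] by (simp add: K_def)
    have "2 / (1 - \<rho>) * \<rho> ^ nat \<bar>N\<bar> \<le> K * \<rho> ^ nat \<bar>N\<bar>"
      using rho unfolding K_def by (intro mult_right_mono divide_right_mono) auto
    then show "norm (hyp q s N - of_int (sgn N)) \<le> K * \<rho> powi \<bar>N\<bar>"
      using hyp_sgn[OF s, of N] by (simp add: power_int_def)
  qed
  show ?thesis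
  proof (cases "\<bar>N\<bar> > \<bar>M\<bar>")
    case False
    have "norm (tnh q N * hyp q s (N + M) - 1) \<le> norm (tnh q N) * norm (hyp q s (N + M)) + 1"
      using norm_triangle_ineq4[of "tnh q N * hyp q s (N + M)" 1] by (simp add: norm_mult)
    also have "\<dots> \<le> K * K + 1"
      using b(1)[of "-1" N] b(1)[OF assms, of "N + M"] K by (intro add_right_mono mult_mono) auto
    also have "\<dots> \<le> (K + 1)\<^sup>2 * 1" using K by (simp add: power2_eq_square algebra_simps)
    also have "\<dots> \<le> (K + 1)\<^sup>2 * \<rho> powi (\<bar>N\<bar> - \<bar>M\<bar>)"
      using rho_powi_le[of "\<bar>N\<bar> - \<bar>M\<bar>" 0] False by (intro mult_left_mono) auto
    finally show ?thesis by (simp add: K_def)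
  next
    case True
    define \<sigma> :: complex where "\<sigma> = of_int (sgn N)"
    define u v where "u = tnh q N - \<sigma>" and "v = hyp q s (N + M) - \<sigma>"
    define R where "R = \<rho> powi (\<bar>N\<bar> - \<bar>M\<bar>)"
    have sg: "sgn (N + M) = sgn N" "\<sigma> * \<sigma> = 1" "norm \<sigma> = 1" using True by (auto simp: \<sigma>_def sgn_if)
    have R: "0 < R" "R \<le> 1" using rho_powi_pos rho_powi_le[of 0 "\<bar>N\<bar> - \<bar>M\<bar>"] True by (auto simp: R_def)
    have "norm u \<le> K * \<rho> powi \<bar>N\<bar>" using b(2)[of "-1" N] by (simp add: u_def \<sigma>_def)
    also have "\<dots> \<le> K * R" unfolding R_def using K by (intro mult_left_mono rho_powi_le) auto
    finally have u: "norm u \<le> K * R" .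
    have "norm v \<le> K * \<rho> powi \<bar>N + M\<bar>" using b(2)[OF assms, of "N + M"] sg by (simp add: v_def \<sigma>_def)
    also have "\<dots> \<le> K * R" unfolding R_def using K True by (intro mult_left_mono rho_powi_le) auto
    finally have v: "norm v \<le> K * R" .
    have "tnh q N * hyp q s (N + M) - 1 = \<sigma> * (u + v) + u * v"
      using sg(2) by (simp add: u_def v_def algebra_simps)
    then have "norm (tnh q N * hyp q s (N + M) - 1) \<le> norm \<sigma> * (norm u + norm v) + norm u * norm v"
      by (metis (no_types, lifting) add_mono mult_left_mono norm_ge_zero norm_mult norm_triangle_ineq norm_triangle_le order_refl)
    also have "\<dots> \<le> (K * R + K * R) + (K * R) * (K * 1)"
      using sg(3) u v K R by (intro add_mono mult_mono) (auto intro: order_trans[OF v])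
    also have "\<dots> \<le> (K + 1)\<^sup>2 * R" using R K by (simp add: power2_eq_square algebra_simps)
    finally show ?thesis by (simp add: K_def R_def)
  qed
qed

lemma theta_hyp_product_summable:
  assumes sm: "theta_char s \<mu>"
  shows "(\<lambda>(n, m). theta_term q s \<mu> m * (tnh q (2 * n + a) * hyp q s (2 * n + a + (2 * m + \<mu>)) - 1))
    summable_on UNIV \<times> UNIV"
proof (rule summable_on_product_bound)
  define C where "C = (3 / (1 - \<rho>) + 1)\<^sup>2"
  have C: "C \<ge> 0" by (simp add: C_def)
  have pow: "(\<lambda>N::int. \<rho> ^ nat \<bar>N\<bar>) summable_on UNIV" using rho_power_summable[of 1] by simp
  then show "(\<lambda>n. \<rho> ^ nat \<bar>2 * n + a\<bar>) summable_on UNIV"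
    by (intro summable_on_progression[where f = "\<lambda>N. \<rho> ^ nat \<bar>N\<bar>"]) simp
  from pow show "(\<lambda>m. C * \<rho> powi (-3) * \<rho> ^ nat \<bar>m\<bar>) summable_on UNIV"
    by (intro summable_on_cmult_right) simp
  show "norm (case (n, m) of (n, m) \<Rightarrow> theta_term q s \<mu> m * (tnh q (2 * n + a) * hyp q s (2 * n + a + (2 * m + \<mu>)) - 1))
      \<le> \<rho> ^ nat \<bar>2 * n + a\<bar> * (C * \<rho> powi (-3) * \<rho> ^ nat \<bar>m\<bar>)" for n m
  proof -
    have "norm (theta_term q s \<mu> m * (tnh q (2 * n + a) * hyp q s (2 * n + a + (2 * m + \<mu>)) - 1))
        \<le> \<rho> powi (m\<^sup>2 + \<mu> * m) * (C * \<rho> powi (\<bar>2 * n + a\<bar> - \<bar>2 * m + \<mu>\<bar>))"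
      unfolding norm_mult theta_term_norm[OF sm] C_def
      by (intro mult_left_mono hyp_product_bound theta_char_s[OF sm] less_imp_le[OF rho_powi_pos])
    also have "\<dots> = C * (\<rho> powi \<bar>2 * n + a\<bar> * \<rho> powi (m\<^sup>2 + \<mu> * m - \<bar>2 * m + \<mu>\<bar>))"
      by (simp add: power_int_add power_int_diff)
    also have "\<dots> \<le> C * (\<rho> powi \<bar>2 * n + a\<bar> * \<rho> powi (-3 + \<bar>m\<bar>))"
    proof (intro mult_left_mono rho_powi_le C less_imp_le[OF rho_powi_pos])
      \<comment> \<open>The constant -3 is forced by m = -2, \<mu> = 1, where equality holds; the
        inequality follows from these completed squares.\<close>
      have *: "0 \<le> (m - 1)^2" "0 \<le> (m + 1)^2" "0 \<le> (m - 2)^2" "0 \<le> (m + 2)^2" by simp_all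
      consider "\<mu> = 0" | "\<mu> = 1" using sm by (auto simp: theta_char_def)
      then show "-3 + \<bar>m\<bar> \<le> m\<^sup>2 + \<mu> * m - \<bar>2 * m + \<mu>\<bar>"
        using * by cases (auto simp: power2_eq_square algebra_simps abs_if)
    qed
    also have "\<dots> = \<rho> ^ nat \<bar>2 * n + a\<bar> * (C * \<rho> powi (-3) * \<rho> ^ nat \<bar>m\<bar>)"
      by (subst power_int_add) (auto simp: power_int_def)
    finally show ?thesis by simp
  qed
qed (auto simp: rho_powi_pos less_imp_le)

text \<open>The absolutely convergent double series \<open>F\<close> is summed in both orders: at
  fixed n it restores the product of the theta series with a term of V a, at fixed m it telescopes
  to \<open>i m\<close>. The contribution b of the coth pole is kept apart, because its shape
  depends on the parities of a and \<mu>.\<close>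

lemma theta_times_tanh_sum:
  assumes sm: "theta_char s \<mu>"
    and B: "\<And>n. ((\<lambda>m. theta_term q s \<mu> m * (tnh q (2 * n + a) * (of_bool (s = 1 \<and> 2 * n + a + (2 * m + \<mu>) = 0) * of_int (2 * n + a))))
              has_sum b n) UNIV" "b summable_on UNIV"
    and I: "\<And>m. ((\<lambda>n. tnh q (2 * n + a) * hyp q s (2 * n + a + (2 * m + \<mu>)) - 1) has_sum i m) UNIV"
  shows "(\<lambda>m. theta_term q s \<mu> m * i m) summable_on UNIV" (is ?th1)
    and "gtheta q s \<mu> * tanh_sum q a = (\<Sum>\<^sub>\<infinity>m. theta_term q s \<mu> m * i m) + infsum b UNIV" (is ?th2)
    and "(\<lambda>n. gtheta q s \<mu> * (tnh q (2 * n + a) * trapezoid q (2 * n + a) - 1)) summable_on UNIV"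
proof -
  define F where "F n m = theta_term q s \<mu> m * (tnh q (2 * n + a) * hyp q s (2 * n + a + (2 * m + \<mu>)) - 1)" for n m
  have F: "(\<lambda>(n, m). F n m) summable_on UNIV \<times> UNIV"
    unfolding F_def by (rule theta_hyp_product_summable[OF sm])
  have F': "(\<lambda>(m, n). F n m) summable_on UNIV \<times> UNIV"
    using F by (subst summable_on_swap) (simp add: case_prod_unfold)
  have 1: "gtheta q s \<mu> * (tnh q (2 * n + a) * trapezoid q (2 * n + a) - 1) = infsum (F n) UNIV + b n" for n
  proof -
    have "((\<lambda>m. tnh q (2 * n + a) * (theta_term q s \<mu> m * (hyp q s (2 * n + a + (2 * m + \<mu>)) + of_bool (s = 1 \<and> 2 * n + a + (2 * m + \<mu>) = 0) * of_int (2 * n + a)))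
        - theta_term q s \<mu> m) has_sum tnh q (2 * n + a) * (gtheta q s \<mu> * trapezoid q (2 * n + a)) - gtheta q s \<mu>) UNIV"
      using has_sum_add[OF has_sum_cmult_right[OF theta_times_trapezoid[OF sm, of "2 * n + a"]] has_sum_uminusI[OF theta_term_has_sum[OF sm]]]
      by simp
    then have "((\<lambda>m. F n m + theta_term q s \<mu> m * (tnh q (2 * n + a) * (of_bool (s = 1 \<and> 2 * n + a + (2 * m + \<mu>) = 0) * of_int (2 * n + a))))
        has_sum gtheta q s \<mu> * (tnh q (2 * n + a) * trapezoid q (2 * n + a) - 1)) UNIV"
      unfolding F_def by (simp only: ring_distribs mult_ac mult_1_right mult_1_left add_diff_eq diff_add_eq)
    moreover have "(F n has_sum infsum (F n) UNIV) UNIV"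
      using summable_on_SigmaD1[OF F] by (simp add: has_sum_infsum)
    ultimately show ?thesis using has_sum_add[OF _ B(1)] has_sum_unique by blast
  qed
  have A: "(\<lambda>n. infsum (F n) UNIV) summable_on UNIV"
    using summable_on_Sigma_banach[OF F] by simp
  have 2: "infsum (\<lambda>n. F n m) UNIV = theta_term q s \<mu> m * i m" for m
    unfolding F_def by (intro infsumI has_sum_cmult_right I)
  show "(\<lambda>n. gtheta q s \<mu> * (tnh q (2 * n + a) * trapezoid q (2 * n + a) - 1)) summable_on UNIV"
    unfolding 1 by (rule summable_on_add[OF A B(2)])
  show ?th1 using summable_on_Sigma_banach[OF F'] by (simp add: 2)
  have "gtheta q s \<mu> * tanh_sum q a = (\<Sum>\<^sub>\<infinity>n. infsum (F n) UNIV + b n)"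
    unfolding tanh_sum_def by (subst infsum_cmult_right'[symmetric]) (simp add: 1)
  also have "\<dots> = (\<Sum>\<^sub>\<infinity>n. infsum (F n) UNIV) + infsum b UNIV"
    by (rule infsum_add[OF A B(2)])
  also have "(\<Sum>\<^sub>\<infinity>n. infsum (F n) UNIV) = (\<Sum>\<^sub>\<infinity>m. infsum (\<lambda>n. F n m) UNIV)"
    by (rule infsum_swap_banach[OF F])
  finally show ?th2 by (simp add: 2)
qed

lemma abs_summable_int_weighted:
  assumes sm: "theta_char s \<mu>" and "\<And>m. norm (f m) \<le> C * (1 + \<bar>of_int m\<bar>)"
  shows "(\<lambda>m. theta_term q s \<mu> m * f m) summable_on UNIV"
proof (rule abs_summable_summable, rule abs_summable_on_int[OF rho(1,2)])
  fix m
  have "norm (theta_term q s \<mu> m * f m) \<le> (1 / \<rho> * \<rho> ^ nat \<bar>m\<bar>) * (C * (1 + \<bar>of_int m\<bar>))"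
    unfolding norm_mult by (intro mult_mono assms(2) theta_term_bound sm) auto
  then show "norm (theta_term q s \<mu> m * f m) \<le> (C / \<rho>) * ((1 + \<bar>of_int m\<bar>) * \<rho> ^ nat \<bar>m\<bar>)"
    by (simp add: field_simps)
qed

lemma abs_summable_linear_hyp:
  assumes sm: "theta_char s \<mu>" and s': "s' = 1 \<or> s' = -1" and \<mu>': "\<mu>' = 0 \<or> \<mu>' = 1"
  shows "(\<lambda>m. theta_term q s \<mu> m * (of_int (2 * m + \<mu>') * hyp q s' (2 * m + \<mu>'))) summable_on UNIV"
proof (rule abs_summable_int_weighted[OF sm])
  fix m :: int
  have "norm (of_int (2 * m + \<mu>') * hyp q s' (2 * m + \<mu>')) = \<bar>of_int (2 * m + \<mu>')\<bar> * norm (hyp q s' (2 * m + \<mu>'))"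
    by (simp only: norm_mult norm_of_int of_int_abs)
  also have "\<dots> \<le> (2 * (1 + \<bar>of_int m\<bar>)) * (3 / (1 - \<rho>))"
    by (intro mult_mono hyp_bound s') (use \<mu>' in auto)
  also have "\<dots> = (6 / (1 - \<rho>)) * (1 + \<bar>of_int m\<bar>)" by simp
  finally show "norm (of_int (2 * m + \<mu>') * hyp q s' (2 * m + \<mu>')) \<le> (6 / (1 - \<rho>)) * (1 + \<bar>of_int m\<bar>)" .
qed

text \<open>The argument 2 n + a + 2 m + \<mu> can hit the pole 0 only if a = \<mu>. In that case
  the linear terms left by telescoping are cancelled by the pole contributions of
  \<open>theta_times_trapezoid\<close>, and only the tanh^2 - 1 from \<open>tnh_times_cth\<close>
  survives; otherwise the linear terms are all that remains.\<close>

lemma theta_times_tanh_sum_coth: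
  assumes sm: "theta_char 1 \<mu>" and a: "a = 0 \<or> a = 1"
  shows "gtheta q 1 \<mu> * tanh_sum q a =
    (if a = \<mu> then \<Sum>\<^sub>\<infinity>m. theta_term q 1 \<mu> m * ((tnh q (2 * m + \<mu>))\<^sup>2 - 1)
     else - (\<Sum>\<^sub>\<infinity>m. theta_term q 1 \<mu> m * (of_int (2 * m + \<mu>) * tnh q (2 * m + \<mu>))))"
proof -
  let ?e = "theta_term q 1 \<mu>"
  define i where "i m = - of_int (2 * m + \<mu>) * tnh q (2 * m + \<mu>) + of_bool (a = \<mu>) * ((tnh q (2 * m + \<mu>))\<^sup>2 - 1)" for m
  define b where "b n = (if a = \<mu> then ?e n * (of_int (2 * n + a) * tnh q (2 * n + a)) else 0)" for n
  have \<mu>: "\<mu> = 0 \<or> \<mu> = 1" using sm by (auto simp: theta_char_def)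
  have lin: "(\<lambda>m. ?e m * (of_int (2 * m + \<mu>) * tnh q (2 * m + \<mu>))) summable_on UNIV"
    by (rule abs_summable_linear_hyp[OF sm _ \<mu>]) simp
  have iff: "2 * n + a + (2 * m + \<mu>) = 0 \<longleftrightarrow> a = \<mu> \<and> m = - n - a" for n m :: int
    using a \<mu> by presburger
  have I: "((\<lambda>n. tnh q (2 * n + a) * hyp q 1 (2 * n + a + (2 * m + \<mu>)) - 1) has_sum i m) UNIV" for m
  proof -
    have "((\<lambda>n. hyp q 1 (2 * n + (a + (2 * m + \<mu>))) - tnh q (2 * n + a)) has_sum of_int (2 * m + \<mu>)) UNIV"
      using hyp_telescope[of 1 "-1" "a + (2 * m + \<mu>)" a] by simp
    from has_sum_cmult_right[OF this, of "- tnh q (2 * m + \<mu>)"]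
    have 1: "((\<lambda>n. - tnh q (2 * m + \<mu>) * (cth q (2 * n + a + (2 * m + \<mu>)) - tnh q (2 * n + a)))
        has_sum - of_int (2 * m + \<mu>) * tnh q (2 * m + \<mu>)) UNIV" by (simp add: algebra_simps)
    have 2: "((\<lambda>n. of_bool (2 * n + a + (2 * m + \<mu>) = 0) * ((tnh q (2 * m + \<mu>))\<^sup>2 - 1))
        has_sum of_bool (a = \<mu>) * ((tnh q (2 * m + \<mu>))\<^sup>2 - 1)) UNIV"
      by (rule has_sum_finite_neutralI[where B = "{- m - a}"]) (auto simp: iff)
    show ?thesis unfolding tnh_times_cth i_def by (rule has_sum_add[OF 1 2])
  qed
  have B: "((\<lambda>m. ?e m * (tnh q (2 * n + a) * (of_bool ((1::complex) = 1 \<and> 2 * n + a + (2 * m + \<mu>) = 0) * of_int (2 * n + a))))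
              has_sum b n) UNIV" for n
    unfolding iff by (rule has_sum_finite_neutralI[where B = "{- n - a}"])
      (use theta_term_reflect[OF sm, of n] in \<open>auto simp: b_def algebra_simps\<close>)
  have bs: "b summable_on UNIV"
    using lin by (cases "a = \<mu>") (simp_all add: b_def[abs_def])
  note main = theta_times_tanh_sum[OF sm B bs I]
  show ?thesis
  proof (cases "a = \<mu>")
    case True
    have "gtheta q 1 \<mu> * tanh_sum q a = (\<Sum>\<^sub>\<infinity>m. ?e m * i m + b m)"
      using main infsum_add[OF main(1) bs] by simp
    also have "\<dots> = (\<Sum>\<^sub>\<infinity>m. ?e m * ((tnh q (2 * m + \<mu>))\<^sup>2 - 1))"
      by (rule infsum_cong) (simp add: i_def b_def True algebra_simps)
    finally show ?thesis using True by simp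
  next
    case False
    then have "infsum b UNIV = 0" by (simp add: b_def[abs_def])
    with False show ?thesis using main(2) by (simp add: i_def b_def infsum_uminus[symmetric] algebra_simps)
  qed
qed

text \<open>For s = -1 there is no pole, but the addition theorem fails for the shift m = 0; that
  single column contributes the sum of tanh^2 - 1 and all others telescope.\<close>

lemma theta_times_tanh_sum_tanh:
  shows "gtheta q (-1) 0 * tanh_sum q a = (\<Sum>\<^sub>\<infinity>n. (tnh q (2 * n + a))\<^sup>2 - 1)
      - (\<Sum>\<^sub>\<infinity>m. theta_term q (-1) 0 m * (of_int (2 * m) * cth q (2 * m)))" (is ?th1)
    and "(\<lambda>n. gtheta q (-1) 0 * (tnh q (2 * n + a) * trapezoid q (2 * n + a) - 1)) summable_on UNIV" (is ?th2)
proof -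
  have sm: "theta_char (-1) 0" by (simp add: theta_char_def)
  let ?e = "theta_term q (-1) 0"
  define Q where "Q = (\<Sum>\<^sub>\<infinity>n. (tnh q (2 * n + a))\<^sup>2 - 1)"
  define i where "i m = - (of_int (2 * m) * cth q (2 * m)) + of_bool (m = 0) * Q" for m
  have F: "(\<lambda>(n, m). ?e m * (tnh q (2 * n + a) * hyp q (-1) (2 * n + a + (2 * m + 0)) - 1)) summable_on UNIV \<times> UNIV"
    by (rule theta_hyp_product_summable[OF sm])
  have "(\<lambda>(m, n). ?e m * (tnh q (2 * n + a) * hyp q (-1) (2 * n + a + (2 * m + 0)) - 1)) summable_on UNIV \<times> UNIV"
    using F by (subst summable_on_swap) (simp add: case_prod_unfold)
  from summable_on_SigmaD1[OF this, of 0]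
  have "(\<lambda>n. (tnh q (2 * n + a))\<^sup>2 - 1) summable_on UNIV" by (simp add: theta_term_def power2_eq_square)
  then have Q: "((\<lambda>n. (tnh q (2 * n + a))\<^sup>2 - 1) has_sum Q) UNIV" by (simp add: Q_def)
  have I: "((\<lambda>n. tnh q (2 * n + a) * hyp q (-1) (2 * n + a + (2 * m + 0)) - 1) has_sum i m) UNIV" for m
  proof (cases "m = 0")
    case True
    then show ?thesis using Q by (simp add: i_def power2_eq_square)
  next
    case False
    have "((\<lambda>n. tnh q (2 * n + a) - tnh q (2 * n + (a + 2 * m))) has_sum - of_int (2 * m)) UNIV"
      using hyp_telescope[of "-1" "-1" a "a + 2 * m"] by simp
    from has_sum_cmult_right[OF this, of "cth q (2 * m)"]
    have X: "((\<lambda>n. cth q (2 * m) * (tnh q (2 * n + a) - tnh q (2 * n + a + 2 * m)))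
        has_sum - (of_int (2 * m) * cth q (2 * m))) UNIV" by (simp add: algebra_simps)
    have "2 * m \<noteq> 0" using False by simp
    from X show ?thesis unfolding add_0_right tnh_times_tnh[OF \<open>2 * m \<noteq> 0\<close>] using False by (simp add: i_def)
  qed
  have B: "((\<lambda>m. ?e m * (tnh q (2 * n + a) * (of_bool ((-1::complex) = 1 \<and> 2 * n + a + (2 * m + 0) = 0) * of_int (2 * n + a))))
              has_sum 0) UNIV" for n by (simp add: has_sum_0)
  have main: "gtheta q (-1) 0 * tanh_sum q a = (\<Sum>\<^sub>\<infinity>m. ?e m * i m)"
    using theta_times_tanh_sum(2)[OF sm B _ I] by simp
  show ?th2 by (rule theta_times_tanh_sum(3)[OF sm B _ I]) simp
  have "((\<lambda>m. - (?e m * (of_int (2 * m) * cth q (2 * m)))) has_sum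
      - (\<Sum>\<^sub>\<infinity>m. ?e m * (of_int (2 * m) * cth q (2 * m)))) UNIV"
    using abs_summable_linear_hyp[OF sm, of 1 0] by (intro has_sum_uminusI) simp
  moreover have "((\<lambda>m. ?e m * (of_bool (m = 0) * Q)) has_sum Q) UNIV"
    by (rule has_sum_finite_neutralI[where B = "{0}"]) (auto simp: theta_term_def)
  ultimately have "((\<lambda>m. ?e m * i m) has_sum - (\<Sum>\<^sub>\<infinity>m. ?e m * (of_int (2 * m) * cth q (2 * m))) + Q) UNIV"
    unfolding i_def ring_distribs mult_minus_right by (rule has_sum_add)
  then show ?th1 using main by (simp add: infsumI Q_def)
qed

end

subsection \<open>The series in (i)-(iii)\<close>

lemma infsum_int_even:
  fixes f :: "int \<Rightarrow> complex"
  assumes "f summable_on UNIV" "\<And>n. f (- n) = f n"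
  shows "infsum f UNIV = f 0 + 2 * (\<Sum>\<^sub>\<infinity>n\<in>{1..}. f (int n))"
proof -
  have *: "infsum f {1..} = (\<Sum>\<^sub>\<infinity>n\<in>{1..}. f (int n))"
    by (rule infsum_reindex_bij_witness[of _ int nat]) auto
  have **: "infsum f {..-1} = (\<Sum>\<^sub>\<infinity>n\<in>{1..}. f (int n))"
    by (rule infsum_reindex_bij_witness[of _ "\<lambda>n. - int n" "\<lambda>n. nat (- n)"]) (use assms(2) in auto)
  have U: "UNIV = insert 0 ({1..} \<union> {..-1::int})" by auto
  have "f summable_on A" for A using assms(1) by (rule summable_on_subset_banach) auto
  then have "infsum f UNIV = f 0 + (infsum f {1..} + infsum f {..-1})"
    by (subst U, subst infsum_insert) (auto intro!: infsum_Un_disjoint)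
  then show ?thesis by (simp add: * **)
qed

lemma infsum_int_even':
  fixes f :: "int \<Rightarrow> complex"
  assumes "f summable_on UNIV" "\<And>n. f (- n - 1) = f n"
  shows "infsum f UNIV = 2 * (\<Sum>\<^sub>\<infinity>n. f (int n))"
proof -
  have *: "infsum f {0..} = (\<Sum>\<^sub>\<infinity>n. f (int n))"
    by (rule infsum_reindex_bij_witness[of _ int nat]) auto
  have **: "infsum f {..-1} = (\<Sum>\<^sub>\<infinity>n. f (int n))"
    by (rule infsum_reindex_bij_witness[of _ "\<lambda>n. - int n - 1" "\<lambda>n. nat (- n - 1)"])
      (use assms(2) in \<open>auto simp: algebra_simps\<close>)
  have U: "UNIV = {0..} \<union> {..-1::int}" by auto
  have "f summable_on A" for A using assms(1) by (rule summable_on_subset_banach) auto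
  then have "infsum f UNIV = infsum f {0..} + infsum f {..-1}"
    by (subst U) (auto intro!: infsum_Un_disjoint)
  then show ?thesis by (simp add: * **)
qed

lemma infsum_int_parity:
  fixes f :: "int \<Rightarrow> complex"
  assumes "f summable_on UNIV"
  shows "infsum f UNIV = (\<Sum>\<^sub>\<infinity>n. f (2 * n)) + (\<Sum>\<^sub>\<infinity>n. f (2 * n + 1))"
proof -
  have e: "infsum f {n. even n} = (\<Sum>\<^sub>\<infinity>n. f (2 * n))"
    by (rule infsum_reindex_bij_witness[of _ "\<lambda>n. 2 * n" "\<lambda>n. n div 2"]) auto
  have o: "infsum f {n. odd n} = (\<Sum>\<^sub>\<infinity>n. f (2 * n + 1))"
    by (rule infsum_reindex_bij_witness[of _ "\<lambda>n. 2 * n + 1" "\<lambda>n. n div 2"]) auto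
  have U: "UNIV = {n. even n} \<union> {n::int. odd n}" by auto
  have "f summable_on A" for A using assms(1) by (rule summable_on_subset_banach) auto
  then have "infsum f UNIV = infsum f {n. even n} + infsum f {n. odd n}"
    by (subst U) (auto intro!: infsum_Un_disjoint)
  then show ?thesis by (simp add: e o)
qed

text \<open>Cutting a Lambert double series along its diagonal produces exponents n (n + d), hence
  squares n^2, out of products n d; \<open>ser_A_eq\<close> rests on this.\<close>

lemma infsum_pairs_trichotomy:
  fixes F :: "nat \<times> nat \<Rightarrow> complex"
  assumes "F summable_on {1..} \<times> {1..}"
  shows "(\<Sum>\<^sub>\<infinity>x\<in>{1..} \<times> {1..}. F x) = (\<Sum>\<^sub>\<infinity>(n, d)\<in>{1..} \<times> {1..}. F (n, n + d)) +
    (\<Sum>\<^sub>\<infinity>(n, d)\<in>{1..} \<times> {1..}. F (n + d, n)) + (\<Sum>\<^sub>\<infinity>n\<in>{1..}. F (n, n))"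
    and "(\<lambda>(n, d). F (n, n + d)) summable_on {1..} \<times> {1..}"
    and "(\<lambda>(n, d). F (n + d, n)) summable_on {1..} \<times> {1..}"
    and "(\<lambda>n. F (n, n)) summable_on {1..}"
proof -
  define L E G where "L = {(n, d). 1 \<le> n \<and> n < (d::nat)}" and "E = {(n, d). 1 \<le> n \<and> n = (d::nat)}"
    and "G = {(n, d). 1 \<le> d \<and> d < (n::nat)}"
  have sub: "F summable_on A" if "A \<subseteq> {1..} \<times> {1..}" for A
    using assms that by (rule summable_on_subset_banach)
  have s: "F summable_on L" "F summable_on E" "F summable_on G"
    by (rule sub, auto simp: L_def E_def G_def)+
  have U: "{1..} \<times> {1..} = (L \<union> G) \<union> E" by (auto simp: L_def E_def G_def)
  have LG: "infsum F (L \<union> G) = infsum F L + infsum F G"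
    by (rule infsum_Un_disjoint) (use s in \<open>auto simp: L_def G_def\<close>)
  have "infsum F ((L \<union> G) \<union> E) = infsum F (L \<union> G) + infsum F E"
    by (rule infsum_Un_disjoint) (use s in \<open>auto simp: L_def E_def G_def intro!: sub\<close>)
  then have 1: "infsum F ({1..} \<times> {1..}) = infsum F L + infsum F G + infsum F E" unfolding U by (simp only: LG)
  have L: "((\<lambda>(n, d). F (n, n + d)) has_sum x) ({1..} \<times> {1..}) \<longleftrightarrow> (F has_sum x) L" for x
    by (rule has_sum_reindex_bij_witness[of _ "\<lambda>(n, d). (n, d - n)" "\<lambda>(n, d). (n, n + d)"]) (auto simp: L_def)
  have G: "((\<lambda>(n, d). F (n + d, n)) has_sum x) ({1..} \<times> {1..}) \<longleftrightarrow> (F has_sum x) G" for x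
    by (rule has_sum_reindex_bij_witness[of _ "\<lambda>(n, d). (d, n - d)" "\<lambda>(n, d). (n + d, n)"]) (auto simp: G_def)
  have E: "((\<lambda>n. F (n, n)) has_sum x) {1..} \<longleftrightarrow> (F has_sum x) E" for x
    by (rule has_sum_reindex_bij_witness[of _ fst "\<lambda>n. (n, n)"]) (auto simp: E_def)
  note h = s[THEN has_sum_infsum]
  show "(\<Sum>\<^sub>\<infinity>x\<in>{1..} \<times> {1..}. F x) = (\<Sum>\<^sub>\<infinity>(n, d)\<in>{1..} \<times> {1..}. F (n, n + d)) +
    (\<Sum>\<^sub>\<infinity>(n, d)\<in>{1..} \<times> {1..}. F (n + d, n)) + (\<Sum>\<^sub>\<infinity>n\<in>{1..}. F (n, n))"
    unfolding 1 using h[folded L G E] by (simp add: infsumI)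
  show "(\<lambda>(n, d). F (n, n + d)) summable_on {1..} \<times> {1..}"
    "(\<lambda>(n, d). F (n + d, n)) summable_on {1..} \<times> {1..}" "(\<lambda>n. F (n, n)) summable_on {1..}"
    using h[folded L G E] by (auto simp: summable_on_def)
qed

lemma has_sum_n_times_power:
  fixes x :: complex
  assumes "norm x < 1"
  shows "((\<lambda>d. of_nat d * x ^ d) has_sum (x / (1 - x)\<^sup>2)) {1..}"
proof -
  have "(\<lambda>n. of_nat (Suc n) * x ^ n) sums (1 / (1 - x)\<^sup>2)" by (rule geometric_deriv_sums[OF assms])
  then have "(\<lambda>n. x * (of_nat (Suc n) * x ^ n)) sums (x * (1 / (1 - x)\<^sup>2))" by (rule sums_mult)
  moreover have "(\<lambda>n. norm (x * (of_nat (Suc n) * x ^ n))) = (\<lambda>n. norm x * (of_nat (Suc n) * norm x ^ n))"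
    by (simp add: norm_mult norm_power del: of_nat_Suc)
  moreover have "summable (\<lambda>n. norm x * (of_nat (Suc n) * norm x ^ n))"
    using geometric_deriv_sums[of "norm x"] assms by (intro summable_mult) (auto simp: sums_iff)
  ultimately have "((\<lambda>n. x * (of_nat (Suc n) * x ^ n)) has_sum (x / (1 - x)\<^sup>2)) UNIV"
    by (intro norm_summable_imp_has_sum) auto
  also have "?this \<longleftrightarrow> ?thesis"
    by (intro has_sum_reindex_bij_witness[of _ "\<lambda>n. n - 1" "\<lambda>n. n + 1"]) (auto simp: algebra_simps)
  finally show ?thesis .
qed

definition ser_A :: "complex \<Rightarrow> complex" where
  "ser_A q = (\<Sum>\<^sub>\<infinity>n. (-1) powi n * q powi (n\<^sup>2 + n) / (1 + q powi n)\<^sup>2)"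

definition ser_B :: "complex \<Rightarrow> complex" where
  "ser_B q = (\<Sum>\<^sub>\<infinity>n. (-1) powi n * q powi (n\<^sup>2 + 2 * n) / (1 + q powi (2 * n))\<^sup>2)"

definition ser_C :: "complex \<Rightarrow> complex" where
  "ser_C q = (\<Sum>\<^sub>\<infinity>n. of_nat n * q ^ (n\<^sup>2) * (1 - q ^ (2 * n)) / (1 + q ^ (2 * n)))"

definition ser_D :: "complex \<Rightarrow> complex" where
  "ser_D q = (\<Sum>\<^sub>\<infinity>n. q ^ (n\<^sup>2 + 3 * n + 1) / (1 - q ^ (2 * n + 1))\<^sup>2)"

lemma gtheta_minus_1_0: "gtheta (- q) 1 0 = gtheta q (-1) 0"
  unfolding gtheta_def by (rule infsum_cong) (simp add: power_int_minus_left)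

lemma gtheta_minus_1_1: "gtheta (- q) 1 1 = gtheta q 1 1"
  unfolding gtheta_def by (rule infsum_cong) (simp add: power_int_minus_left)

context nome
begin

text \<open>With q = exp (- 2 u) this is 1 / (4 cosh^2 (N u)).\<close>

definition sech2 :: "int \<Rightarrow> complex" where "sech2 N = q powi N / (1 + q powi N)\<^sup>2"

lemma tnh_squared: "(tnh q N)\<^sup>2 - 1 = - 4 * sech2 N"
proof -
  have "1 + q powi N \<noteq> 0" by simp
  then show ?thesis unfolding hyp_def sech2_def
    by (simp add: power_divide divide_simps) (simp add: power2_eq_square algebra_simps)
qed

lemma sech2_minus: "sech2 (- N) = sech2 N"
proof -
  have "1 + q powi N \<noteq> 0" by simp
  then show ?thesis by (simp add: sech2_def power_int_minus field_simps power2_eq_square)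
qed

lemma sech2_bound: "norm (sech2 N) \<le> (1 / (1 - \<rho>))\<^sup>2 * \<rho> ^ nat \<bar>N\<bar>"
proof -
  have pos: "norm (sech2 N) \<le> (1 / (1 - \<rho>))\<^sup>2 * \<rho> ^ nat \<bar>N\<bar>" if "N \<ge> 0" for N
  proof (cases "N = 0")
    case True
    have "1 \<le> 1 / (1 - \<rho>)" using rho by (subst le_divide_eq_1_pos) auto
    then have "1 \<le> (1 / (1 - \<rho>))\<^sup>2" by (rule one_le_power)
    then show ?thesis using True by (simp add: sech2_def)
  next
    case False
    have "norm (q powi N) \<le> \<rho> powi 1" unfolding norm_power_int using that False by (intro rho_powi_le) auto
    then have "1 - \<rho> \<le> norm (1 + q powi N)" using norm_triangle_ineq4[of "1 + q powi N" "q powi N"] by simp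
    then have "1 / norm (1 + q powi N) \<le> 1 / (1 - \<rho>)" using rho by (intro divide_left_mono) auto
    then have "(1 / norm (1 + q powi N))\<^sup>2 * norm (q powi N) \<le> (1 / (1 - \<rho>))\<^sup>2 * norm (q powi N)"
      by (intro mult_right_mono power_mono) auto
    then show ?thesis using that by (simp add: sech2_def norm_divide norm_power power_divide norm_power_int power_int_def)
  qed
  show ?thesis using pos[of N] pos[of "-N"] sech2_minus[of N] by (cases "N \<ge> 0") auto
qed

lemma sech2_summable: "sech2 summable_on UNIV"
  by (rule abs_summable_summable, rule abs_summable_on_int_exp[OF rho(1,2) sech2_bound])

lemma theta_sech2_summable:
  assumes "theta_char s \<mu>"
  shows "(\<lambda>m. theta_term q s \<mu> m * sech2 (g m)) summable_on UNIV"
proof (rule abs_summable_int_weighted[OF assms])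
  fix m :: int
  have "norm (sech2 (g m)) \<le> (1 / (1 - \<rho>))\<^sup>2 * \<rho> ^ nat \<bar>g m\<bar>" by (rule sech2_bound)
  also have "\<dots> \<le> (1 / (1 - \<rho>))\<^sup>2 * (1 + \<bar>of_int m\<bar>)"
    using power_le_one[of \<rho>] rho by (intro mult_left_mono) (auto intro: order_trans[of _ 1])
  finally show "norm (sech2 (g m)) \<le> (1 / (1 - \<rho>))\<^sup>2 * (1 + \<bar>of_int m\<bar>)" .
qed

text \<open>It is applied at -q, where (-q)^(n^2 + 2 n) supplies the sign (-1)^n of
  \<open>ser_B\<close>.\<close>

lemma V0_eq: "gtheta q 1 0 * tanh_sum q 0 = - 4 * (\<Sum>\<^sub>\<infinity>n. q powi (n\<^sup>2 + 2 * n) / (1 + q powi (2 * n))\<^sup>2)"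
proof -
  have "gtheta q 1 0 * tanh_sum q 0 = (\<Sum>\<^sub>\<infinity>m. theta_term q 1 0 m * ((tnh q (2 * m + 0))\<^sup>2 - 1))"
    using theta_times_tanh_sum_coth[of 0 0] by (simp add: theta_char_def)
  also have "\<dots> = (\<Sum>\<^sub>\<infinity>n. - 4 * (q powi (n\<^sup>2 + 2 * n) / (1 + q powi (2 * n))\<^sup>2))"
    by (rule infsum_cong) (simp add: tnh_squared sech2_def theta_term_def power_int_add)
  finally show ?thesis by (simp only: infsum_cmult_right')
qed

lemma V1_C_eq: "gtheta q 1 0 * tanh_sum q 1 = - 4 * ser_C q"
proof -
  have t: "theta_char 1 0" by (simp add: theta_char_def)
  define f where "f m = theta_term q 1 0 m * (of_int (2 * m) * tnh q (2 * m))" for m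
  have "gtheta q 1 0 * tanh_sum q 1 = - infsum f UNIV"
    using theta_times_tanh_sum_coth[of 0 1] t by (simp add: f_def[abs_def])
  also have "infsum f UNIV = f 0 + 2 * (\<Sum>\<^sub>\<infinity>n\<in>{1..}. f (int n))"
  proof (rule infsum_int_even)
    show "f summable_on UNIV"
      using abs_summable_linear_hyp[OF t, of "-1" 0] by (simp add: f_def[abs_def])
    show "f (- n) = f n" for n
      using theta_term_reflect[OF t, of n] hyp_minus[of "-1" "2 * n"] by (simp add: f_def)
  qed
  also have "(\<Sum>\<^sub>\<infinity>n\<in>{1..}. f (int n)) = 2 * ser_C q"
    unfolding ser_C_def infsum_cmult_right'[symmetric]
  proof (rule infsum_cong_neutral)
    show "f (int n) = 2 * (of_nat n * q ^ n\<^sup>2 * (1 - q ^ (2 * n)) / (1 + q ^ (2 * n)))" for n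
      by (simp add: f_def theta_term_def hyp_def power_int_def nat_mult_distrib nat_power_eq)
  qed auto
  finally show ?thesis by (simp add: f_def)
qed

text \<open>It is applied at -q, where the odd exponents 2 n + 1 turn the denominators into those of
  \<open>ser_D\<close>. One factor 2 in the constant comes from folding the sum over all integers by
  the reflection m -> - m - 1.\<close>

lemma V1_D_eq: "gtheta q 1 1 * tanh_sum q 1 = - 8 * (\<Sum>\<^sub>\<infinity>n. q ^ (n\<^sup>2 + 3 * n + 1) / (1 + q ^ (2 * n + 1))\<^sup>2)"
proof -
  have t: "theta_char 1 1" by (simp add: theta_char_def)
  define f where "f m = theta_term q 1 1 m * sech2 (2 * m + 1)" for m
  have "gtheta q 1 1 * tanh_sum q 1 = (\<Sum>\<^sub>\<infinity>m. - 4 * f m)"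
    using theta_times_tanh_sum_coth[of 1 1] t by (simp add: f_def[abs_def] tnh_squared mult.left_commute)
  also have "\<dots> = - 4 * infsum f UNIV" by (rule infsum_cmult_right')
  also have "infsum f UNIV = 2 * (\<Sum>\<^sub>\<infinity>n. f (int n))"
  proof (rule infsum_int_even')
    show "f summable_on UNIV" unfolding f_def by (rule theta_sech2_summable[OF t])
    have *: "2 * (- n - 1) + 1 = - (2 * n + 1)" for n :: int by simp
    show "f (- n - 1) = f n" for n
      unfolding f_def * sech2_minus using theta_term_reflect[OF t, of n] by simp
  qed
  also have "(\<Sum>\<^sub>\<infinity>n. f (int n)) = (\<Sum>\<^sub>\<infinity>n. q ^ (n\<^sup>2 + 3 * n + 1) / (1 + q ^ (2 * n + 1))\<^sup>2)"
  proof (rule infsum_cong)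
    fix n :: nat
    have 1: "(int n)\<^sup>2 + 1 * int n + (2 * int n + 1) = int (n\<^sup>2 + 3 * n + 1)" by simp
    have 2: "2 * int n + 1 = int (2 * n + 1)" by simp
    have "f (int n) = q powi ((int n)\<^sup>2 + 1 * int n + (2 * int n + 1)) / (1 + q powi (2 * int n + 1))\<^sup>2"
      unfolding f_def theta_term_def sech2_def by (subst (2) power_int_add) auto
    then show "f (int n) = q ^ (n\<^sup>2 + 3 * n + 1) / (1 + q ^ (2 * n + 1))\<^sup>2"
      unfolding 1 unfolding 2 power_int_of_nat .
  qed
  finally show ?thesis by simp
qed

text \<open>The coth series on the right does not depend on a: it cancels in V 1 - V 0 (see
  \<open>th4_cubed\<close>), and it is what \<open>ser_A_eq\<close> has to absorb in V 0 + V
  1.\<close>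

lemma V_sum_diff:
  "gtheta q (-1) 0 * tanh_sum q a = - 4 * (\<Sum>\<^sub>\<infinity>n. sech2 (2 * n + a))
      - 2 * (\<Sum>\<^sub>\<infinity>m. theta_term q (-1) 0 m * (of_int m * cth q (2 * m)))"
  unfolding theta_times_tanh_sum_tanh(1) tnh_squared infsum_cmult_right'[symmetric]
  by (simp add: algebra_simps)

lemma sech2_has_sum:
  assumes "n \<ge> 1"
  shows "((\<lambda>d. - of_nat d * (-1) ^ d * q ^ (n * d)) has_sum sech2 (int n)) {1..}"
proof -
  have "norm (- (q ^ n)) < 1" using q_lt assms by (simp add: norm_power power_less_one_iff)
  from has_sum_uminusI[OF has_sum_n_times_power[OF this]]
  show ?thesis by (simp add: sech2_def power_mult power_minus[of "q ^ n"] mult.assoc)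
qed

lemma rho_nat_summable: "(\<lambda>n::nat. \<rho> ^ n) summable_on A"
proof -
  have "(\<lambda>n::nat. \<rho> ^ n) summable_on UNIV"
    using rho by (intro summable_nonneg_imp_summable_on summable_geometric) auto
  then show ?thesis by (rule summable_on_subset_banach) auto
qed

lemma rho_n_summable: "(\<lambda>d. of_nat d * \<rho> ^ d) summable_on {1..}"
proof -
  have "(\<lambda>d. of_nat d * complex_of_real \<rho> ^ d) summable_on {1..}"
    using has_sum_n_times_power[of "complex_of_real \<rho>"] rho by (auto simp: summable_on_def)
  then have "(\<lambda>d. norm (of_nat d * complex_of_real \<rho> ^ d)) summable_on {1..}"
    by (rule summable_on_iff_abs_summable_on_complex[THEN iffD1])
  then show ?thesis by (simp add: norm_mult norm_power)
qed

text \<open>The divisor-sum rearrangement. Expand \<open>sech2 n\<close> as the Lambert series of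
  terms F (n, d) with multiplicity d and cut along the diagonal. For d > n the multiplicity splits
  as (d - n) + n: the part d - n gives \<open>ser_A\<close>, while the part n joins the terms below
  the diagonal, whose multiplicity is the smaller index as well, and together they form the coth
  series of \<open>V_sum_diff\<close>.\<close>

lemma ser_A_eq: "4 * ser_A q = - gtheta q (-1) 0 * (tanh_sum q 0 + tanh_sum q 1)"
proof -
  have t: "theta_char (-1) 0" by (simp add: theta_char_def)
  define P where "P = {1::nat..} \<times> {1::nat..}"
  define F :: "nat \<times> nat \<Rightarrow> complex" where "F = (\<lambda>(n, d). - of_nat d * (-1) ^ d * q ^ (n * d))"
  define S where "S = (\<Sum>\<^sub>\<infinity>m. theta_term q (-1) 0 m * (of_int m * cth q (2 * m)))"
  define A' :: "nat \<times> nat \<Rightarrow> complex" where "A' = (\<lambda>(n, d). (-1) ^ n * q ^ (n\<^sup>2) * F (n, d))"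
  have bound: "norm (F (n, d)) \<le> \<rho> ^ n * (1 / \<rho> * (of_nat d * \<rho> ^ d))" if "n \<ge> 1" "d \<ge> 1" for n d
  proof -
    \<comment> \<open>This gives n + d \<le> n d + 1; the surplus 1 is the factor 1 / \<rho> of the
      bound.\<close>
    have "0 \<le> (int n - 1) * (int d - 1)" using that by simp
    then have "int (n + d) \<le> int (Suc (n * d))" by (simp add: algebra_simps)
    then have "n + d \<le> Suc (n * d)" by linarith
    then have "\<rho> ^ Suc (n * d) \<le> \<rho> ^ (n + d)" using rho by (intro power_decreasing) auto
    then have "\<rho> * \<rho> ^ (n * d) \<le> \<rho> ^ (n + d)" by simp
    then have "of_nat d * (\<rho> * \<rho> ^ (n * d)) \<le> of_nat d * \<rho> ^ (n + d)" by (rule mult_left_mono) simp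
    then have "of_nat d * \<rho> ^ (n * d) \<le> of_nat d * \<rho> ^ (n + d) / \<rho>"
      using rho(1) by (simp add: pos_le_divide_eq mult_ac)
    then show ?thesis
      by (simp add: F_def norm_mult norm_power power_add mult_ac)
  qed
  have sg: "(\<lambda>n::nat. \<rho> ^ n) summable_on {1..}" "(\<lambda>d. 1 / \<rho> * (of_nat d * \<rho> ^ d)) summable_on {1..}"
  proof -
    show "(\<lambda>n::nat. \<rho> ^ n) summable_on {1..}" by (rule rho_nat_summable)
    from rho_n_summable
    show "(\<lambda>d. 1 / \<rho> * (of_nat d * \<rho> ^ d)) summable_on {1..}"
      by (rule summable_on_cmult_right)
  qed
  have F: "F summable_on P" unfolding P_def
    by (rule summable_on_product_bound[OF sg]) (use bound rho in auto)
  have A's: "A' summable_on P" unfolding P_def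
  proof (rule summable_on_product_bound[OF sg])
    fix n d :: nat assume "n \<in> {1..}" "d \<in> {1..}"
    then have "norm (F (n, d)) \<le> \<rho> ^ n * (1 / \<rho> * (of_nat d * \<rho> ^ d))" using bound by auto
    moreover have "norm (A' (n, d)) \<le> 1 * norm (F (n, d))"
      unfolding A'_def case_prod_conv norm_mult using rho
      by (intro mult_right_mono) (auto simp: norm_power power_le_one)
    ultimately show "norm (A' (n, d)) \<le> \<rho> ^ n * (1 / \<rho> * (of_nat d * \<rho> ^ d))" by linarith
  qed (use rho in auto)
  note tri = infsum_pairs_trichotomy[OF F[unfolded P_def], folded P_def]
  have sumF: "infsum F P = (\<Sum>\<^sub>\<infinity>n\<in>{1..}. sech2 (int n))"
    unfolding P_def
    by (subst infsum_Sigma_banach[symmetric, OF F[unfolded P_def]], rule infsum_cong)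
      (use sech2_has_sum in \<open>auto intro!: infsumI simp: F_def\<close>)
  have "(\<Sum>\<^sub>\<infinity>d\<in>{1..}. A' (n, d)) = (-1) ^ n * q ^ (n\<^sup>2) * sech2 (int n)" if "n \<ge> 1" for n
    using has_sum_cmult_right[OF sech2_has_sum[OF that], of "(-1) ^ n * q ^ (n\<^sup>2)"]
    unfolding A'_def F_def case_prod_conv by (rule infsumI)
  then have sumA: "infsum A' P = (\<Sum>\<^sub>\<infinity>n\<in>{1..}. (-1) ^ n * q ^ (n\<^sup>2) * sech2 (int n))"
    unfolding P_def
    by (subst infsum_Sigma_banach[symmetric, OF A's[unfolded P_def]]) (rule infsum_cong, simp)
  have E: "infsum sech2 UNIV = 1 / 4 + 2 * infsum F P"
  proof -
    have "sech2 0 = 1 / 4" by (simp add: sech2_def)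
    then show ?thesis using infsum_int_even[OF sech2_summable sech2_minus] by (simp only: sumF)
  qed
  have A: "ser_A q = 1 / 4 + 2 * infsum A' P"
  proof -
    define f where "f n = theta_term q (-1) 0 n * sech2 n" for n
    have "f summable_on UNIV" unfolding f_def by (rule theta_sech2_summable[OF t])
    moreover have "f (- n) = f n" for n
      using theta_term_reflect[OF t, of n] sech2_minus[of n] by (simp add: f_def)
    ultimately have "infsum f UNIV = f 0 + 2 * (\<Sum>\<^sub>\<infinity>n\<in>{1..}. f (int n))" by (rule infsum_int_even)
    moreover have "f (int n) = (-1) ^ n * q ^ (n\<^sup>2) * sech2 (int n)" for n
      by (simp add: f_def theta_term_def power_int_def nat_power_eq)
    moreover have "ser_A q = infsum f UNIV"
      unfolding ser_A_def by (rule infsum_cong) (simp add: f_def theta_term_def sech2_def power_int_add)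
    moreover have "f 0 = 1 / 4" by (simp add: f_def theta_term_def sech2_def)
    ultimately show ?thesis by (simp only: sumA)
  qed
  define g where "g n = (-1) ^ n * of_nat n * q ^ (n\<^sup>2) * cth q (2 * int n)" for n :: nat
  have hs: "(\<lambda>m. theta_term q (-1) 0 m * (of_int m * cth q (2 * m))) summable_on UNIV" (is "?h summable_on _")
    using summable_on_cmult_right[OF abs_summable_linear_hyp[OF t, of 1 0], of "1/2"] by simp
  moreover have "?h (- m) = ?h m" for m
    using theta_term_reflect[OF t, of m] hyp_minus[of 1 "2 * m"] by simp
  ultimately have "infsum ?h UNIV = ?h 0 + 2 * (\<Sum>\<^sub>\<infinity>n\<in>{1..}. ?h (int n))"
    by (rule infsum_int_even)
  moreover have hg: "?h (int n) = g n" for n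
    by (simp add: g_def theta_term_def power_int_def nat_power_eq)
  ultimately have S: "S = 2 * infsum g {1..}"
    by (simp add: S_def)
  define F1 F2 H where "F1 = (\<lambda>(n, d). F (n, n + d))" and "F2 = (\<lambda>(n, d). F (n + d, n))"
    and "H x = F1 x + F2 x + - A' x" for x
  note tri' = tri[folded F1_def F2_def]
  have F12: "(\<lambda>x. F1 x + F2 x) summable_on P" by (rule summable_on_add[OF tri'(2,3)])
  have nA: "(\<lambda>x. - A' x) summable_on P" using A's by (simp add: summable_on_uminus)
  have Hs: "H summable_on P" unfolding H_def by (rule summable_on_add[OF F12 nA])
  \<comment> \<open>\<open>F1\<close> and \<open>A'\<close> have equal signs and powers with
    multiplicities n + d and d, so their difference has multiplicity n, as \<open>F2\<close>
    does.\<close>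
  have H: "H (n, d) = - of_nat n * (-1) ^ n * (1 + (-1) ^ d) * q ^ (n * (n + d))" for n d
    by (simp add: H_def F1_def F2_def F_def A'_def algebra_simps power_add power2_eq_square)
  have "infsum H P = infsum F1 P + infsum F2 P + infsum (\<lambda>x. - A' x) P"
    unfolding H_def by (simp only: infsum_add[OF F12 nA] infsum_add[OF tri'(2,3)])
  then have H1: "infsum H P = infsum F P - (\<Sum>\<^sub>\<infinity>n\<in>{1..}. F (n, n)) - infsum A' P"
    using tri'(1) by (simp add: infsum_uminus)
  have H2: "infsum H P = (\<Sum>\<^sub>\<infinity>n\<in>{1..}. \<Sum>\<^sub>\<infinity>d\<in>{1..}. H (n, d))"
    unfolding P_def by (rule infsum_Sigma_banach[symmetric, OF Hs[unfolded P_def]])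
  have inner: "(\<Sum>\<^sub>\<infinity>d\<in>{1..}. H (n, d)) = - g n + (-1) ^ n * of_nat n * q ^ (n\<^sup>2)" if n: "n \<ge> 1" for n
  proof -
    have x: "norm (q ^ n) < 1" "norm (- (q ^ n)) < 1"
      using q_lt n by (auto simp: norm_power power_less_one_iff)
    have nz: "1 - q ^ n \<noteq> 0" "1 + q ^ n \<noteq> 0" "1 - q ^ (2 * n) \<noteq> 0"
      using q_powi_ne[of "int n"] q_powi_ne[of "int (2 * n)"] n unfolding power_int_of_nat by auto
    have H': "H (n, d) = (- of_nat n * (-1) ^ n * q ^ (n\<^sup>2)) * ((q ^ n) ^ d + (- (q ^ n)) ^ d)" for n d
    proof -
      have "q ^ (n * (n + d)) = q ^ (n\<^sup>2) * (q ^ n) ^ d"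
        by (simp add: distrib_left power_add power2_eq_square flip: power_mult)
      then show ?thesis unfolding H power_minus[of "q ^ n"] by (simp add: algebra_simps)
    qed
    have "((\<lambda>d. (q ^ n) ^ d + (- (q ^ n)) ^ d) has_sum q ^ n / (1 - q ^ n) + - (q ^ n) / (1 - - (q ^ n))) {1..}"
      by (rule has_sum_add[OF has_sum_geometric_from_1[OF x(1)] has_sum_geometric_from_1[OF x(2)]])
    from has_sum_cmult_right[OF this, of "- of_nat n * (-1) ^ n * q ^ (n\<^sup>2)"]
    have "((\<lambda>d. H (n, d)) has_sum (- of_nat n * (-1) ^ n * q ^ (n\<^sup>2)) *
       (q ^ n / (1 - q ^ n) + - (q ^ n) / (1 - - (q ^ n)))) {1..}"
      unfolding H'[of n] .
    then have "(\<Sum>\<^sub>\<infinity>d\<in>{1..}. H (n, d)) = (- of_nat n * (-1) ^ n * q ^ (n\<^sup>2)) *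
       (q ^ n / (1 - q ^ n) + - (q ^ n) / (1 - - (q ^ n)))" by (rule infsumI)
    \<comment> \<open>The odd powers of q^n cancel, so the ratio becomes q^(2 n); the -1 stands for
      the absent term d = 0, which the diagonal terms F (n, n) will compensate.\<close>
    moreover have "q ^ n / (1 - q ^ n) + - (q ^ n) / (1 - - (q ^ n)) = cth q (2 * int n) - 1"
    proof -
      have c: "cth q (2 * int n) = (1 + q ^ (2 * n)) / (1 - q ^ (2 * n))"
        unfolding hyp_def using power_int_of_nat[of q "2 * n"] by simp
      have "1 - q ^ (2 * n) = (1 - q ^ n) * (1 + q ^ n)" by (simp add: algebra_simps power_mult power2_eq_square mult_2 power_add)
      then show ?thesis unfolding c using nz
        by (simp add: field_simps)
    qed
    ultimately show ?thesis by (simp only: g_def) (simp add: algebra_simps)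
  qed
  have "(\<Sum>\<^sub>\<infinity>n\<in>{1..}. (-1) ^ n * of_nat n * q ^ (n\<^sup>2)) = - (\<Sum>\<^sub>\<infinity>n\<in>{1..}. F (n, n))"
    by (subst infsum_uminus[symmetric], rule infsum_cong) (simp add: F_def power2_eq_square)
  moreover have "(\<lambda>n. (-1) ^ n * of_nat n * q ^ (n\<^sup>2)) summable_on {1..}"
    using summable_on_uminus[THEN iffD2, OF tri(4)] by (simp add: F_def power2_eq_square mult.assoc mult.left_commute)
  moreover have gs: "g summable_on {1..}"
  proof -
    have "?h summable_on range int" using hs by (rule summable_on_subset_banach) auto
    then have "?h \<circ> int summable_on UNIV" by (subst (asm) summable_on_reindex) auto
    moreover have "?h \<circ> int = g" by (rule ext) (simp only: o_apply hg)
    ultimately have "g summable_on UNIV" by simp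
    then show ?thesis by (rule summable_on_subset_banach) auto
  qed
  moreover have "infsum H P = (\<Sum>\<^sub>\<infinity>n\<in>{1..}. - g n + (-1) ^ n * of_nat n * q ^ (n\<^sup>2))"
    unfolding H2 by (rule infsum_cong) (use inner in auto)
  moreover have "(\<lambda>n. - g n) summable_on {1..}" using gs by (simp add: summable_on_uminus)
  ultimately have "infsum H P = - infsum g {1..} - (\<Sum>\<^sub>\<infinity>n\<in>{1..}. F (n, n))"
    using infsum_add[of "\<lambda>n. - g n" "{1..}" "\<lambda>n. (-1) ^ n * of_nat n * q ^ (n\<^sup>2)"]
    by (simp only: infsum_uminus) simp
  with H1 have "infsum A' P = infsum F P + infsum g {1..}" by (simp add: algebra_simps)
  then have "4 * ser_A q = 4 * infsum sech2 UNIV + 4 * S"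
    by (simp only: A E S) simp
  moreover have "gtheta q (-1) 0 * tanh_sum q 0 = - 4 * (\<Sum>\<^sub>\<infinity>n. sech2 (2 * n)) - 2 * S"
    "gtheta q (-1) 0 * tanh_sum q 1 = - 4 * (\<Sum>\<^sub>\<infinity>n. sech2 (2 * n + 1)) - 2 * S"
    using V_sum_diff[of 0] V_sum_diff[of 1] by (simp_all only: S_def add_0_right)
  ultimately show ?thesis
    by (simp only: infsum_int_parity[OF sech2_summable] distrib_left minus_mult_left[symmetric]) simp
qed

end

subsection \<open>Sums of two and four squares\<close>

text \<open>Controls the behaviour of the theta and secant series as q tends to 0, where the term n
  = 0 dominates.\<close>

lemma infsum_int_near_0:
  fixes f :: "int \<Rightarrow> complex"
  assumes r: "0 < r" "r < 1" and f: "\<And>n. n \<noteq> 0 \<Longrightarrow> norm (f n) \<le> C * r ^ nat \<bar>n\<bar>" and C: "C \<ge> 0"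
  shows "norm (infsum f UNIV - f 0) \<le> 2 * C * (r / (1 - r))"
proof -
  define g where "g n = (if n = 0 then 0 else f n)" for n
  have g: "norm (g n) \<le> C * r ^ nat \<bar>n\<bar>" for n using f[of n] C r by (auto simp: g_def)
  have gs: "g summable_on UNIV"
    by (rule abs_summable_summable, rule abs_summable_on_int_exp[OF r g])
  have "((\<lambda>n. f 0 * of_bool (n = 0)) has_sum f 0) UNIV"
    by (rule has_sum_finite_neutralI[where B = "{0}"]) auto
  from has_sum_add[OF this has_sum_infsum[OF gs]]
  have "(f has_sum (f 0 + infsum g UNIV)) UNIV"
    by (rule has_sum_cong[THEN iffD1, rotated]) (auto simp: g_def)
  then have eq: "infsum f UNIV - f 0 = infsum g UNIV" by (simp add: infsumI)
  have geo: "((\<lambda>n. C * r ^ n) has_sum C * (r / (1 - r))) {1..}"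
    using has_sum_geometric_from_1[of r] r by (intro has_sum_cmult_right) auto
  have "((\<lambda>n. C * r ^ n) has_sum C * (r / (1 - r))) {1..} = ((\<lambda>n. C * r ^ nat \<bar>n\<bar>) has_sum C * (r / (1 - r))) {1..}"
    by (rule has_sum_reindex_bij_witness[of _ nat int]) auto
  then have "((\<lambda>n. C * r ^ nat \<bar>n\<bar>) has_sum C * (r / (1 - r))) {1..}" using geo by simp
  moreover have "((\<lambda>n. C * r ^ n) has_sum C * (r / (1 - r))) {1..} = ((\<lambda>n. C * r ^ nat \<bar>n\<bar>) has_sum C * (r / (1 - r))) {..-1}"
    by (rule has_sum_reindex_bij_witness[of _ "\<lambda>n. nat (-n)" "\<lambda>n. - int n"]) auto
  then have "((\<lambda>n. C * r ^ nat \<bar>n\<bar>) has_sum C * (r / (1 - r))) {..-1}" using geo by simp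
  ultimately have 1: "((\<lambda>n. C * r ^ nat \<bar>n\<bar>) has_sum C * (r / (1 - r)) + C * (r / (1 - r))) ({1..} \<union> {..-1})"
    by (rule has_sum_Un_disjoint) auto
  have 2: "(g has_sum infsum g UNIV) ({1..} \<union> {..-1})"
    by (rule has_sum_cong_neutral[THEN iffD1, OF _ _ _ has_sum_infsum[OF gs]]) (auto simp: g_def)
  have "norm (infsum g UNIV) \<le> C * (r / (1 - r)) + C * (r / (1 - r))"
    by (rule norm_infsum_le[OF 2 1 g])
  also have "\<dots> = 2 * C * (r / (1 - r))" by simp
  finally show ?thesis unfolding eq .
qed

text \<open>With q = exp (- v) this is 1 / (2 cosh (n v)), half a hyperbolic secant.\<close>

definition sec :: "complex \<Rightarrow> int \<Rightarrow> complex" where "sec q n = q powi n / (1 + q powi (2 * n))"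

lemma nome_square: "nome q \<Longrightarrow> nome (q ^ 2)"
  by (simp add: nome_def norm_power power_less_one_iff)

context nome
begin

abbreviation "th \<equiv> gtheta q 1 0"
abbreviation "th4 \<equiv> gtheta q (-1) 0"

lemma char0: "theta_char 1 0" "theta_char (-1) 0" by (auto simp: theta_char_def)

lemma gtheta_product:
  assumes s: "s = 1 \<or> s = -1" and s': "s' = 1 \<or> s' = -1"
  shows "((\<lambda>(x, y). theta_term q s 0 x * theta_term q s' 0 y) has_sum gtheta q s 0 * gtheta q s' 0) (UNIV \<times> UNIV)"
proof -
  have c: "theta_char s 0" "theta_char s' 0" using s s' by (auto simp: theta_char_def)
  note h = theta_term_has_sum[OF c(1)] theta_term_has_sum[OF c(2)]
  have b: "(\<lambda>m::int. 1 / \<rho> * \<rho> ^ nat \<bar>m\<bar>) summable_on UNIV"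
    by (rule rho_power_summable)
  show ?thesis
  proof (rule has_sum_SigmaI[where g = "\<lambda>x. theta_term q s 0 x * gtheta q s' 0"])
    show "(\<lambda>(x, y). theta_term q s 0 x * theta_term q s' 0 y) summable_on UNIV \<times> UNIV"
      by (rule summable_on_product_bound[OF b b])
        (auto simp: norm_mult intro!: mult_mono theta_term_bound[OF c(1)] theta_term_bound[OF c(2)] simp del: times_divide_eq_left)
  qed (auto intro!: has_sum_cmult_right has_sum_cmult_left h)
qed

lemma has_sum_parity_pairs:
  fixes f :: "int \<times> int \<Rightarrow> complex"
  assumes "(f has_sum S) (UNIV \<times> UNIV)"
  obtains E Od where "(f has_sum E) {(x, y). even (x + y)}" "(f has_sum Od) {(x, y). odd (x + y)}" "S = E + Od"
proof -
  have s: "f summable_on UNIV \<times> UNIV" using assms by (auto simp: summable_on_def)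
  have "f summable_on {(x, y). even (x + y)}" "f summable_on {(x, y). odd (x + y)}"
    by (rule summable_on_subset_banach[OF s], simp)+
  then obtain E Od where EO: "(f has_sum E) {(x, y). even (x + y)}" "(f has_sum Od) {(x, y). odd (x + y)}"
    by (auto simp: summable_on_def)
  have "(f has_sum (E + Od)) ({(x, y). even (x + y)} \<union> {(x, y). odd (x + y)})"
    by (rule has_sum_Un_disjoint[OF EO]) auto
  also have "{(x, y). even (x + y)} \<union> {(x, y). odd (x + y)} = (UNIV \<times> UNIV :: (int \<times> int) set)" by auto
  finally show ?thesis using assms EO that has_sum_unique by blast
qed

lemma nome_q2: "nome (q ^ 2)" by (rule nome_square) (rule nome_axioms)

lemma q2_powi: "(q ^ 2) powi k = q powi (2 * k)"
  by (simp add: power_int_mult)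

text \<open>The map (u, v) -> (u + v, u - v) identifies all integer pairs with the pairs of equal
  parity and doubles the sum of the two squares, which is how q^2 enters.\<close>

lemma has_sum_even_pairs:
  "((\<lambda>(u, v). theta_term (q^2) s 0 u * theta_term (q^2) s' 0 v) has_sum S) (UNIV \<times> UNIV) \<longleftrightarrow>
   ((\<lambda>(x, y). s powi ((x + y) div 2) * s' powi ((x - y) div 2) * q powi (x^2 + y^2)) has_sum S) {(x, y). even (x + y)}"
proof (rule has_sum_reindex_bij_witness[of _ "\<lambda>(x, y). ((x + y) div 2, (x - y) div 2)" "\<lambda>(u, v). (u + v, u - v)"])
  fix a :: "int \<times> int" assume "a \<in> {(x, y). even (x + y)}"
  then show "(case (case a of (x, y) \<Rightarrow> ((x + y) div 2, (x - y) div 2)) of (u, v) \<Rightarrow> (u + v, u - v)) = a"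
    by (cases a) (auto, presburger+)
next
  fix a :: "int \<times> int"
  obtain u v where a: "a = (u, v)" by (cases a)
  have "(q^2) powi (u^2) * (q^2) powi (v^2) = q powi ((u + v)^2 + (u - v)^2)"
    unfolding q2_powi by (subst power_int_add[symmetric]) (auto simp: power2_eq_square algebra_simps)
  then show "(case case a of (u, v) \<Rightarrow> (u + v, u - v) of (x, y) \<Rightarrow> s powi ((x + y) div 2) * s' powi ((x - y) div 2) * q powi (x^2 + y^2)) =
     (case a of (u, v) \<Rightarrow> theta_term (q^2) s 0 u * theta_term (q^2) s' 0 v)"
    by (simp add: a theta_term_def mult_ac)
qed auto

text \<open>Passing from \<open>th\<close> to \<open>th4\<close> multiplies the term at (x, y) by
  (-1)^(x + y): pairs of unequal parity cancel, and those of equal parity are counted twice and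
  rotated.\<close>

lemma th_squares: "th ^ 2 + th4 ^ 2 = 2 * gtheta (q ^ 2) 1 0 ^ 2"
proof -
  interpret q2: nome "q ^ 2" by (rule nome_q2)
  have a: "((\<lambda>(x, y). q powi (x^2 + y^2)) has_sum th ^ 2) (UNIV \<times> UNIV)"
    using gtheta_product[of 1 1] by (simp add: theta_term_def power_int_add power2_eq_square)
  obtain E Od where EO: "((\<lambda>(x, y). q powi (x^2 + y^2)) has_sum E) {(x, y). even (x + y)}"
      "((\<lambda>(x, y). q powi (x^2 + y^2)) has_sum Od) {(x, y). odd (x + y)}" "th ^ 2 = E + Od"
    using has_sum_parity_pairs[OF a] by blast
  have "((\<lambda>(x, y). (-1) powi (x + y) * q powi (x^2 + y^2)) has_sum th4 ^ 2) (UNIV \<times> UNIV)"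
    using gtheta_product[of "-1" "-1"]
    by (simp add: theta_term_def power_int_add power2_eq_square mult_ac)
  from has_sum_parity_pairs[OF this] obtain E' Od' where EO':
      "((\<lambda>(x, y). (-1) powi (x + y) * q powi (x^2 + y^2)) has_sum E') {(x, y). even (x + y)}"
      "((\<lambda>(x, y). (-1) powi (x + y) * q powi (x^2 + y^2)) has_sum Od') {(x, y). odd (x + y)}" "th4 ^ 2 = E' + Od'"
    by blast
  have "((\<lambda>(x, y). q powi (x^2 + y^2)) has_sum E') {(x, y). even (x + y)}"
    by (rule has_sum_cong[THEN iffD1, OF _ EO'(1)]) (auto simp: power_int_minus_left)
  then have E: "E' = E" using EO(1) has_sum_unique by blast
  have "((\<lambda>(x, y). - (q powi (x^2 + y^2))) has_sum Od') {(x, y). odd (x + y)}"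
    by (rule has_sum_cong[THEN iffD1, OF _ EO'(2)]) (auto simp: power_int_minus_left)
  moreover have "((\<lambda>(x, y). - (q powi (x^2 + y^2))) has_sum - Od) {(x, y). odd (x + y)}"
    using has_sum_uminusI[OF EO(2)] by (simp add: case_prod_unfold)
  ultimately have Od: "Od' = - Od" using has_sum_unique by blast
  have "((\<lambda>(x, y). q powi (x^2 + y^2)) has_sum gtheta (q ^ 2) 1 0 * gtheta (q ^ 2) 1 0) {(x, y). even (x + y)}"
    using q2.gtheta_product[of 1 1] has_sum_even_pairs[of 1 1] by simp
  then have "E = gtheta (q ^ 2) 1 0 ^ 2" using EO(1) has_sum_unique by (auto simp: power2_eq_square)
  then show ?thesis using EO(3) EO'(3) E Od by simp
qed

text \<open>The sign is (-1)^y alone, so exchanging x and y shows that pairs of unequal parity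
  contribute 0; the rest is again the rotation.\<close>

lemma th_product: "th * th4 = gtheta (q ^ 2) (-1) 0 ^ 2"
proof -
  interpret q2: nome "q ^ 2" by (rule nome_q2)
  have "((\<lambda>(x, y). (-1) powi y * q powi (x^2 + y^2)) has_sum th * th4) (UNIV \<times> UNIV)"
    using gtheta_product[of 1 "-1"] by (simp add: theta_term_def power_int_add mult_ac)
  from has_sum_parity_pairs[OF this] obtain E Od where EO:
      "((\<lambda>(x, y). (-1) powi y * q powi (x^2 + y^2)) has_sum E) {(x, y). even (x + y)}"
      "((\<lambda>(x, y). (-1) powi y * q powi (x^2 + y^2)) has_sum Od) {(x, y). odd (x + y)}" "th * th4 = E + Od"
    by blast
  have "((\<lambda>(x, y). (-1) powi y * q powi (x^2 + y^2)) has_sum - Od) {(x, y). odd (x + y)} =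
        ((\<lambda>(x, y). - ((-1) powi y * q powi (x^2 + y^2))) has_sum - Od) {(x, y). odd (x + y)}"
    by (rule has_sum_reindex_bij_witness[of _ "\<lambda>(x, y). (y, x)" "\<lambda>(x, y). (y, x)"])
      (auto simp: power_int_minus_left add.commute)
  moreover have "((\<lambda>(x, y). - ((-1) powi y * q powi (x^2 + y^2))) has_sum - Od) {(x, y). odd (x + y)}"
    using has_sum_uminusI[OF EO(2)] by (simp add: case_prod_unfold)
  ultimately have "- Od = Od" using EO(2) has_sum_unique by blast
  then have Od: "Od = 0" by simp
  have "((\<lambda>(x, y). (-1) powi ((x + y) div 2) * (-1) powi ((x - y) div 2) * q powi (x^2 + y^2))
      has_sum gtheta (q ^ 2) (-1) 0 * gtheta (q ^ 2) (-1) 0) {(x, y). even (x + y)}"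
    using q2.gtheta_product[of "-1" "-1"] has_sum_even_pairs[of "-1" "-1"] by simp
  then have "((\<lambda>(x, y). (-1) powi y * q powi (x^2 + y^2))
      has_sum gtheta (q ^ 2) (-1) 0 * gtheta (q ^ 2) (-1) 0) {(x, y). even (x + y)}"
  proof (rule has_sum_cong[THEN iffD1, rotated])
    fix a :: "int \<times> int" assume "a \<in> {(x, y). even (x + y)}"
    then obtain x y where a: "a = (x, y)" "even (x + y)" by auto
    then obtain u where "x + y = 2 * u" by (elim evenE)
    then have x: "x = 2 * u - y" by simp
    show "(case a of (x, y) \<Rightarrow> (-1) powi ((x + y) div 2) * (-1) powi ((x - y) div 2) * q powi (x^2 + y^2)) =
        (case a of (x, y) \<Rightarrow> (-1) powi y * q powi (x^2 + y^2))"
      by (simp add: a(1) x power_int_minus_left)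
  qed
  then have "E = gtheta (q ^ 2) (-1) 0 ^ 2" using EO(1) has_sum_unique by (auto simp: power2_eq_square)
  then show ?thesis using EO(3) Od by simp
qed

section \<open>Behaviour near q = 0 and non-vanishing of the theta series\<close>

lemma theta_term_bound0:
  assumes "s = 1 \<or> s = -1"
  shows "norm (theta_term q s 0 m) \<le> 1 * \<rho> ^ nat \<bar>m\<bar>"
proof -
  have "norm (theta_term q s 0 m) = \<rho> powi (m^2)"
    using assms by (subst theta_term_norm) (auto simp: theta_char_def)
  also have "\<dots> \<le> \<rho> powi \<bar>m\<bar>"
    using mult_left_mono[of 1 "\<bar>m\<bar>" "\<bar>m\<bar>"] by (intro rho_powi_le, cases "m = 0") (auto simp: power2_eq_square)
  finally show ?thesis by (simp add: power_int_def)
qed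

lemma gtheta_near_1:
  assumes "s = 1 \<or> s = -1"
  shows "norm (gtheta q s 0 - 1) \<le> 2 * (\<rho> / (1 - \<rho>))"
  using infsum_int_near_0[OF rho(1,2), of "theta_term q s 0" 1] theta_term_bound0[OF assms]
    theta_term_has_sum[of s 0] assms
  by (auto simp: theta_char_def infsumI theta_term_def[of q s 0 0])

lemma nome_power: "nome (q ^ (2 ^ k))"
  using rho by (simp add: nome_def norm_power power_less_one_iff)

lemma power_tower_tendsto_0: "(\<lambda>k. \<rho> ^ (2 ^ k)) \<longlonglongrightarrow> 0"
  using LIMSEQ_subseq_LIMSEQ[OF LIMSEQ_power_zero[of \<rho>], of "\<lambda>k. 2 ^ k"] rho
  by (auto simp: o_def strict_mono_def)

text \<open>By \<open>th_product\<close> a zero at q would propagate to q^2, q^4, q^8 and so on,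
  although the values there tend to 1.\<close>

lemma th4_nonzero: "th4 \<noteq> 0"
proof
  assume 0: "th4 = 0"
  have z: "gtheta (q ^ (2 ^ k)) (-1) 0 = 0" for k
  proof (induction k)
    case (Suc k)
    interpret n: nome "q ^ (2 ^ k)" by (rule nome_power)
    show ?case using n.th_product Suc by (simp flip: power_mult add: mult.commute)
  qed (use 0 in simp)
  have "norm (gtheta (q ^ (2 ^ k)) (-1) 0 - 1) \<le> 2 * (\<rho> ^ (2 ^ k) / (1 - \<rho> ^ (2 ^ k)))" for k
    using nome.gtheta_near_1[OF nome_power, of "-1" k] by (simp add: norm_power)
  then have "1 \<le> 2 * (\<rho> ^ (2 ^ k) / (1 - \<rho> ^ (2 ^ k)))" for k by (simp add: z)
  moreover have "(\<lambda>k. 2 * (\<rho> ^ (2 ^ k) / (1 - \<rho> ^ (2 ^ k)))) \<longlonglongrightarrow> 2 * (0 / (1 - 0))"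
    by (intro tendsto_intros power_tower_tendsto_0) auto
  ultimately have "1 \<le> 2 * (0 / (1 - 0) :: real)" by (intro LIMSEQ_le_const) auto
  then show False by simp
qed

lemma th_nonzero: "th \<noteq> 0"
  using nome.th4_nonzero[OF nome_minus[OF nome_axioms]] gtheta_minus_1_0[of "- q"] by simp

section \<open>The secant series and the two-square theorem\<close>

lemma sec_minus: "sec q (- n) = sec q n"
proof -
  have "1 + q powi (2 * n) \<noteq> 0" by simp
  moreover have "q powi (2 * n) = q powi n * q powi n" using power_int_add[of q n n] by simp
  ultimately show ?thesis by (simp add: sec_def power_int_minus field_simps)
qed

lemma sec_bound: "norm (sec q n) \<le> 1 / (1 - \<rho>) * \<rho> ^ nat \<bar>n\<bar>"
proof -
  have pos: "norm (sec q n) \<le> 1 / (1 - \<rho>) * \<rho> ^ nat \<bar>n\<bar>" if "n \<ge> 0" for n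
  proof -
    have "norm (1 + q powi (2 * n)) \<ge> 1 - \<rho>"
    proof (cases "n = 0")
      case False
      have "norm (q powi (2 * n)) \<le> \<rho> powi 1" unfolding norm_power_int using that False by (intro rho_powi_le) auto
      then show ?thesis using norm_triangle_ineq4[of "1 + q powi (2 * n)" "q powi (2 * n)"] by simp
    next
      case True
      then have "norm (1 + q powi (2 * n)) = 2" by simp
      then show ?thesis using rho by linarith
    qed
    then have "norm (q powi n) / norm (1 + q powi (2 * n)) \<le> norm (q powi n) / (1 - \<rho>)"
      using rho by (intro divide_left_mono) auto
    then show ?thesis using that by (simp add: sec_def norm_divide norm_power_int power_int_def norm_power)
  qed
  show ?thesis using pos[of n] pos[of "-n"] sec_minus[of n] by (cases "n \<ge> 0") auto
qed

lemma sec_summable: "(\<lambda>n. (-1) powi n * sec q n) summable_on UNIV" "sec q summable_on UNIV"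
  by (rule abs_summable_summable, rule abs_summable_on_int_exp[OF rho(1,2), of _ "1 / (1 - \<rho>)"],
      use sec_bound in \<open>simp add: norm_mult norm_power_int\<close>)+

text \<open>With m = n + k, the inner sum over n at fixed m only changes sign when m is increased.\<close>

lemma theta_times_sec:
  assumes s: "s = 1 \<or> s = -1"
  shows "gtheta q s 0 * (\<Sum>\<^sub>\<infinity>n. (- s) powi n * sec q n) =
    gtheta q (- s) 0 * (\<Sum>\<^sub>\<infinity>n. (-1) powi n * q powi (n^2) * sec q n)"
proof -
  define S where "S m = (\<Sum>\<^sub>\<infinity>n. (-1) powi n * q powi (n^2 - 2 * m * n) * sec q n)" for m
  define W where "W n m = theta_term q s 0 (m - n) * ((- s) powi n * sec q n)" for n m
  have snz: "s \<noteq> 0" using s by auto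
  have b: "(\<lambda>m::int. C * \<rho> ^ nat \<bar>m\<bar>) summable_on UNIV" for C
    by (rule rho_power_summable)
  have "(\<lambda>(n, k). theta_term q s 0 k * ((- s) powi n * sec q n)) summable_on UNIV \<times> UNIV"
  proof (rule summable_on_product_bound[OF b b])
    fix n k
    have "norm ((- s) powi n * sec q n) \<le> 1 / (1 - \<rho>) * \<rho> ^ nat \<bar>n\<bar>"
      using sec_bound[of n] s by (auto simp: norm_mult norm_power_int)
    then show "norm (case (n, k) of (n, k) \<Rightarrow> theta_term q s 0 k * ((- s) powi n * sec q n))
        \<le> (1 / (1 - \<rho>) * \<rho> ^ nat \<bar>n\<bar>) * (1 * \<rho> ^ nat \<bar>k\<bar>)"
      using theta_term_bound0[OF s, of k] unfolding case_prod_conv norm_mult[of "theta_term q s 0 k"]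
      by (subst mult.commute) (rule mult_mono, auto)
  qed (use rho in auto)
  also have "?this \<longleftrightarrow> (\<lambda>(n, m). W n m) summable_on UNIV \<times> UNIV"
    by (rule summable_on_reindex_bij_witness[of _ "\<lambda>(n, m). (n, m - n)" "\<lambda>(n, k). (n, k + n)"]) (auto simp: W_def)
  finally have W: "(\<lambda>(n, m). W n m) summable_on UNIV \<times> UNIV" .
  then have W': "(\<lambda>(m, n). W n m) summable_on UNIV \<times> UNIV"
    by (subst (asm) summable_on_swap) (simp add: case_prod_unfold)
  have Wnm: "W n m = s powi m * q powi (m^2) * ((-1) powi n * q powi (n^2 - 2 * m * n) * sec q n)" for n m
  proof -
    have "s powi (m - n) * (- s) powi n = s powi m * (-1) powi n"
      using s by (auto simp: power_int_diff power_int_minus_left)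
    moreover have "q powi ((m - n)^2) = q powi (m^2) * q powi (n^2 - 2 * m * n)"
      by (subst power_int_add[symmetric]) (auto simp: power2_eq_square algebra_simps)
    ultimately show ?thesis by (simp add: W_def theta_term_def mult_ac)
  qed
  have summ: "(\<lambda>n. (-1) powi n * q powi (n^2 - 2 * m * n) * sec q n) summable_on UNIV" for m
  proof -
    have "(\<lambda>n. W n m) summable_on UNIV" using summable_on_SigmaD1[OF W'] by simp
    then have "(\<lambda>n. (s powi m * q powi (m^2)) * ((-1) powi n * q powi (n^2 - 2 * m * n) * sec q n)) summable_on UNIV"
      unfolding Wnm .
    then show ?thesis using snz by (subst (asm) summable_on_cmult_right') auto
  qed
  have step: "S (m + 1) = - S m" for m
  proof -
    \<comment> \<open>The exponents of consecutive m differ by the factor q^(2 n), so adding the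
      terms produces 1 + q^(2 n) and clears the denominator of \<open>sec\<close>.\<close>
    have sec1: "q powi (n^2 - 2 * (m + 1) * n) * sec q n + q powi (n^2 - 2 * m * n) * sec q n = q powi (n^2 - (2 * m + 1) * n)" for n
    proof -
      have e: "q powi (n^2 - 2 * m * n) = q powi (n^2 - 2 * (m + 1) * n) * q powi (2 * n)"
        "q powi (n^2 - (2 * m + 1) * n) = q powi (n^2 - 2 * (m + 1) * n) * q powi n"
        by (subst power_int_add[symmetric], auto simp: algebra_simps)+
      have "(1 + q powi (2 * n)) * sec q n = q powi n" by (simp add: sec_def)
      moreover have "A * s + A * b * s = A * ((1 + b) * s)" for A b s :: complex by (simp add: algebra_simps)
      ultimately show ?thesis unfolding e by simp
    qed
    have "((\<lambda>n. (-1) powi n * q powi (n^2 - 2 * (m + 1) * n) * sec q n + (-1) powi n * q powi (n^2 - 2 * m * n) * sec q n)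
       has_sum S (m + 1) + S m) UNIV"
      unfolding S_def using summ by (intro has_sum_add has_sum_infsum)
    also have "(\<lambda>n. (-1) powi n * q powi (n^2 - 2 * (m + 1) * n) * sec q n + (-1) powi n * q powi (n^2 - 2 * m * n) * sec q n)
       = (\<lambda>n. (-1) powi n * q powi (n^2 - (2 * m + 1) * n))"
      using sec1 by (simp only: mult.assoc distrib_left[symmetric])
    finally have h: "((\<lambda>n. (-1) powi n * q powi (n^2 - (2 * m + 1) * n)) has_sum S (m + 1) + S m) UNIV" .
    \<comment> \<open>The exponent is invariant under n -> 2 m + 1 - n, a map that reverses the
      parity of n and hence the sign.\<close>
    moreover have "((\<lambda>n. (-1) powi n * q powi (n^2 - (2 * m + 1) * n)) has_sum 0) UNIV"
    proof (rule has_sum_0_if_reflect[where a = "- (2 * m + 1)"])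
      fix n
      have "(- n - - (2 * m + 1))\<^sup>2 - (2 * m + 1) * (- n - - (2 * m + 1)) = n^2 - (2 * m + 1) * n"
        by (simp add: power2_eq_square algebra_simps)
      moreover have "(-1) powi (- n - - (2 * m + 1)) = - ((-1 :: complex) powi n)"
        by (simp add: power_int_minus_left)
      ultimately show "(-1) powi (- n - - (2 * m + 1)) * q powi ((- n - - (2 * m + 1))\<^sup>2 - (2 * m + 1) * (- n - - (2 * m + 1)))
          = - ((-1) powi n * q powi (n^2 - (2 * m + 1) * n))" by simp
    qed (use h in \<open>auto simp: summable_on_def\<close>)
    ultimately have "S (m + 1) + S m = 0" using has_sum_unique by blast
    then show ?thesis by (simp add: add_eq_0_iff2)
  qed
  have S: "S m = (-1) powi m * S 0" for m
  proof (induction m rule: int_induct[where k = 0])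
    case (step1 i)
    then show ?case using step[of i] by (simp add: power_int_add)
  next
    case (step2 i)
    then show ?case using step[of "i - 1"] by (simp add: power_int_diff)
  qed simp
  have "gtheta q s 0 * (\<Sum>\<^sub>\<infinity>n. (- s) powi n * sec q n) = (\<Sum>\<^sub>\<infinity>n. \<Sum>\<^sub>\<infinity>m. W n m)"
  proof (subst infsum_cmult_right'[symmetric], rule infsum_cong)
    fix n
    have "infsum (theta_term q s 0) UNIV = (\<Sum>\<^sub>\<infinity>m. theta_term q s 0 (m - n))"
      by (rule infsum_reindex_bij_witness[of _ "\<lambda>m. m - n" "\<lambda>m. m + n"]) auto
    then show "gtheta q s 0 * ((- s) powi n * sec q n) = (\<Sum>\<^sub>\<infinity>m. W n m)"
      using theta_term_has_sum[of s 0] char0 s by (auto simp: W_def infsum_cmult_left' infsumI)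
  qed
  also have "\<dots> = (\<Sum>\<^sub>\<infinity>m. \<Sum>\<^sub>\<infinity>n. W n m)" by (rule infsum_swap_banach[OF W])
  also have "\<dots> = (\<Sum>\<^sub>\<infinity>m. theta_term q (- s) 0 m * S 0)"
  proof (rule infsum_cong)
    fix m
    have "(\<Sum>\<^sub>\<infinity>n. W n m) = s powi m * q powi (m^2) * S m"
      unfolding Wnm S_def by (rule infsum_cmult_right')
    then show "(\<Sum>\<^sub>\<infinity>n. W n m) = theta_term q (- s) 0 m * S 0"
      using s by (auto simp: S[of m] theta_term_def power_int_minus_left)
  qed
  also have "\<dots> = gtheta q (- s) 0 * S 0"
    using theta_term_has_sum[of "- s" 0] char0 s by (auto simp: infsum_cmult_left' infsumI)
  finally show ?thesis by (simp add: S_def)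
qed


text \<open>The two cases s = 1 and s = -1 of \<open>theta_times_sec\<close> share the series S;
  eliminating it gives th^2 a' = th4^2 a for the plain sum a and the alternating sum a'. As a + a'
  keeps twice the even indices, it is the secant series at q^2, and \<open>th_squares\<close> does
  the same for the theta side.\<close>

lemma sec_sum_ratio:
  "infsum (sec q) UNIV / th ^ 2 = infsum (sec (q ^ 2)) UNIV / gtheta (q ^ 2) 1 0 ^ 2"
proof -
  interpret q2: nome "q ^ 2" by (rule nome_q2)
  define a a' a2 where "a = infsum (sec q) UNIV" and "a' = (\<Sum>\<^sub>\<infinity>n. (-1) powi n * sec q n)"
    and "a2 = infsum (sec (q ^ 2)) UNIV"
  define S where "S = (\<Sum>\<^sub>\<infinity>n. (-1) powi n * q powi (n^2) * sec q n)"
  define t where "t = gtheta (q ^ 2) 1 0"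
  have 1: "th4 * a = th * S" using theta_times_sec[of "-1"] by (simp add: a_def S_def)
  have 2: "th * a' = th4 * S" using theta_times_sec[of 1] by (simp add: a'_def S_def)
  have "a + a' = (\<Sum>\<^sub>\<infinity>n. sec q n + (-1) powi n * sec q n)"
    unfolding a_def a'_def using sec_summable by (intro infsum_add[symmetric])
  also have "\<dots> = (\<Sum>\<^sub>\<infinity>n. sec q (2 * n) + (-1) powi (2 * n) * sec q (2 * n)) +
      (\<Sum>\<^sub>\<infinity>n. sec q (2 * n + 1) + (-1) powi (2 * n + 1) * sec q (2 * n + 1))"
    by (rule infsum_int_parity) (intro summable_on_add sec_summable)
  also have "\<dots> = (\<Sum>\<^sub>\<infinity>n. 2 * sec (q ^ 2) n)"
    by (simp add: power_int_minus_left sec_def q2_powi)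
  also have "\<dots> = 2 * a2" by (simp add: a2_def infsum_cmult_right')
  finally have 3: "a + a' = 2 * a2" .
  have "th ^ 2 * a' = th * (th * a')" by (simp add: power2_eq_square)
  also have "\<dots> = th4 * (th * S)" unfolding 2 by (rule mult.left_commute)
  also have "\<dots> = th4 ^ 2 * a" unfolding 1[symmetric] by (simp add: power2_eq_square)
  finally have "th ^ 2 * a' = th4 ^ 2 * a" .
  then have "a * (th ^ 2 + th4 ^ 2) = th ^ 2 * (a + a')" by (simp add: algebra_simps)
  then have "a * t ^ 2 = a2 * th ^ 2" unfolding 3 th_squares t_def[symmetric] by simp
  moreover have "th ^ 2 \<noteq> 0" "t ^ 2 \<noteq> 0" using th_nonzero q2.th_nonzero by (auto simp: t_def)
  ultimately show ?thesis unfolding a_def[symmetric] a2_def[symmetric] t_def[symmetric]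
    by (metis frac_eq_eq)
qed

lemma sec_sum_near: "norm (infsum (sec q) UNIV - 1 / 2) \<le> 2 * (1 / (1 - \<rho>)) * (\<rho> / (1 - \<rho>))"
proof -
  have "sec q 0 = 1 / 2" by (simp add: sec_def)
  moreover have "norm (infsum (sec q) UNIV - sec q 0) \<le> 2 * (1 / (1 - \<rho>)) * (\<rho> / (1 - \<rho>))"
    by (rule infsum_int_near_0[OF rho(1,2) sec_bound]) (use rho in auto)
  ultimately show ?thesis by (simp only:)
qed

text \<open>The quotient above is invariant under squaring q, hence equal to its limit 1 / 2 at q = 0.\<close>

theorem jacobi_two_squares: "th ^ 2 = 2 * infsum (sec q) UNIV"
proof -
  define f where "f k = infsum (sec (q ^ (2 ^ k))) UNIV / gtheta (q ^ (2 ^ k)) 1 0 ^ 2" for k :: nat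
  have const: "f k = f 0" for k
  proof (induction k)
    case (Suc k)
    have "(q ^ (2 ^ k)) ^ 2 = q ^ (2 ^ Suc k)"
      unfolding power_mult[symmetric] power_Suc by (simp only: mult.commute)
    then have "f k = f (Suc k)"
      using nome.sec_sum_ratio[OF nome_power, of k] unfolding f_def by (simp only:)
    with Suc show ?case by simp
  qed simp
  let ?r = "\<lambda>k. \<rho> ^ (2 ^ k)"
  have b1: "norm (gtheta (q ^ (2 ^ k)) 1 0 - 1) \<le> 2 * (?r k / (1 - ?r k))" for k
    using nome.gtheta_near_1[OF nome_power disjI1[OF refl], of k] unfolding norm_power .
  have b2: "norm (infsum (sec (q ^ (2 ^ k))) UNIV - 1 / 2) \<le> 2 * (1 / (1 - ?r k)) * (?r k / (1 - ?r k))" for k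
    using nome.sec_sum_near[OF nome_power, of k] unfolding norm_power .
  have "(\<lambda>k. gtheta (q ^ (2 ^ k)) 1 0 - 1) \<longlonglongrightarrow> 0"
  proof (rule Lim_null_comparison[OF always_eventually])
    show "\<forall>k. norm (gtheta (q ^ (2 ^ k)) 1 0 - 1) \<le> 2 * (?r k / (1 - ?r k))"
      by (intro allI b1)
    have "(\<lambda>k. 2 * (?r k / (1 - ?r k))) \<longlonglongrightarrow> 2 * (0 / (1 - 0))"
      by (intro tendsto_intros power_tower_tendsto_0) auto
    then show "(\<lambda>k. 2 * (?r k / (1 - ?r k))) \<longlonglongrightarrow> 0" unfolding div_0 mult_zero_right .
  qed
  then have t: "(\<lambda>k. gtheta (q ^ (2 ^ k)) 1 0) \<longlonglongrightarrow> 1" by (rule LIM_zero_cancel)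
  have "(\<lambda>k. infsum (sec (q ^ (2 ^ k))) UNIV - 1 / 2) \<longlonglongrightarrow> 0"
  proof (rule Lim_null_comparison[OF always_eventually])
    show "\<forall>k. norm (infsum (sec (q ^ (2 ^ k))) UNIV - 1 / 2) \<le> 2 * (1 / (1 - ?r k)) * (?r k / (1 - ?r k))"
      by (intro allI b2)
    have "(\<lambda>k. 2 * (1 / (1 - r k)) * (r k / (1 - r k))) \<longlonglongrightarrow> 0" if "r \<longlonglongrightarrow> 0" for r :: "nat \<Rightarrow> real"
      using that by (auto intro!: tendsto_eq_intros)
    from this[OF power_tower_tendsto_0]
    show "(\<lambda>k. 2 * (1 / (1 - ?r k)) * (?r k / (1 - ?r k))) \<longlonglongrightarrow> 0" .
  qed
  then have a: "(\<lambda>k. infsum (sec (q ^ (2 ^ k))) UNIV) \<longlonglongrightarrow> 1 / 2" by (rule LIM_zero_cancel)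
  have "(\<lambda>k. f k) \<longlonglongrightarrow> (1 / 2) / 1 ^ 2" unfolding f_def
    by (rule tendsto_divide[OF a tendsto_power[OF t]]) auto
  moreover have "f = (\<lambda>_. f 0)" using const by (rule ext)
  then have "f \<longlonglongrightarrow> f 0" by (metis tendsto_const)
  ultimately have "f 0 = 1 / 2 / 1 ^ 2" by (rule LIMSEQ_unique[rotated])
  then show ?thesis using th_nonzero by (simp add: f_def field_simps)
qed

section \<open>From two squares to four squares\<close>

lemma sec_minus_q: "sec (- q) n = (-1) powi n * sec q n"
  by (simp add: sec_def power_int_minus_left)

lemma th4_squared: "th4 ^ 2 = 2 * (\<Sum>\<^sub>\<infinity>n. (-1) powi n * sec q n)"
  using nome.jacobi_two_squares[OF nome_minus[OF nome_axioms]]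
  by (simp add: gtheta_minus_1_0 sec_minus_q[abs_def])

lemma sec_squared: "sec q n ^ 2 = sech2 (2 * n)"
proof -
  have "q powi (2 * n) = q powi n * q powi n" using power_int_add[of q n n] by simp
  then show ?thesis by (simp add: sec_def sech2_def power2_eq_square)
qed

text \<open>The identity sinh (b - a) / (cosh a cosh b) = tanh b - tanh a.\<close>

lemma sec_times_sec:
  assumes "r \<noteq> 0"
  shows "sec q n * sec q (n + r) = - (q powi r / (1 - q powi (2 * r))) / 2 * (tnh q (2 * n) - tnh q (2 * n + 2 * r))"
proof -
  define u v where "u = q powi n" and "v = q powi r"
  have e: "q powi (2 * n) = u * u" "q powi (n + r) = u * v" "q powi (2 * (n + r)) = u * u * v * v"
    "q powi (2 * n + 2 * r) = u * u * v * v" "q powi (2 * r) = v * v"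
    unfolding u_def v_def by (simp_all flip: power_int_add add: mult_ac) (simp_all add: algebra_simps)
  have nz: "1 + u * u \<noteq> 0" "1 + u * u * v * v \<noteq> 0" "1 - v * v \<noteq> 0"
    using one_plus_q_powi[of "2 * n"] one_plus_q_powi[of "2 * n + 2 * r"] q_powi_ne(3)[of "2 * r"] assms
    unfolding e by auto
  show ?thesis
    using nz unfolding sec_def hyp_def e by (simp add: u_def[symmetric] v_def[symmetric] divide_simps) (simp add: algebra_simps)
qed

text \<open>Square the series and collect the pairs of indices by their difference r. The sign
  (-1)^(n + n + r) depends on r only, so alternation does not disturb the telescoping over n; r = 0
  gives the sum of squares.\<close>

lemma sec_alternating_squared:
  "(\<Sum>\<^sub>\<infinity>n. (-1) powi n * sec q n) ^ 2 =
     (\<Sum>\<^sub>\<infinity>n. sech2 (2 * n)) + (\<Sum>\<^sub>\<infinity>r. (-1) powi r * (of_int r * (q powi r / (1 - q powi (2 * r)))))"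
  (is "?a ^ 2 = _ + ?b")
proof -
  define g where "g r = (if r = 0 then (\<Sum>\<^sub>\<infinity>n. sech2 (2 * n)) else 0) +
     (-1) powi r * (of_int r * (q powi r / (1 - q powi (2 * r))))" for r
  define W where "W n r = (-1) powi r * (sec q n * sec q (n + r))" for n r
  have b: "(\<lambda>m::int. 1 / (1 - \<rho>) * \<rho> ^ nat \<bar>m\<bar>) summable_on UNIV"
    by (rule rho_power_summable)
  have "(\<lambda>(n, m). ((-1) powi n * sec q n) * ((-1) powi m * sec q m)) summable_on UNIV \<times> UNIV"
    by (rule summable_on_product_bound[OF b b])
      (use sec_bound rho in \<open>auto simp: norm_mult norm_power_int intro!: mult_mono simp del: times_divide_eq_left\<close>)
  also have "?this \<longleftrightarrow> (\<lambda>(n, r). W n r) summable_on UNIV \<times> UNIV"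
    by (rule summable_on_reindex_bij_witness[of _ "\<lambda>(n, r). (n, n + r)" "\<lambda>(n, m). (n, m - n)"])
      (auto simp: W_def power_int_minus_left)
  finally have W: "(\<lambda>(n, r). W n r) summable_on UNIV \<times> UNIV" .
  have inner: "((\<lambda>n. W n r) has_sum g r) UNIV" for r
  proof (cases "r = 0")
    case True
    have "(\<lambda>n. sech2 (2 * n + 0)) summable_on UNIV" by (rule summable_on_progression[OF sech2_summable])
    then show ?thesis using True sec_squared by (simp add: W_def g_def power2_eq_square[symmetric])
  next
    case False
    have tel: "((\<lambda>n. tnh q (2 * n) - tnh q (2 * n + 2 * r)) has_sum - of_int (2 * r)) UNIV"
      using hyp_telescope[of "-1" "-1" 0 "2 * r"] by simp
    define X where "X = q powi r / (1 - q powi (2 * r))"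
    have "W n r = (-1) powi r * (- X / 2) * (tnh q (2 * n) - tnh q (2 * n + 2 * r))" for n
      by (simp only: W_def sec_times_sec[OF False] X_def mult.assoc)
    moreover have "g r = (-1) powi r * (- X / 2) * (- of_int (2 * r))"
      using False by (simp add: g_def X_def[symmetric])
    ultimately show ?thesis using has_sum_cmult_right[OF tel, of "(-1) powi r * (- X / 2)"] by (simp only:)
  qed
  have "?a ^ 2 = (\<Sum>\<^sub>\<infinity>n. \<Sum>\<^sub>\<infinity>r. W n r)"
    unfolding power2_eq_square
  proof (subst infsum_cmult_left'[symmetric], rule infsum_cong)
    fix n
    have "?a = (\<Sum>\<^sub>\<infinity>r. (-1) powi (n + r) * sec q (n + r))"
      by (rule infsum_reindex_bij_witness[of _ "\<lambda>r. n + r" "\<lambda>m. m - n"]) auto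
    then have "(-1) powi n * sec q n * ?a = (\<Sum>\<^sub>\<infinity>r. (-1) powi n * sec q n * ((-1) powi (n + r) * sec q (n + r)))"
      by (simp add: infsum_cmult_right')
    also have "\<dots> = (\<Sum>\<^sub>\<infinity>r. W n r)"
      by (rule infsum_cong) (simp add: W_def power_int_minus_left)
    finally show "(-1) powi n * sec q n * ?a = (\<Sum>\<^sub>\<infinity>r. W n r)" .
  qed
  also have "\<dots> = (\<Sum>\<^sub>\<infinity>r. \<Sum>\<^sub>\<infinity>n. W n r)" by (rule infsum_swap_banach[OF W])
  also have "\<dots> = infsum g UNIV" by (simp add: infsumI[OF inner])
  also have "infsum g UNIV = (\<Sum>\<^sub>\<infinity>n. sech2 (2 * n)) + ?b"
  proof -
    have "(\<lambda>(r, n). W n r) summable_on UNIV \<times> UNIV"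
      using W by (subst summable_on_swap) (simp add: case_prod_unfold)
    from summable_on_Sigma_banach[OF this] have g: "g summable_on UNIV" by (simp add: infsumI[OF inner])
    have d: "((\<lambda>r. if r = 0 then (\<Sum>\<^sub>\<infinity>n. sech2 (2 * n)) else 0) has_sum (\<Sum>\<^sub>\<infinity>n. sech2 (2 * n))) (UNIV :: int set)"
      by (rule has_sum_finite_neutralI[where B = "{0}"]) auto
    from has_sum_add[OF has_sum_infsum[OF g] has_sum_uminusI[OF d]]
    have "((\<lambda>r. (-1) powi r * (of_int r * (q powi r / (1 - q powi (2 * r))))) has_sum
       (infsum g UNIV + - (\<Sum>\<^sub>\<infinity>n. sech2 (2 * n)))) UNIV" by (simp add: g_def)
    then show ?thesis by (simp add: infsumI)
  qed
  finally show ?thesis .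
qed

text \<open>Both sides are, up to folding by symmetry, the double series of d (-1)^d q^((2 n + 1)
  d): summing over n first gives the left side, summing over d first the right side.\<close>

lemma odd_sech2_lambert:
  "(\<Sum>\<^sub>\<infinity>r. (-1) powi r * (of_int r * (q powi r / (1 - q powi (2 * r))))) = - (\<Sum>\<^sub>\<infinity>n. sech2 (2 * n + 1))"
proof -
  define f where "f r = (-1) powi r * (of_int r * (q powi r / (1 - q powi (2 * r))))" for r
  define W :: "nat \<Rightarrow> nat \<Rightarrow> complex" where "W n d = of_nat d * (-1) ^ d * q ^ ((2 * n + 1) * d)" for n d
  have W: "(\<lambda>(n, d). W n d) summable_on UNIV \<times> {1..}"
  proof (rule summable_on_product_bound[OF rho_nat_summable rho_n_summable])
    fix n d :: nat assume "d \<in> {1..}"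
    then have "n * 1 \<le> n * (2 * d)" by (intro mult_left_mono) auto
    then have "n + d \<le> (2 * n + 1) * d" by (simp add: algebra_simps)
    then have "\<rho> ^ ((2 * n + 1) * d) \<le> \<rho> ^ (n + d)" using rho by (intro power_decreasing) auto
    then have "real d * \<rho> ^ ((2 * n + 1) * d) \<le> real d * \<rho> ^ (n + d)" by (rule mult_left_mono) simp
    also have "\<dots> = \<rho> ^ n * (real d * \<rho> ^ d)" by (simp add: power_add mult_ac)
    finally show "norm (case (n, d) of (n, d) \<Rightarrow> W n d) \<le> \<rho> ^ n * (of_nat d * \<rho> ^ d)"
      by (simp add: W_def norm_mult norm_power)
  qed (use rho in auto)
  have rows: "((\<lambda>d. W n d) has_sum - sech2 (2 * int n + 1)) {1..}" for n
    using has_sum_uminusI[OF sech2_has_sum[of "2 * n + 1"]] by (simp add: W_def algebra_simps)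
  have cols: "((\<lambda>n. W n d) has_sum f (int d)) UNIV" if "d \<in> {1..}" for d
  proof -
    have lt: "norm (q ^ (2 * d)) < 1" using that q_lt by (simp add: norm_power power_less_one_iff)
    have "(\<lambda>n. (q ^ (2 * d)) ^ n) sums (1 / (1 - q ^ (2 * d)))" by (rule geometric_sums[OF lt])
    then have "((\<lambda>n. (q ^ (2 * d)) ^ n) has_sum (1 / (1 - q ^ (2 * d)))) UNIV"
      using lt by (intro norm_summable_imp_has_sum) (auto simp: norm_power intro!: summable_geometric)
    from has_sum_cmult_right[OF this, of "of_nat d * (-1) ^ d * q ^ d"]
    have "((\<lambda>n. W n d) has_sum of_nat d * (-1) ^ d * q ^ d * (1 / (1 - q ^ (2 * d)))) UNIV"
      by (simp add: W_def power_mult[symmetric] power_add algebra_simps)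
    moreover have "f (int d) = of_nat d * (-1) ^ d * q ^ d * (1 / (1 - q ^ (2 * d)))"
      unfolding f_def using power_int_of_nat[of q "2 * d"] by (simp add: mult_ac)
    ultimately show ?thesis by simp
  qed
  have "(\<lambda>(d, n). W n d) summable_on {1..} \<times> UNIV"
    using W by (subst summable_on_swap) (simp add: case_prod_unfold)
  then have fs: "(\<lambda>d. f (int d)) summable_on {1..}"
    using summable_on_Sigma_banach[of "\<lambda>d n. W n d" "{1..}" "\<lambda>_. UNIV"] infsumI[OF cols]
    by (subst summable_on_cong[where g = "\<lambda>d. \<Sum>\<^sub>\<infinity>n. W n d"]) simp_all
  have even: "f (- r) = f r" for r
  proof (cases "r = 0")
    case False
    have e: "q powi (2 * r) = q powi r * q powi r" using power_int_add[of q r r] by simp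
    have "1 - q powi (2 * r) \<noteq> 0" using False by (intro q_powi_ne) auto
    then show ?thesis unfolding f_def mult_minus_right power_int_minus e
      by (simp add: power_int_minus_left divide_simps) (auto simp: algebra_simps)
  qed simp
  have "f summable_on UNIV"
  proof -
    have 1: "f summable_on {1..}"
      by (rule summable_on_reindex_bij_witness[of _ nat int, THEN iffD1, OF _ _ _ _ _ fs]) auto
    have 2: "f summable_on {..-1}"
      by (rule summable_on_reindex_bij_witness[of _ "\<lambda>n. nat (-n)" "\<lambda>n. - int n", THEN iffD1, OF _ _ _ _ _ fs]) (auto simp: even)
    have "f summable_on insert 0 ({1..} \<union> {..-1})"
      using summable_on_union[OF 1 2] by (simp add: summable_on_insert_iff)
    also have "insert 0 ({1..} \<union> {..-1}) = (UNIV :: int set)" by auto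
    finally show ?thesis .
  qed
  from infsum_int_even[OF this even] have "infsum f UNIV = 2 * (\<Sum>\<^sub>\<infinity>d\<in>{1..}. f (int d))"
    by (simp add: f_def[of 0])
  also have "(\<Sum>\<^sub>\<infinity>d\<in>{1..}. f (int d)) = (\<Sum>\<^sub>\<infinity>d\<in>{1..}. \<Sum>\<^sub>\<infinity>n. W n d)"
    by (rule infsum_cong) (simp add: infsumI[OF cols])
  also have "\<dots> = (\<Sum>\<^sub>\<infinity>n. \<Sum>\<^sub>\<infinity>d\<in>{1..}. W n d)"
    by (rule infsum_swap_banach[OF W, symmetric])
  also have "\<dots> = - (\<Sum>\<^sub>\<infinity>n. sech2 (2 * int n + 1))"
    unfolding infsumI[OF rows] by (rule infsum_uminus)
  also have "2 * \<dots> = - (\<Sum>\<^sub>\<infinity>n. sech2 (2 * n + 1))"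
  proof -
    have *: "2 * (- n - 1) + 1 = - (2 * n + 1)" for n :: int by simp
    have "infsum (\<lambda>n. sech2 (2 * n + 1)) UNIV = 2 * (\<Sum>\<^sub>\<infinity>n. sech2 (2 * int n + 1))"
      by (rule infsum_int_even'[OF summable_on_progression[OF sech2_summable]]) (unfold *, rule sech2_minus)
    then show ?thesis by simp
  qed
  finally show ?thesis unfolding f_def .
qed

lemma jacobi_four_squares:
  "th4 ^ 4 = 4 * ((\<Sum>\<^sub>\<infinity>n. sech2 (2 * n)) - (\<Sum>\<^sub>\<infinity>n. sech2 (2 * n + 1)))"
proof -
  have "th4 ^ 4 = (th4 ^ 2) ^ 2" by simp
  also have "\<dots> = 4 * (\<Sum>\<^sub>\<infinity>n. (-1) powi n * sec q n) ^ 2" unfolding th4_squared by (simp add: power_mult_distrib)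
  finally show ?thesis unfolding sec_alternating_squared odd_sech2_lambert by simp
qed

text \<open>In th4 (V 1 - V 0) the coth series of \<open>V_sum_diff\<close> cancels, and what
  remains is the four-square expression for th4^4.\<close>

theorem th4_cubed: "th4 ^ 3 = tanh_sum q 1 - tanh_sum q 0"
proof -
  have "th4 * (tanh_sum q 1 - tanh_sum q 0) = th4 ^ 4"
    using V_sum_diff[of 0] V_sum_diff[of 1] unfolding jacobi_four_squares right_diff_distrib by (simp only: add_0_right) simp
  also have "\<dots> = th4 * th4 ^ 3" by (simp add: power4_eq_xxxx power3_eq_cube)
  finally show ?thesis using th4_nonzero by simp
qed

end

text \<open>Shanks' finite form of Gauss's product for the triangular numbers.\<close>

lemma triangular_partial_sum:
  fixes Q :: complex
  assumes Q: "norm Q < 1"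
  defines "r \<equiv> \<lambda>n. \<Prod>i<n. (1 - Q ^ (2 * i + 1)) / (1 - Q ^ (2 * i + 2))"
  shows "(\<Sum>s<n. r s * Q ^ (s * (2 * n + 1))) = r n * (\<Sum>s<2*n. Q ^ (s * (s + 1) div 2))"
proof (induction n)
  case (Suc n)
  have ne: "1 - Q ^ Suc k \<noteq> 0" for k
  proof
    assume "1 - Q ^ Suc k = 0"
    then have "norm Q ^ Suc k = 1" using norm_power[of Q "Suc k"] by simp
    moreover have "norm Q ^ Suc k \<le> norm Q" using power_decreasing[of 1 "Suc k" "norm Q"] Q by simp
    ultimately show False using Q by linarith
  qed
  have ne1: "1 - Q ^ (2 * i + 1) \<noteq> 0" "1 - Q ^ (2 * i + 2) \<noteq> 0" for i using ne[of "2*i"] ne[of "2*i+1"] by auto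
  have rs: "r (Suc s) * (1 - Q ^ (2 * s + 2)) = r s * (1 - Q ^ (2 * s + 1))" for s
    using ne1[of s] by (simp add: r_def)
  \<comment> \<open>A telescoping certificate for the recursion in n: the combination in
    \<open>step\<close> is a difference in s, and the factor 1 - Q^(2 s) makes \<open>u 0\<close>
    vanish.\<close>
  define u where "u s = Q ^ (s * (2 * n + 1)) * (1 - Q ^ (2 * s)) * r s" for s
  have step: "(1 - Q ^ (2 * n + 2)) * (r s * Q ^ (s * (2 * Suc n + 1))) - (1 - Q ^ (2 * n + 1)) * (r s * Q ^ (s * (2 * n + 1))) = u (Suc s) - u s" for s
  proof -
    have "u (Suc s) = Q ^ (Suc s * (2 * n + 1)) * (r (Suc s) * (1 - Q ^ (2 * s + 2)))" by (simp add: u_def)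
    also have "\<dots> = Q ^ (2 * n + 1) * Q ^ (s * (2 * n + 1)) * (1 - Q ^ (2 * s + 1)) * r s"
      unfolding rs by (simp add: power_add algebra_simps)
    finally have us: "u (Suc s) = Q ^ (2 * n + 1) * Q ^ (s * (2 * n + 1)) * (1 - Q ^ (2 * s + 1)) * r s" .
    define x y z where "x = Q ^ (s * (2 * n + 1))" and "y = Q ^ (2 * s)" and "z = Q ^ (2 * n)"
    have e: "Q ^ (s * (2 * Suc n + 1)) = x * y" "Q ^ (2 * n + 2) = Q * Q * z" "Q ^ (2 * n + 1) = Q * z"
        "Q ^ (2 * s + 1) = Q * y"
      by (simp_all add: x_def y_def z_def power_add[symmetric] algebra_simps)
    show ?thesis unfolding us unfolding u_def e x_def[symmetric] y_def[symmetric] by (simp add: algebra_simps)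
  qed
  have "(1 - Q ^ (2 * n + 2)) * (\<Sum>s\<le>n. r s * Q ^ (s * (2 * Suc n + 1))) - (1 - Q ^ (2 * n + 1)) * (\<Sum>s\<le>n. r s * Q ^ (s * (2 * n + 1)))
      = (\<Sum>s\<le>n. u (Suc s) - u s)"
    by (simp only: sum_distrib_left step sum_subtractf[symmetric])
  also have "\<dots> = u (Suc n)"
  proof -
    have "(\<Sum>s\<le>m. u (Suc s) - u s) = u (Suc m) - u 0" for m by (induction m) auto
    then show ?thesis by (simp add: u_def[of 0])
  qed
  also have "\<dots> = Q ^ (Suc n * (2 * n + 1)) * (r n * (1 - Q ^ (2 * n + 1)))"
    unfolding rs[symmetric] by (simp add: u_def)
  finally have "(1 - Q ^ (2 * n + 2)) * (\<Sum>s\<le>n. r s * Q ^ (s * (2 * Suc n + 1)))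
     = (1 - Q ^ (2 * n + 1)) * ((\<Sum>s\<le>n. r s * Q ^ (s * (2 * n + 1))) + r n * Q ^ (Suc n * (2 * n + 1)))"
    by (simp add: algebra_simps)
  also have "(\<Sum>s\<le>n. r s * Q ^ (s * (2 * n + 1))) = r n * ((\<Sum>s<2*n. Q ^ (s * (s + 1) div 2)) + Q ^ (n * (2 * n + 1)))"
    using Suc.IH by (simp add: lessThan_Suc_atMost[symmetric] distrib_left)
  \<comment> \<open>The triangular numbers with indices 2 n and 2 n + 1 are n (2 n + 1) and (n + 1)
    (2 n + 1): the first comes from the term s = n, the second from the boundary value
    \<open>u (Suc n)\<close>.\<close>
  also have "(\<Sum>s<2*n. Q ^ (s * (s + 1) div 2)) + Q ^ (n * (2 * n + 1)) = (\<Sum>s<2*n+1. Q ^ (s * (s + 1) div 2))"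
    by (simp add: algebra_simps)
  also have "(1 - Q ^ (2 * n + 1)) * (r n * (\<Sum>s<2*n+1. Q ^ (s * (s + 1) div 2)) + r n * Q ^ (Suc n * (2 * n + 1)))
     = (r n * (1 - Q ^ (2 * n + 1))) * ((\<Sum>s<2*n+1. Q ^ (s * (s + 1) div 2)) + Q ^ (Suc n * (2 * n + 1)))"
    by (simp add: algebra_simps)
  also have "(\<Sum>s<2*n+1. Q ^ (s * (s + 1) div 2)) + Q ^ (Suc n * (2 * n + 1)) = (\<Sum>s<2*Suc n. Q ^ (s * (s + 1) div 2))"
  proof -
    have "(2 * n + 1) * ((2 * n + 1) + 1) div 2 = Suc n * (2 * n + 1)" by (simp add: algebra_simps)
    moreover have "2 * Suc n = Suc (2 * n + 1)" by simp
    ultimately show ?thesis by (simp only: sum.lessThan_Suc)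
  qed
  also have "r n * (1 - Q ^ (2 * n + 1)) = r (Suc n) * (1 - Q ^ (2 * n + 2))" by (rule rs[symmetric])
  finally show ?case using ne1(2)[of n] by (simp add: lessThan_Suc_atMost mult_ac)
qed simp

text \<open>Let n tend to infinity in the finite identity: on the left the term s = 0 is 1, and each
  of the fewer than n others is at most B |Q|^n because the partial products r are bounded.\<close>

lemma triangular_product:
  fixes Q :: complex
  assumes Q: "norm Q < 1"
  shows "(\<Prod>n. (1 - Q ^ (2 * n + 1)) / (1 - Q ^ (2 * n + 2))) * (\<Sum>\<^sub>\<infinity>n. Q ^ (n * (n + 1) div 2)) = 1"
proof -
  define f where "f i = (1 - Q ^ (2 * i + 1)) / (1 - Q ^ (2 * i + 2))" for i
  define r where "r n = (\<Prod>i<n. f i)" for n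
  have Qp: "norm Q ^ k \<le> norm Q" if "k > 0" for k
    using power_decreasing[of 1 k "norm Q"] that Q by auto
  have ne: "1 - norm Q \<le> norm (1 - Q ^ k)" if "k > 0" for k
    using norm_triangle_ineq2[of 1 "Q ^ k"] Qp[OF that] by (simp add: norm_power)
  have f1: "norm (f i - 1) \<le> 2 / (1 - norm Q) * norm Q ^ i" for i
  proof -
    have nz: "1 - Q ^ (2 * i + 2) \<noteq> 0" using ne[of "2 * i + 2"] Q by auto
    have "f i - 1 = (Q ^ (2 * i + 2) - Q ^ (2 * i + 1)) / (1 - Q ^ (2 * i + 2))"
      using nz by (simp add: f_def field_simps)
    moreover have "norm (Q ^ (2 * i + 2) - Q ^ (2 * i + 1)) \<le> 2 * norm Q ^ i"
    proof -
      have "norm (Q ^ (2 * i + 2) - Q ^ (2 * i + 1)) \<le> norm Q ^ (2 * i + 2) + norm Q ^ (2 * i + 1)"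
        using norm_triangle_ineq4 by (metis norm_power)
      also have "\<dots> \<le> norm Q ^ i + norm Q ^ i" using Q by (intro add_mono power_decreasing) auto
      finally show ?thesis by simp
    qed
    ultimately have "norm (f i - 1) \<le> (2 * norm Q ^ i) / (1 - norm Q)"
      unfolding norm_divide using Q ne[of "2 * i + 2"] by (auto simp: norm_divide intro!: frac_le)
    then show ?thesis by simp
  qed
  have "summable (\<lambda>i. norm (f i - 1))"
    by (rule summable_comparison_test'[where g = "\<lambda>i. 2 / (1 - norm Q) * norm Q ^ i" and N = 0])
      (use f1 Q in \<open>auto intro!: summable_mult summable_geometric\<close>)
  then have "convergent_prod f"
    by (intro abs_convergent_prod_imp_convergent_prod summable_imp_abs_convergent_prod)
  then have "(\<lambda>n. \<Prod>i\<le>n. f i) \<longlonglongrightarrow> prodinf f" by (rule convergent_prod_LIMSEQ)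
  then have "(\<lambda>n. r (Suc n)) \<longlonglongrightarrow> prodinf f" by (simp add: r_def lessThan_Suc_atMost)
  then have r: "r \<longlonglongrightarrow> prodinf f" by (simp add: filterlim_sequentially_Suc)
  obtain B where B: "B > 0" "\<And>n. norm (r n) \<le> B" using convergent_imp_Bseq[of r] r by (auto simp: convergent_def Bseq_def)
  define T where "T n = (\<Sum>s<n. Q ^ (s * (s + 1) div 2))" for n
  define \<psi> where "\<psi> = (\<Sum>\<^sub>\<infinity>n. Q ^ (n * (n + 1) div 2))"
  have "summable (\<lambda>n. norm (Q ^ (n * (n + 1) div 2)))"
  proof (rule summable_comparison_test'[where g = "\<lambda>i. norm Q ^ i" and N = 0])
    fix n :: nat
    have "n \<le> n * (n + 1) div 2" by (induction n) auto
    then show "norm (norm (Q ^ (n * (n + 1) div 2))) \<le> norm Q ^ n"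
      using Q power_decreasing[of n "n * (n + 1) div 2" "norm Q"] by (simp add: norm_power)
  qed (use Q in auto)
  then have "((\<lambda>n. Q ^ (n * (n + 1) div 2)) has_sum \<psi>) UNIV"
    unfolding \<psi>_def by (intro has_sum_infsum norm_summable_imp_summable_on)
  then have "T \<longlonglongrightarrow> \<psi>" unfolding T_def using has_sum_imp_sums sums_def by blast
  then have T2: "(\<lambda>n. T (2 * n)) \<longlonglongrightarrow> \<psi>"
    using LIMSEQ_subseq_LIMSEQ[of T \<psi> "\<lambda>n. 2 * n"] by (auto simp: o_def strict_mono_def)
  have "(\<lambda>n. r n * T (2 * n) - 1) \<longlonglongrightarrow> 0"
  proof (rule Lim_null_comparison)
    show "\<forall>\<^sub>F n in sequentially. norm (r n * T (2 * n) - 1) \<le> B * (of_nat n * norm Q ^ n)"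
      using eventually_gt_at_top[of 0]
    proof eventually_elim
      case (elim n)
      have "r n * T (2 * n) = (\<Sum>s<n. r s * Q ^ (s * (2 * n + 1)))"
        using triangular_partial_sum[OF Q, of n] by (simp add: r_def f_def T_def)
      also have "{..<n} = insert 0 {1..<n}" using elim by auto
      also have "(\<Sum>s\<in>insert 0 {1..<n}. r s * Q ^ (s * (2 * n + 1))) - 1 = (\<Sum>s\<in>{1..<n}. r s * Q ^ (s * (2 * n + 1)))"
        by (subst sum.insert) (auto simp: r_def)
      also have "norm \<dots> \<le> (\<Sum>s\<in>{1..<n}. B * norm Q ^ n)"
      proof (rule sum_norm_le)
        fix s assume "s \<in> {1..<n}"
        then have "1 * n \<le> s * (2 * n + 1)" by (intro mult_mono) auto
        then have "norm Q ^ (s * (2 * n + 1)) \<le> norm Q ^ n" using Q by (intro power_decreasing) auto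
        then show "norm (r s * Q ^ (s * (2 * n + 1))) \<le> B * norm Q ^ n"
          unfolding norm_mult norm_power using B by (intro mult_mono) auto
      qed
      also have "\<dots> = real (n - 1) * (B * norm Q ^ n)" by simp
      also have "\<dots> \<le> real n * (B * norm Q ^ n)" using B by (intro mult_right_mono) auto
      also have "\<dots> = B * (of_nat n * norm Q ^ n)" by simp
      finally show ?case .
    qed
    have "(\<lambda>n. of_nat n * norm Q ^ n) \<longlonglongrightarrow> 0" using powser_times_n_limit_0[of "norm Q"] Q by simp
    then show "(\<lambda>n. B * (of_nat n * norm Q ^ n)) \<longlonglongrightarrow> 0" using tendsto_mult_right_zero by blast
  qed
  then have "(\<lambda>n. r n * T (2 * n)) \<longlonglongrightarrow> 1" by (rule LIM_zero_cancel)
  moreover have "(\<lambda>n. r n * T (2 * n)) \<longlonglongrightarrow> prodinf f * \<psi>" by (intro tendsto_mult r T2)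
  ultimately have "prodinf f * \<psi> = 1" using LIMSEQ_unique by blast
  then show ?thesis unfolding f_def \<psi>_def .
qed

subsection \<open>Reduced forms\<close>

definition reduced_bqf :: "bqf \<Rightarrow> bool" where
  "reduced_bqf f = (case f of (a, b, c) \<Rightarrow> 0 < a \<and> - a < b \<and> b \<le> a \<and> a \<le> c \<and> (a = c \<longrightarrow> 0 \<le> b))"

lemma SL2Z_equivalent_refl: "SL2Z_equivalent f f"
  unfolding SL2Z_equivalent_def by (rule exI[of _ 1], rule exI[of _ 0], rule exI[of _ 0], rule exI[of _ 1]) simp

lemma SL2Z_equivalent_sym:
  assumes "SL2Z_equivalent f g"
  shows "SL2Z_equivalent g f"
proof -
  obtain \<alpha> \<beta> \<gamma> \<delta> where det: "\<alpha> * \<delta> - \<beta> * \<gamma> = 1"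
    and ev: "\<And>x y. bqf_eval g x y = bqf_eval f (\<alpha> * x + \<beta> * y) (\<gamma> * x + \<delta> * y)"
    using assms unfolding SL2Z_equivalent_def by blast
  have "bqf_eval f x y = bqf_eval g (\<delta> * x + (- \<beta>) * y) ((- \<gamma>) * x + \<alpha> * y)" for x y
  proof -
    have "\<alpha> * (\<delta> * x + (- \<beta>) * y) + \<beta> * ((- \<gamma>) * x + \<alpha> * y) = (\<alpha> * \<delta> - \<beta> * \<gamma>) * x"
      "\<gamma> * (\<delta> * x + (- \<beta>) * y) + \<delta> * ((- \<gamma>) * x + \<alpha> * y) = (\<alpha> * \<delta> - \<beta> * \<gamma>) * y"
      by (simp_all add: algebra_simps)
    then show ?thesis unfolding ev det by simp
  qed
  moreover have "\<delta> * \<alpha> - (- \<beta>) * (- \<gamma>) = 1" using det by (simp add: algebra_simps)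
  ultimately show ?thesis unfolding SL2Z_equivalent_def by blast
qed

lemma SL2Z_equivalent_trans:
  assumes "SL2Z_equivalent f g" "SL2Z_equivalent g h"
  shows "SL2Z_equivalent f h"
proof -
  obtain a b c d where det: "a * d - b * c = 1"
    and ev: "\<And>x y. bqf_eval g x y = bqf_eval f (a * x + b * y) (c * x + d * y)"
    using assms(1) unfolding SL2Z_equivalent_def by blast
  obtain a' b' c' d' where det': "a' * d' - b' * c' = 1"
    and ev': "\<And>x y. bqf_eval h x y = bqf_eval g (a' * x + b' * y) (c' * x + d' * y)"
    using assms(2) unfolding SL2Z_equivalent_def by blast
  have "(a * a' + b * c') * (c * b' + d * d') - (a * b' + b * d') * (c * a' + d * c') = (a * d - b * c) * (a' * d' - b' * c')"
    by (simp add: algebra_simps)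
  moreover have "bqf_eval h x y = bqf_eval f ((a * a' + b * c') * x + (a * b' + b * d') * y) ((c * a' + d * c') * x + (c * b' + d * d') * y)" for x y
    unfolding ev' ev by (simp add: algebra_simps)
  ultimately show ?thesis unfolding SL2Z_equivalent_def using det det' by (metis mult_1)
qed

lemma bqf_eval_inject:
  assumes "\<And>x y. bqf_eval f x y = bqf_eval g x y"
  shows "f = g"
proof -
  obtain a b c a' b' c' where fg: "f = (a, b, c)" "g = (a', b', c')" by (cases f, cases g) auto
  show ?thesis using assms[of 1 0] assms[of 0 1] assms[of 1 1] by (simp add: fg)
qed

lemma bqf_substitute:
  "bqf_eval (a, b, c) (\<alpha> * x + \<beta> * y) (\<gamma> * x + \<delta> * y) =
   bqf_eval (bqf_eval (a, b, c) \<alpha> \<gamma>, 2 * a * \<alpha> * \<beta> + b * (\<alpha> * \<delta> + \<beta> * \<gamma>) + 2 * c * \<gamma> * \<delta>, bqf_eval (a, b, c) \<beta> \<delta>) x y"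
  by (simp add: power2_eq_square algebra_simps)

lemma SL2Z_equivalentI:
  assumes "\<alpha> * \<delta> - \<beta> * \<gamma> = 1"
    and "g = (bqf_eval (a, b, c) \<alpha> \<gamma>, 2 * a * \<alpha> * \<beta> + b * (\<alpha> * \<delta> + \<beta> * \<gamma>) + 2 * c * \<gamma> * \<delta>, bqf_eval (a, b, c) \<beta> \<delta>)"
  shows "SL2Z_equivalent (a, b, c) g"
  unfolding SL2Z_equivalent_def assms(2) using bqf_substitute assms(1) by metis

lemma SL2Z_equivalentE:
  assumes "SL2Z_equivalent (a, b, c) (a', b', c')"
  obtains \<alpha> \<beta> \<gamma> \<delta> where "\<alpha> * \<delta> - \<beta> * \<gamma> = 1" "a' = bqf_eval (a, b, c) \<alpha> \<gamma>"
    "b' = 2 * a * \<alpha> * \<beta> + b * (\<alpha> * \<delta> + \<beta> * \<gamma>) + 2 * c * \<gamma> * \<delta>" "c' = bqf_eval (a, b, c) \<beta> \<delta>"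
proof -
  obtain \<alpha> \<beta> \<gamma> \<delta> where det: "\<alpha> * \<delta> - \<beta> * \<gamma> = 1"
    and ev: "\<And>x y. bqf_eval (a', b', c') x y = bqf_eval (a, b, c) (\<alpha> * x + \<beta> * y) (\<gamma> * x + \<delta> * y)"
    using assms unfolding SL2Z_equivalent_def by blast
  have "(a', b', c') = (bqf_eval (a, b, c) \<alpha> \<gamma>, 2 * a * \<alpha> * \<beta> + b * (\<alpha> * \<delta> + \<beta> * \<gamma>) + 2 * c * \<gamma> * \<delta>, bqf_eval (a, b, c) \<beta> \<delta>)"
    by (rule bqf_eval_inject) (simp only: ev bqf_substitute)
  then show ?thesis using that det by simp
qed

lemma SL2Z_equivalent_disc:
  assumes "SL2Z_equivalent f g"
  shows "bqf_disc g = bqf_disc f"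
proof -
  obtain a b c a' b' c' where fg: "f = (a, b, c)" "g = (a', b', c')" by (cases f, cases g) auto
  obtain \<alpha> \<beta> \<gamma> \<delta> where *: "\<alpha> * \<delta> - \<beta> * \<gamma> = 1" "a' = bqf_eval (a, b, c) \<alpha> \<gamma>"
    "b' = 2 * a * \<alpha> * \<beta> + b * (\<alpha> * \<delta> + \<beta> * \<gamma>) + 2 * c * \<gamma> * \<delta>" "c' = bqf_eval (a, b, c) \<beta> \<delta>"
    using SL2Z_equivalentE assms unfolding fg by metis
  have "b'\<^sup>2 - 4 * a' * c' = (b\<^sup>2 - 4 * a * c) * (\<alpha> * \<delta> - \<beta> * \<gamma>)\<^sup>2"
    unfolding *(2-4) by (simp add: power2_eq_square algebra_simps)
  then show ?thesis using *(1) by (simp add: fg)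
qed

lemma SL2Z_equivalent_pos_def:
  assumes "SL2Z_equivalent f g" "bqf_pos_def f"
  shows "bqf_pos_def g"
proof -
  obtain \<alpha> \<beta> \<gamma> \<delta> where det: "\<alpha> * \<delta> - \<beta> * \<gamma> = 1"
    and ev: "\<And>x y. bqf_eval g x y = bqf_eval f (\<alpha> * x + \<beta> * y) (\<gamma> * x + \<delta> * y)"
    using assms(1) unfolding SL2Z_equivalent_def by blast
  have "bqf_eval g x y > 0" if "(x, y) \<noteq> (0, 0)" for x y
  proof -
    have "(\<alpha> * x + \<beta> * y, \<gamma> * x + \<delta> * y) \<noteq> (0, 0)"
    proof
      assume "(\<alpha> * x + \<beta> * y, \<gamma> * x + \<delta> * y) = (0, 0)"
      then have 0: "\<alpha> * x + \<beta> * y = 0" "\<gamma> * x + \<delta> * y = 0" by auto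
      have "(\<alpha> * \<delta> - \<beta> * \<gamma>) * x = \<delta> * (\<alpha> * x + \<beta> * y) - \<beta> * (\<gamma> * x + \<delta> * y)"
        "(\<alpha> * \<delta> - \<beta> * \<gamma>) * y = \<alpha> * (\<gamma> * x + \<delta> * y) - \<gamma> * (\<alpha> * x + \<beta> * y)"
        by (simp_all add: algebra_simps)
      then show False using that unfolding 0 det by simp
    qed
    then show ?thesis using assms(2) unfolding bqf_pos_def_def ev by blast
  qed
  then show ?thesis unfolding bqf_pos_def_def by blast
qed

lemma bqf_pos_def_lead:
  assumes "bqf_pos_def (a, b, c)"
  shows "a > 0"
  using spec[OF spec[OF assms[unfolded bqf_pos_def_def], of 1], of 0] by simp

lemma four_a_bqf_eval:
  "4 * a * bqf_eval (a, b, c) x y = (2 * a * x + b * y)\<^sup>2 - bqf_disc (a, b, c) * y\<^sup>2"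
  by (simp add: power2_eq_square algebra_simps)

lemma bqf_pos_def_iff:
  assumes "bqf_disc (a, b, c) < 0"
  shows "bqf_pos_def (a, b, c) \<longleftrightarrow> a > 0"
proof
  assume "bqf_pos_def (a, b, c)"
  then show "a > 0" by (rule bqf_pos_def_lead)
next
  assume a: "a > 0"
  show "bqf_pos_def (a, b, c)" unfolding bqf_pos_def_def
  proof (intro allI impI)
    fix x y :: int assume xy: "(x, y) \<noteq> (0, 0)"
    have "4 * a * bqf_eval (a, b, c) x y > 0"
    proof (cases "y = 0")
      case True
      then show ?thesis using xy a by auto
    next
      case False
      then have "- bqf_disc (a, b, c) * y\<^sup>2 > 0" using assms by (intro mult_pos_pos) auto
      then show ?thesis unfolding four_a_bqf_eval
        using zero_le_power2[of "2 * a * x + b * y"] by linarith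
    qed
    then show "bqf_eval (a, b, c) x y > 0" using a by (simp only: zero_less_mult_iff) auto
  qed
qed

text \<open>Take a form of the class with minimal leading coefficient a. A translation brings b into
  the interval from - a (excluded) to a, the form with the outer coefficients exchanged shows a
  \<le> c by minimality, and when a = c this exchange also repairs a negative b.\<close>

lemma exists_reduced:
  assumes f: "bqf_pos_def f"
  obtains g where "SL2Z_equivalent f g" "reduced_bqf g"
proof -
  define S where "S = {g. SL2Z_equivalent f g}"
  have pos: "a > 0" if "(a, b, c) \<in> S" for a b c
  proof -
    have "bqf_pos_def (a, b, c)" using that f SL2Z_equivalent_pos_def by (auto simp: S_def)
    then show ?thesis by (rule bqf_pos_def_lead)
  qed
  have "f \<in> S" by (simp add: S_def SL2Z_equivalent_refl)
  then obtain g0 where g0: "g0 \<in> S" "\<And>g. g \<in> S \<Longrightarrow> nat (fst g0) \<le> nat (fst g)"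
    using ex_has_least_nat[of "\<lambda>g. g \<in> S" f "\<lambda>g. nat (fst g)"] by blast
  obtain a b0 c0 where g0eq: "g0 = (a, b0, c0)" by (cases g0)
  have a: "a > 0" using pos g0(1) g0eq by blast
  have min: "a \<le> a'" if "(a', b', c') \<in> S" for a' b' c'
    using g0(2)[OF that] pos[OF that] a by (simp add: g0eq)
  have closed: "h \<in> S" if "g \<in> S" "SL2Z_equivalent g h" for g h
    using that SL2Z_equivalent_trans by (auto simp: S_def)
  \<comment> \<open>Chosen so that b + a - 1 is the residue of b0 + a - 1 modulo 2 a; the shift by a
    - 1 fits the interval that excludes - a and includes a.\<close>
  define k where "k = - ((b0 + a - 1) div (2 * a))"
  define b c where "b = b0 + 2 * a * k" and "c = bqf_eval (a, b0, c0) k 1"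
  have "SL2Z_equivalent (a, b0, c0) (a, b, c)"
    \<comment> \<open>The arguments come in the order \<alpha>, \<delta>, \<beta>, \<gamma>: this is
      the translation x -> x + k y.\<close>
    by (rule SL2Z_equivalentI[of 1 1 k 0]) (auto simp: b_def c_def)
  then have g1: "(a, b, c) \<in> S" using closed g0(1) g0eq by blast
  have "b + a - 1 = (b0 + a - 1) mod (2 * a)"
    unfolding b_def k_def by (simp add: minus_mult_div_eq_mod[symmetric] algebra_simps)
  then have "0 \<le> b + a - 1" "b + a - 1 < 2 * a" using a by auto
  then have b: "- a < b" "b \<le> a" by auto
  have "SL2Z_equivalent (a, b, c) (c, - b, a)"
    by (rule SL2Z_equivalentI[of 0 0 "-1" 1]) auto
  then have g2: "(c, - b, a) \<in> S" using closed g1 by blast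
  have ac: "a \<le> c" using min[OF g2] .
  show ?thesis
  proof (cases "a = c \<and> b < 0")
    case True
    then have "reduced_bqf (c, - b, a)" using a b by (auto simp: reduced_bqf_def)
    then show ?thesis using that g2 by (auto simp: S_def)
  next
    case False
    then have "reduced_bqf (a, b, c)" using a b ac by (auto simp: reduced_bqf_def)
    then show ?thesis using that g1 by (auto simp: S_def)
  qed
qed

text \<open>As |b| \<le> a \<le> c, the mixed term |b x y| is absorbed by |b| times the larger of
  x^2 and y^2; the coefficients left over are smallest at |x| = |y| = 1.\<close>

lemma reduced_lower_bound:
  assumes r: "reduced_bqf (a, b, c)" and "y \<noteq> 0"
  shows "bqf_eval (a, b, c) x y \<ge> c" and "x \<noteq> 0 \<Longrightarrow> bqf_eval (a, b, c) x y \<ge> a + c - \<bar>b\<bar>"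
proof -
  define B where "B = \<bar>b\<bar>"
  have ab: "0 < a" "B \<le> a" "a \<le> c" "0 \<le> B" using r by (auto simp: reduced_bqf_def B_def)
  have y1: "1 \<le> \<bar>y\<bar>" using assms(2) by simp
  have *: "bqf_eval (a, b, c) x y \<ge> a + c - B" if "x \<noteq> 0"
  proof -
    have x1: "1 \<le> \<bar>x\<bar>" using that by simp
    define X Y where "X = \<bar>x\<bar>" and "Y = \<bar>y\<bar>"
    have XY: "1 \<le> X" "1 \<le> Y" using x1 y1 by (auto simp: X_def Y_def)
    have "b * (x * y) \<ge> - (B * (X * Y))"
      unfolding X_def Y_def B_def abs_mult[symmetric] by linarith
    then have bqf: "bqf_eval (a, b, c) x y \<ge> a * (X * X) - B * (X * Y) + c * (Y * Y)"
      by (simp add: X_def Y_def power2_eq_square mult.assoc)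
    have arith: "0 \<le> t1 - t2 + t3 - (a + c - B)" if "t4 + (a - B) \<le> t1" "t2 \<le> t4" "c \<le> t3" for t1 t2 t3 t4
      using that by linarith
    have arith': "0 \<le> t1 - t2 + t3 - (a + c - B)" if "t4 + (c - B) \<le> t3" "t2 \<le> t4" "a \<le> t1" for t1 t2 t3 t4
      using that by linarith
    note bqf
    moreover have "a * (X * X) - B * (X * Y) + c * (Y * Y) - (a + c - B) \<ge> 0"
    proof (cases "X \<ge> Y")
      case True
      have "a * (X * X) \<ge> B * (X * X) + (a - B) * 1"
      proof -
        have "1 \<le> X * X" using mult_mono[of 1 X 1 X] XY by simp
        then have "(a - B) * 1 \<le> (a - B) * (X * X)" using ab by (intro mult_left_mono) auto
        then show ?thesis by (simp add: algebra_simps)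
      qed
      moreover have "B * (X * Y) \<le> B * (X * X)" using True XY ab by (intro mult_left_mono) auto
      moreover have "c * 1 \<le> c * (Y * Y)" using mult_mono[of 1 Y 1 Y] XY ab by (intro mult_left_mono) auto
      ultimately show ?thesis by (intro arith) (simp_all only: mult_1_right)
    next
      case False
      have "c * (Y * Y) \<ge> B * (Y * Y) + (c - B) * 1"
      proof -
        have "1 \<le> Y * Y" using mult_mono[of 1 Y 1 Y] XY by simp
        then have "(c - B) * 1 \<le> (c - B) * (Y * Y)" using ab by (intro mult_left_mono) auto
        then show ?thesis by (simp add: algebra_simps)
      qed
      moreover have "B * (X * Y) \<le> B * (Y * Y)" using False XY ab by (intro mult_left_mono mult_right_mono) auto
      moreover have "a * 1 \<le> a * (X * X)" using mult_mono[of 1 X 1 X] XY ab by (intro mult_left_mono) auto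
      ultimately show ?thesis by (intro arith') (simp_all only: mult_1_right)
    qed
    ultimately show ?thesis by linarith
  qed
  then show "x \<noteq> 0 \<Longrightarrow> bqf_eval (a, b, c) x y \<ge> a + c - \<bar>b\<bar>" unfolding B_def .
  show "bqf_eval (a, b, c) x y \<ge> c"
  proof (cases "x = 0")
    case True
    have "c * 1 \<le> c * (\<bar>y\<bar> * \<bar>y\<bar>)" using mult_mono[of 1 "\<bar>y\<bar>" 1 "\<bar>y\<bar>"] y1 ab by (intro mult_left_mono) auto
    then show ?thesis using True by (simp add: power2_eq_square)
  next
    case False
    then show ?thesis using * ab by linarith
  qed
qed

lemma reduced_minimum:
  assumes r: "reduced_bqf (a, b, c)" and xy: "(x, y) \<noteq> (0, 0)"
  shows "bqf_eval (a, b, c) x y \<ge> a"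
proof (cases "y = 0")
  case True
  then have "1 \<le> \<bar>x\<bar>" using xy by auto
  then have "a * 1 \<le> a * (\<bar>x\<bar> * \<bar>x\<bar>)"
    using mult_mono[of 1 "\<bar>x\<bar>" 1 "\<bar>x\<bar>"] r by (intro mult_left_mono) (auto simp: reduced_bqf_def)
  then show ?thesis using True by (simp add: power2_eq_square)
next
  case False
  then show ?thesis using reduced_lower_bound(1)[OF r False, of x] r by (auto simp: reduced_bqf_def)
qed

lemma reduced_equivalent_fst_le:
  assumes "reduced_bqf (a, b, c)" "SL2Z_equivalent (a, b, c) (a', b', c')"
  shows "a \<le> a'"
proof -
  obtain \<alpha> \<beta> \<gamma> \<delta> where *: "\<alpha> * \<delta> - \<beta> * \<gamma> = 1" "a' = bqf_eval (a, b, c) \<alpha> \<gamma>"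
    using SL2Z_equivalentE[OF assms(2)] by metis
  have "(\<alpha>, \<gamma>) \<noteq> (0, 0)" using *(1) by auto
  then show ?thesis using reduced_minimum[OF assms(1)] *(2) by simp
qed

lemma cong_2a_unique:
  fixes a b b' k :: int
  assumes "b' = b + 2 * a * k" "- a < b" "b \<le> a" "- a < b'" "b' \<le> a"
  shows "b' = b"
proof -
  have "\<bar>2 * a * k\<bar> < 2 * a" using assms by auto
  then have "2 * a * \<bar>k\<bar> < 2 * a * 1" using assms by (simp add: abs_mult)
  then have "\<bar>k\<bar> < 1" using assms by (subst (asm) mult_less_cancel_left_pos) auto
  then show ?thesis using assms(1) by simp
qed

text \<open>The leading coefficients agree, each being the minimum of its form, and the discriminant
  recovers c' from b'. For b' there are three cases: \<gamma> = 0 shifts b by a multiple of 2 a;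
  \<gamma> \<noteq> 0 forces c = a, and then \<alpha> = 0 allows - b modulo 2 a, which the
  tie-breaking condition decides; \<alpha> \<noteq> 0 forces a = b = c.\<close>

lemma reduced_equivalent_eq:
  assumes f: "reduced_bqf f" and g: "reduced_bqf g" and eq: "SL2Z_equivalent f g"
  shows "f = g"
proof -
  obtain a b c a' b' c' where fg: "f = (a, b, c)" "g = (a', b', c')" by (cases f, cases g) auto
  note f = f[unfolded fg(1)] and g = g[unfolded fg(2)] and eq = eq[unfolded fg]
  have aa: "a' = a"
    using reduced_equivalent_fst_le[OF f eq] reduced_equivalent_fst_le[OF g SL2Z_equivalent_sym[OF eq]] by simp
  have disc: "b'\<^sup>2 - 4 * a * c' = b\<^sup>2 - 4 * a * c"
    using SL2Z_equivalent_disc[OF eq] aa by simp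
  have ra: "0 < a" "- a < b" "b \<le> a" "a \<le> c" "a = c \<Longrightarrow> 0 \<le> b" using f by (auto simp: reduced_bqf_def)
  have rb: "- a < b'" "b' \<le> a" "a \<le> c'" "a = c' \<Longrightarrow> 0 \<le> b'" using g by (auto simp: reduced_bqf_def aa)
  obtain \<alpha> \<beta> \<gamma> \<delta> where *: "\<alpha> * \<delta> - \<beta> * \<gamma> = 1" "a' = bqf_eval (a, b, c) \<alpha> \<gamma>"
    "b' = 2 * a * \<alpha> * \<beta> + b * (\<alpha> * \<delta> + \<beta> * \<gamma>) + 2 * c * \<gamma> * \<delta>" "c' = bqf_eval (a, b, c) \<beta> \<delta>"
    using SL2Z_equivalentE[OF eq] by metis
  have bb: "b' = b"
  proof (cases "\<gamma> = 0")
    case True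
    then have ad: "\<alpha> * \<delta> = 1" using *(1) by simp
    have "b' = b + 2 * a * (\<alpha> * \<beta>)" using *(3) True ad by (simp add: algebra_simps)
    then show ?thesis using ra rb cong_2a_unique by blast
  next
    case \<gamma>: False
    have ca: "c = a" using reduced_lower_bound(1)[OF f \<gamma>, of \<alpha>] *(2) aa ra by simp
    show ?thesis
    proof (cases "\<alpha> = 0")
      case True
      then have bg: "\<beta> * \<gamma> = -1" using *(1) by simp
      have b'eq: "b' = - b + 2 * a * (\<gamma> * \<delta>)" using *(3) True bg ca by (simp add: algebra_simps)
      show ?thesis
      \<comment> \<open>b = a is the only value for which - b leaves the admissible interval; there
        the congruence is rewritten around a itself.\<close>
      proof (cases "b = a")
        case True
        have "b' = a + 2 * a * (\<gamma> * \<delta> - 1)" using b'eq True by (simp add: algebra_simps)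
        then show ?thesis using True ra rb cong_2a_unique[of b' a a] by blast
      next
        case False
        have "b' = - b" using cong_2a_unique[OF b'eq] ra rb False by simp
        moreover have "c' = c" using disc ra calculation by simp
        ultimately show ?thesis using ra rb ca by simp
      qed
    next
      case False
      have "a \<ge> a + c - \<bar>b\<bar>" using reduced_lower_bound(2)[OF f \<gamma> False] *(2) aa by simp
      then have ba: "b = a" using ra ca by auto
      have "4 * a * c' = 3 * (a * a) + b'\<^sup>2" using disc ba ca by (simp add: power2_eq_square)
      moreover have "b'\<^sup>2 \<le> a * a" using rb abs_le_square_iff[of b' a] by (simp add: power2_eq_square abs_le_iff)
      ultimately have "a * c' \<le> a * a" by linarith
      then have c'a: "c' = a" using ra rb by simp
      then have "(b' - a) * (b' + a) = 0" using disc ba ca by (simp add: power2_eq_square algebra_simps)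
      then show ?thesis using rb ba c'a ra by auto
    qed
  qed
  moreover have "c' = c" using disc bb ra by simp
  ultimately show ?thesis by (simp add: fg aa)
qed

section \<open>The class number as a finite sum over reduced forms\<close>

lemma reduced_bounds:
  assumes "reduced_bqf (a, b, c)" "bqf_disc (a, b, c) = - int n"
  shows "a \<le> int n" "c \<le> int n" "\<bar>b\<bar> \<le> int n"
proof -
  have r: "0 < a" "\<bar>b\<bar> \<le> a" "a \<le> c" using assms(1) by (auto simp: reduced_bqf_def)
  have "b\<^sup>2 \<le> a * c"
  proof -
    have "\<bar>b\<bar> * \<bar>b\<bar> \<le> a * c" using r by (intro mult_mono) auto
    then show ?thesis by (simp add: power2_eq_square)
  qed
  then have "3 * (a * c) \<le> int n" using assms(2) by simp
  moreover have "1 * c \<le> a * c" using r by (intro mult_right_mono) auto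
  ultimately show "c \<le> int n" using r by linarith
  then show "a \<le> int n" "\<bar>b\<bar> \<le> int n" using r by auto
qed

definition reduced_forms :: "nat \<Rightarrow> bqf set" where
  "reduced_forms n = {f. reduced_bqf f \<and> bqf_disc f = - int n}"

lemma finite_reduced_forms: "finite (reduced_forms n)"
proof (rule finite_subset)
  show "reduced_forms n \<subseteq> {- int n..int n} \<times> {- int n..int n} \<times> {- int n..int n}"
  proof
    fix f assume f: "f \<in> reduced_forms n"
    obtain a b c where abc: "f = (a, b, c)" by (cases f)
    have "reduced_bqf (a, b, c)" "bqf_disc (a, b, c) = - int n" using f abc by (auto simp: reduced_forms_def)
    from reduced_bounds[OF this] this(1)
    show "f \<in> {- int n..int n} \<times> {- int n..int n} \<times> {- int n..int n}"
      by (auto simp: abc reduced_bqf_def)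
  qed
qed auto

definition form_weight :: "bqf \<Rightarrow> real" where
  "form_weight f = (case f of (a, b, c) \<Rightarrow> if b = 0 \<and> a = c then 1 / 2 else if a = b \<and> b = c then 1 / 3 else 1)"

text \<open>Each class contains exactly one reduced form. The weight can be read off from it because
  positive definite forms (a, 0, a) and (a, a, a) are reduced themselves, so a class containing one
  of them has it as its representative.\<close>

lemma hurwitz_class_number_reduced:
  assumes n: "n > 0"
  shows "hurwitz_class_number n = (\<Sum>f\<in>reduced_forms n. form_weight f)"
proof -
  define R where "R = {(f, g) \<in> pos_def_forms n \<times> pos_def_forms n. SL2Z_equivalent f g}"
  have sub: "f \<in> pos_def_forms n" if "f \<in> reduced_forms n" for f
  proof -
    obtain a b c where abc: "f = (a, b, c)" by (cases f)
    show ?thesis using that bqf_pos_def_iff[of a b c] n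
      by (auto simp: abc pos_def_forms_def reduced_forms_def reduced_bqf_def)
  qed
  have cl: "g \<in> R `` {f} \<longleftrightarrow> SL2Z_equivalent f g" if "f \<in> pos_def_forms n" for f g
    using that SL2Z_equivalent_disc[of f g] SL2Z_equivalent_pos_def[of f g] by (auto simp: R_def pos_def_forms_def)
  have bij: "bij_betw (\<lambda>f. R `` {f}) (reduced_forms n) (form_classes n)"
  proof (rule bij_betwI')
    fix f g assume fg: "f \<in> reduced_forms n" "g \<in> reduced_forms n"
    show "(R `` {f} = R `` {g}) = (f = g)"
    proof
      assume "R `` {f} = R `` {g}"
      then have "SL2Z_equivalent f g" using cl[OF sub[OF fg(1)], of g] cl[OF sub[OF fg(2)], of g] SL2Z_equivalent_refl by blast
      then show "f = g" using fg reduced_equivalent_eq by (auto simp: reduced_forms_def)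
    qed simp
  next
    fix f assume "f \<in> reduced_forms n"
    then show "R `` {f} \<in> form_classes n" using sub[of f] unfolding form_classes_def R_def[symmetric] by (intro quotientI)
  next
    fix C assume "C \<in> form_classes n"
    then obtain f where f: "f \<in> pos_def_forms n" "C = R `` {f}"
      unfolding form_classes_def R_def[symmetric] by (rule quotientE)
    then obtain g where g: "SL2Z_equivalent f g" "reduced_bqf g"
      using exists_reduced[of f] by (auto simp: pos_def_forms_def)
    have "g \<in> reduced_forms n" using g f SL2Z_equivalent_disc[of f g] by (auto simp: reduced_forms_def pos_def_forms_def)
    moreover have "C = R `` {g}"
    proof (rule set_eqI)
      fix h
      show "h \<in> C \<longleftrightarrow> h \<in> R `` {g}"
        unfolding f(2) cl[OF f(1)] cl[OF sub[OF calculation]]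
        using g(1) SL2Z_equivalent_trans SL2Z_equivalent_sym by blast
    qed
    ultimately show "\<exists>f\<in>reduced_forms n. C = R `` {f}" by blast
  qed
  have w: "class_weight (R `` {f}) = form_weight f" if f: "f \<in> reduced_forms n" for f
  proof -
    have red: "reduced_bqf f" using f by (simp add: reduced_forms_def)
    have mem: "g \<in> R `` {f} \<longleftrightarrow> g = f" if "reduced_bqf g" for g
      using cl[OF sub[OF f], of g] reduced_equivalent_eq[OF red that] SL2Z_equivalent_refl[of f] by auto
    have pos: "a > 0" if "(a, b, c) \<in> R `` {f}" for a b c
    proof -
      have "bqf_pos_def (a, b, c)" using that by (auto simp: R_def pos_def_forms_def)
      then show ?thesis by (rule bqf_pos_def_lead)
    qed
    have 1: "(\<exists>a. (a, 0, a) \<in> R `` {f}) \<longleftrightarrow> (\<exists>a. f = (a, 0, a))"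
      using mem pos red by (metis (no_types, lifting) Image_singleton_iff case_prod_conv neg_less_0_iff_less order_less_imp_le order_refl reduced_bqf_def)
    have 2: "(\<exists>a. (a, a, a) \<in> R `` {f}) \<longleftrightarrow> (\<exists>a. f = (a, a, a))"
    proof
      assume "\<exists>a. (a, a, a) \<in> R `` {f}"
      then obtain a where a: "(a, a, a) \<in> R `` {f}" by blast
      have "reduced_bqf (a, a, a)" using pos[OF a] by (auto simp: reduced_bqf_def)
      then show "\<exists>a. f = (a, a, a)" using mem a by metis
    next
      assume "\<exists>a. f = (a, a, a)"
      then show "\<exists>a. (a, a, a) \<in> R `` {f}" using mem[OF red] by metis
    qed
    show ?thesis unfolding class_weight_def 1 2 by (cases f) (auto simp: form_weight_def)
  qed
  have "hurwitz_class_number n = (\<Sum>f\<in>reduced_forms n. class_weight (R `` {f}))"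
    unfolding hurwitz_class_number_def by (rule sum.reindex_bij_betw[OF bij, symmetric])
  then show ?thesis using w by simp
qed

subsection \<open>Selling parameters\<close>

text \<open>A triple with one zero counts half, like the end terms of \<open>trapezoid\<close>;
  triples with two zeros, infinitely many of which share the exponent 0, are dropped.\<close>

definition triple_weight :: "nat \<times> nat \<times> nat \<Rightarrow> real" where
  "triple_weight = (\<lambda>(x, y, z). if x = 0 \<and> y = 0 \<or> y = 0 \<and> z = 0 \<or> x = 0 \<and> z = 0 then 0
     else if x = 0 \<or> y = 0 \<or> z = 0 then 1 / 2 else 1)"

definition pair_sum :: "nat \<times> nat \<times> nat \<Rightarrow> nat" where
  "pair_sum = (\<lambda>(x, y, z). x * y + y * z + z * x)"

definition triples :: "nat \<Rightarrow> (nat \<times> nat \<times> nat) set" where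
  "triples n = {(x, y, z). even (x + y) \<and> even (y + z) \<and> pair_sum (x, y, z) = n}"

text \<open>Two positive entries already dominate the sum of all three. The bound makes the triples
  with a given positive exponent finite in number and gives geometric decay in each entry.\<close>

lemma triple_sum_le:
  assumes "triple_weight (x, y, z) \<noteq> 0"
  shows "x + y + z \<le> 2 * pair_sum (x, y, z)"
proof -
  have p: "a + b \<le> 2 * (a * b)" if "a > 0" "b > 0" for a b :: nat
  proof -
    have "a * 1 \<le> a * b" "1 * b \<le> a * b" using that by (intro mult_le_mono; simp)+
    then show ?thesis by linarith
  qed
  have two: "0 < x \<and> 0 < y \<or> 0 < y \<and> 0 < z \<or> 0 < x \<and> 0 < z"
    using assms by (simp add: triple_weight_def split: if_splits) blast
  define u v w where "u = x * y" and "v = y * z" and "w = z * x"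
  have s2: "pair_sum (x, y, z) = u + v + w" by (simp add: pair_sum_def u_def v_def w_def)
  have "x + y \<le> 2 * u" if "0 < x" "0 < y" using p[OF that] by (simp add: u_def)
  moreover have "y + z \<le> 2 * v" if "0 < y" "0 < z" using p[OF that] by (simp add: v_def)
  moreover have "z + x \<le> 2 * w" if "0 < z" "0 < x" using p[OF that] by (simp add: w_def)
  ultimately show ?thesis using two unfolding s2
    by (cases "x = 0"; cases "y = 0"; cases "z = 0") auto
qed

lemma finite_triples:
  assumes "n > 0"
  shows "finite (triples n)"
proof (rule finite_subset)
  show "triples n \<subseteq> {..2 * n} \<times> {..2 * n} \<times> {..2 * n}"
  proof
    fix t assume t: "t \<in> triples n"
    obtain x y z where xyz: "t = (x, y, z)" by (cases t)
    have n: "pair_sum (x, y, z) = n" using t by (simp add: xyz triples_def)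
    then have "triple_weight (x, y, z) \<noteq> 0" using assms by (auto simp: triple_weight_def pair_sum_def)
    from triple_sum_le[OF this] n show "t \<in> {..2 * n} \<times> {..2 * n} \<times> {..2 * n}" by (simp add: xyz)
  qed
qed auto

lemma triple_weight_swap: "triple_weight (y, x, z) = triple_weight (x, y, z)" "triple_weight (x, z, y) = triple_weight (x, y, z)"
  by (auto simp: triple_weight_def)

lemma pair_sum_swap: "pair_sum (y, x, z) = pair_sum (x, y, z)" "pair_sum (x, z, y) = pair_sum (x, y, z)"
  by (simp_all add: pair_sum_def algebra_simps)

text \<open>Weight, exponent and parity condition are symmetric, so it suffices to count the
  orderings of a sorted triple: six, three or one.\<close>

lemma sum_triples_sorted:
  "(\<Sum>t\<in>triples n. triple_weight t) = (\<Sum>(x, y, z)\<in>triples n. triple_weight (x, y, z) *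
     (6 * of_bool (x < y \<and> y < z) + 3 * of_bool (x = y \<and> y < z) + 3 * of_bool (x < y \<and> y = z) + of_bool (x = y \<and> y = z)))"
proof -
  define A where "A P = (\<Sum>(x, y, z)\<in>triples n. triple_weight (x, y, z) * of_bool (P x y z))" for P
  have s12: "A P = A (\<lambda>x y z. P y x z)" for P unfolding A_def
    by (rule sum.reindex_bij_witness[of _ "\<lambda>(x, y, z). (y, x, z)" "\<lambda>(x, y, z). (y, x, z)"])
      (auto simp: triples_def triple_weight_swap pair_sum_swap)
  have s23: "A P = A (\<lambda>x y z. P x z y)" for P unfolding A_def
    by (rule sum.reindex_bij_witness[of _ "\<lambda>(x, y, z). (x, z, y)" "\<lambda>(x, y, z). (x, z, y)"])
      (auto simp: triples_def triple_weight_swap pair_sum_swap)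
  have 1: "A (\<lambda>x y z. y < x \<and> x < z) = A (\<lambda>x y z. x < y \<and> y < z)" by (rule s12)
  have 2: "A (\<lambda>x y z. x < z \<and> z < y) = A (\<lambda>x y z. x < y \<and> y < z)" by (rule s23)
  have 3: "A (\<lambda>x y z. y < z \<and> z < x) = A (\<lambda>x y z. x < z \<and> z < y)" by (rule s12)
  have 4: "A (\<lambda>x y z. z < x \<and> x < y) = A (\<lambda>x y z. y < x \<and> x < z)" by (rule s23)
  have 5: "A (\<lambda>x y z. z < y \<and> y < x) = A (\<lambda>x y z. z < x \<and> x < y)" by (rule s12)
  have 6: "A (\<lambda>x y z. x = z \<and> z < y) = A (\<lambda>x y z. x = y \<and> y < z)" by (rule s23)
  have 7: "A (\<lambda>x y z. y = z \<and> z < x) = A (\<lambda>x y z. x = z \<and> z < y)" by (rule s12)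
  have 8: "A (\<lambda>x y z. y < x \<and> x = z) = A (\<lambda>x y z. x < y \<and> y = z)" by (rule s12)
  have 9: "A (\<lambda>x y z. z < x \<and> x = y) = A (\<lambda>x y z. y < x \<and> x = z)" by (rule s23)
  \<comment> \<open>These are the 13 weak orderings of three numbers, exactly one of which
    holds.\<close>
  define S :: "nat \<Rightarrow> nat \<Rightarrow> nat \<Rightarrow> real" where "S x y z =
      of_bool (x < y \<and> y < z) + of_bool (y < x \<and> x < z) + of_bool (x < z \<and> z < y) +
      of_bool (y < z \<and> z < x) + of_bool (z < x \<and> x < y) + of_bool (z < y \<and> y < x) +
      of_bool (x = y \<and> y < z) + of_bool (x = z \<and> z < y) + of_bool (y = z \<and> z < x) +
      of_bool (x < y \<and> y = z) + of_bool (y < x \<and> x = z) + of_bool (z < x \<and> x = y) +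
      of_bool (x = y \<and> y = z)" for x y z
  have one: "S x y z = 1" for x y z
    unfolding S_def
    by (cases x y rule: linorder_cases; cases y z rule: linorder_cases; cases x z rule: linorder_cases;
        (linarith | simp))
  have "(\<Sum>t\<in>triples n. triple_weight t) = (\<Sum>(x, y, z)\<in>triples n. triple_weight (x, y, z) * S x y z)"
    by (simp add: one case_prod_unfold)
  also have "\<dots> = 6 * A (\<lambda>x y z. x < y \<and> y < z) + 3 * A (\<lambda>x y z. x = y \<and> y < z)
      + 3 * A (\<lambda>x y z. x < y \<and> y = z) + A (\<lambda>x y z. x = y \<and> y = z)"
    unfolding case_prod_unfold S_def distrib_left sum.distrib
    unfolding case_prod_unfold[symmetric] using 1 2 3 4 5 6 7 8 9
    by (simp add: A_def case_prod_unfold)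
  also have "\<dots> = (\<Sum>(x, y, z)\<in>triples n. triple_weight (x, y, z) *
     (6 * of_bool (x < y \<and> y < z) + 3 * of_bool (x = y \<and> y < z) + 3 * of_bool (x < y \<and> y = z) + of_bool (x = y \<and> y = z)))"
    by (simp add: A_def case_prod_unfold sum_distrib_left sum.distrib[symmetric] algebra_simps)
  finally show ?thesis .
qed

text \<open>Selling parameters: the form with b = x, 2 a = x + y, 2 c = x + z has discriminant
  - (x y + y z + z x), and it is reduced when x, y, z increase. The reduced forms with b < 0
  are the mirror images of the strictly increasing triples with x > 0.\<close>

lemma sum_triples_hurwitz:
  assumes n: "n > 0"
  shows "(\<Sum>t\<in>triples n. triple_weight t) = 3 * hurwitz_class_number n"
proof -
  define Rp Rm where "Rp = {f \<in> reduced_forms n. fst (snd f) \<ge> 0}" and "Rm = {f \<in> reduced_forms n. fst (snd f) < 0}"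
  define Tp Tm where "Tp = {(x, y, z) \<in> triples n. x \<le> y \<and> y \<le> z}"
    and "Tm = {(x, y, z) \<in> triples n. 0 < x \<and> x < y \<and> y < z}"
  \<comment> \<open>This is \<open>form_weight\<close> in Selling parameters: b = 0, a = c means x =
    0, y = z, and a = b = c means x = y = z.\<close>
  define \<phi> where "\<phi> = (\<lambda>(x, y, z :: nat). if x = 0 \<and> y = z then 1 / 2 else if x = y \<and> y = z then 1 / 3 else 1 :: real)"
  have fin: "finite (reduced_forms n)" "finite (triples n)" using finite_reduced_forms finite_triples[OF n] by auto
  have disc: "(int x)\<^sup>2 - 4 * ((int x + int y) div 2) * ((int x + int z) div 2) = - int n"
    if "(x, y, z) \<in> triples n" for x y z
  proof -
    have e: "even (int x + int y)" "even (int x + int z)" using that by (auto simp: triples_def even_nat_iff simp flip: of_nat_add)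
    have "4 * ((int x + int y) div 2) * ((int x + int z) div 2) = (2 * ((int x + int y) div 2)) * (2 * ((int x + int z) div 2))" by simp
    also have "\<dots> = (int x + int y) * (int x + int z)" using e by (simp only: dvd_mult_div_cancel)
    also have "\<dots> = (int x)\<^sup>2 + int (pair_sum (x, y, z))" by (simp add: pair_sum_def power2_eq_square algebra_simps)
    finally show ?thesis using that by (simp add: triples_def)
  qed
  have nd: "\<not> (x = 0 \<and> y = 0)" if "(x, y, z) \<in> triples n" for x y z
    using that n by (auto simp: triples_def pair_sum_def)
  have tri: "(nat b, nat (2 * a - b), nat (2 * c - b)) \<in> triples n"
    if "reduced_bqf (a, b, c)" "b\<^sup>2 - 4 * a * c = - int n" "0 \<le> b" for a b c
  proof -
    have r: "0 \<le> 2 * a - b" "0 \<le> 2 * c - b" using that by (auto simp: reduced_bqf_def)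
    have "int (pair_sum (nat b, nat (2 * a - b), nat (2 * c - b))) = b * (2 * a - b) + (2 * a - b) * (2 * c - b) + (2 * c - b) * b"
      using r that(3) by (simp add: pair_sum_def)
    also have "\<dots> = int n" using that(2) by (simp add: power2_eq_square algebra_simps)
    finally have "pair_sum (nat b, nat (2 * a - b), nat (2 * c - b)) = n" by simp
    moreover have "nat b + nat (2 * a - b) = 2 * nat a" "nat (2 * a - b) + nat (2 * c - b) = 2 * nat (a + c - b)"
      using r that(3) by (auto simp: nat_add_distrib[symmetric] nat_mult_distrib[symmetric])
    then have "even (nat b + nat (2 * a - b))" "even (nat (2 * a - b) + nat (2 * c - b))"
      by (metis dvd_triv_left)+
    ultimately show ?thesis by (simp only: triples_def mem_Collect_eq case_prod_conv simp_thms)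
  qed
  have P: "(\<Sum>f\<in>Rp. form_weight f) = (\<Sum>t\<in>Tp. \<phi> t)"
  proof (rule sum.reindex_bij_witness[of _ "\<lambda>(x, y, z). ((int x + int y) div 2, int x, (int x + int z) div 2)"
        "\<lambda>(a, b, c). (nat b, nat (2 * a - b), nat (2 * c - b))"])
    fix f assume "f \<in> Rp"
    then obtain a b c where f: "f = (a, b, c)" "reduced_bqf (a, b, c)" "b\<^sup>2 - 4 * a * c = - int n" "0 \<le> b"
      by (cases f) (auto simp: Rp_def reduced_forms_def)
    have r: "0 < a" "b \<le> a" "a \<le> c" using f by (auto simp: reduced_bqf_def)
    show "(case case f of (a, b, c) \<Rightarrow> (nat b, nat (2 * a - b), nat (2 * c - b)) of (x, y, z) \<Rightarrow> ((int x + int y) div 2, int x, (int x + int z) div 2)) = f"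
      using r f(4) by (simp add: f(1))
    show "(case f of (a, b, c) \<Rightarrow> (nat b, nat (2 * a - b), nat (2 * c - b))) \<in> Tp"
      using tri[OF f(2-4)] r f(4) by (auto simp: f(1) Tp_def)
    show "\<phi> (case f of (a, b, c) \<Rightarrow> (nat b, nat (2 * a - b), nat (2 * c - b))) = form_weight f"
      using r f(4) by (auto simp: f(1) \<phi>_def form_weight_def)
  next
    fix t assume "t \<in> Tp"
    then obtain x y z where t: "t = (x, y, z)" "(x, y, z) \<in> triples n" "x \<le> y" "y \<le> z" by (auto simp: Tp_def)
    have "even (int x + int y)" "even (int x + int z)" using t(2) by (auto simp: triples_def even_nat_iff simp flip: of_nat_add)
    then have h: "2 * ((int x + int y) div 2) = int x + int y" "2 * ((int x + int z) div 2) = int x + int z" by auto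
    show "(case case t of (x, y, z) \<Rightarrow> ((int x + int y) div 2, int x, (int x + int z) div 2) of (a, b, c) \<Rightarrow> (nat b, nat (2 * a - b), nat (2 * c - b))) = t"
      by (simp add: t(1) h)
    have "reduced_bqf ((int x + int y) div 2, int x, (int x + int z) div 2)"
      using h t(3,4) nd[OF t(2)] unfolding reduced_bqf_def case_prod_conv by linarith
    then show "(case t of (x, y, z) \<Rightarrow> ((int x + int y) div 2, int x, (int x + int z) div 2)) \<in> Rp"
      using disc[OF t(2)] by (simp add: t(1) Rp_def reduced_forms_def)
  qed
  have M: "(\<Sum>f\<in>Rm. form_weight f) = (\<Sum>t\<in>Tm. 1)"
  proof (rule sum.reindex_bij_witness[of _ "\<lambda>(x, y, z). ((int x + int y) div 2, - int x, (int x + int z) div 2)"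
        "\<lambda>(a, b, c). (nat (- b), nat (2 * a + b), nat (2 * c + b))"])
    fix f assume "f \<in> Rm"
    then obtain a b c where f: "f = (a, b, c)" "reduced_bqf (a, b, c)" "b\<^sup>2 - 4 * a * c = - int n" "b < 0"
      by (cases f) (auto simp: Rm_def reduced_forms_def)
    have r: "0 < a" "- a < b" "a < c" using f by (auto simp: reduced_bqf_def order_le_less)
    have "reduced_bqf (a, - b, c)" using r f(4) by (auto simp: reduced_bqf_def)
    from tri[OF this] have "(nat (- b), nat (2 * a + b), nat (2 * c + b)) \<in> triples n" using f(3,4) by simp
    then show "(case f of (a, b, c) \<Rightarrow> (nat (- b), nat (2 * a + b), nat (2 * c + b))) \<in> Tm"
      using r f(4) by (auto simp: f(1) Tm_def)
    show "(case case f of (a, b, c) \<Rightarrow> (nat (- b), nat (2 * a + b), nat (2 * c + b)) of (x, y, z) \<Rightarrow> ((int x + int y) div 2, - int x, (int x + int z) div 2)) = f"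
      using r f(4) by (simp add: f(1))
    show "1 = form_weight f" using r f(4) by (auto simp: f(1) form_weight_def)
  next
    fix t assume "t \<in> Tm"
    then obtain x y z where t: "t = (x, y, z)" "(x, y, z) \<in> triples n" "0 < x" "x < y" "y < z" by (auto simp: Tm_def)
    have "even (int x + int y)" "even (int x + int z)" using t(2) by (auto simp: triples_def even_nat_iff simp flip: of_nat_add)
    then have h: "2 * ((int x + int y) div 2) = int x + int y" "2 * ((int x + int z) div 2) = int x + int z" by auto
    show "(case case t of (x, y, z) \<Rightarrow> ((int x + int y) div 2, - int x, (int x + int z) div 2) of (a, b, c) \<Rightarrow> (nat (- b), nat (2 * a + b), nat (2 * c + b))) = t"
      by (simp add: t(1) h)
    have "reduced_bqf ((int x + int y) div 2, - int x, (int x + int z) div 2)"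
      using h t(3-5) unfolding reduced_bqf_def case_prod_conv by linarith
    then show "(case t of (x, y, z) \<Rightarrow> ((int x + int y) div 2, - int x, (int x + int z) div 2)) \<in> Rm"
      using disc[OF t(2)] t(3) by (simp add: t(1) Rm_def reduced_forms_def)
  qed
  have R: "reduced_forms n = Rp \<union> Rm" "finite Rp" "finite Rm" "Rp \<inter> Rm = {}"
    using fin by (auto simp: Rp_def Rm_def)
  have "(\<Sum>f\<in>reduced_forms n. form_weight f) = (\<Sum>f\<in>Rp. form_weight f) + (\<Sum>f\<in>Rm. form_weight f)"
    unfolding R(1) by (rule sum.union_disjoint[OF R(2-4)])
  also have "\<dots> = (\<Sum>t\<in>triples n. of_bool (t \<in> Tp) * \<phi> t) + (\<Sum>t\<in>triples n. of_bool (t \<in> Tm) * 1)"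
  proof -
    have "Tp \<subseteq> triples n" "Tm \<subseteq> triples n" by (auto simp: Tp_def Tm_def)
    then show ?thesis unfolding P M using fin(2)
      by (intro arg_cong2[where f = "(+)"] sum.mono_neutral_cong_left) auto
  qed
  finally have "3 * hurwitz_class_number n = (\<Sum>t\<in>triples n. 3 * (of_bool (t \<in> Tp) * \<phi> t + of_bool (t \<in> Tm) * 1))"
    unfolding hurwitz_class_number_reduced[OF n] by (simp add: sum.distrib sum_distrib_left algebra_simps)
  also have "\<dots> = (\<Sum>(x, y, z)\<in>triples n. triple_weight (x, y, z) *
     (6 * of_bool (x < y \<and> y < z) + 3 * of_bool (x = y \<and> y < z) + 3 * of_bool (x < y \<and> y = z) + of_bool (x = y \<and> y = z)))"
  proof (rule sum.cong[OF refl], clarify)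
    fix x y z assume t: "(x, y, z) \<in> triples n"
    have nz: "\<not> (x = 0 \<and> y = 0)" "\<not> (y = 0 \<and> z = 0)" "\<not> (x = 0 \<and> z = 0)"
      using t n by (auto simp: triples_def pair_sum_def)
    have Tp: "(x, y, z) \<in> Tp \<longleftrightarrow> x \<le> y \<and> y \<le> z" and Tm: "(x, y, z) \<in> Tm \<longleftrightarrow> 0 < x \<and> x < y \<and> y < z"
      using t by (auto simp: Tp_def Tm_def)
    \<comment> \<open>For 0 < x < y < z both signs of b occur, giving 3 + 3 = 6; for 0 = x < y < z
      one form gives 3 = 6 / 2. One equality among positive entries gives 3, while 0 = x < y = z
      gives 3 / 2 on both sides, and x = y = z gives 1.\<close>
    show "3 * (of_bool ((x, y, z) \<in> Tp) * \<phi> (x, y, z) + of_bool ((x, y, z) \<in> Tm) * 1) = triple_weight (x, y, z) *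
     (6 * of_bool (x < y \<and> y < z) + 3 * of_bool (x = y \<and> y < z) + 3 * of_bool (x < y \<and> y = z) + of_bool (x = y \<and> y = z))"
      unfolding Tp Tm using nz by (auto simp: \<phi>_def triple_weight_def)
  qed
  finally show ?thesis unfolding sum_triples_sorted ..
qed

section \<open>Generating function of the weighted triples\<close>

context nome
begin

definition triple_term :: "nat \<times> nat \<times> nat \<Rightarrow> complex" where
  "triple_term t = complex_of_real (triple_weight t) * q ^ pair_sum t"

lemma triple_term_summable: "triple_term summable_on A"
proof -
  \<comment> \<open>The square root absorbs the factor 2 of \<open>triple_sum_le\<close>, so that
    the term at (x, y, z) is at most r^(x + y + z).\<close>
  define r where "r = sqrt \<rho>"
  have r: "0 < r" "r < 1" "r ^ 2 = \<rho>" using rho by (auto simp: r_def)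
  have geo: "(\<lambda>n::nat. r ^ n) summable_on UNIV"
    using r by (intro summable_nonneg_imp_summable_on summable_geometric) auto
  have geo2: "(\<lambda>(y, z). r ^ y * r ^ z) summable_on (UNIV \<times> UNIV :: (nat \<times> nat) set)"
    by (rule summable_on_product_bound[OF geo geo]) (use r in auto)
  have "triple_term summable_on UNIV \<times> UNIV \<times> UNIV"
  proof (rule summable_on_product_bound[OF geo geo2])
    fix x :: nat and yz :: "nat \<times> nat"
    obtain y z where yz: "yz = (y, z)" by (cases yz)
    have "norm (triple_term (x, y, z)) \<le> r ^ (x + y + z)"
    proof (cases "triple_weight (x, y, z) = 0")
      case True
      then show ?thesis using r by (simp add: triple_term_def)
    next
      case False
      have "norm (triple_term (x, y, z)) = \<bar>triple_weight (x, y, z)\<bar> * \<rho> ^ pair_sum (x, y, z)"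
        by (simp add: triple_term_def norm_mult norm_power)
      also have "\<dots> \<le> 1 * \<rho> ^ pair_sum (x, y, z)"
        using rho by (intro mult_right_mono) (auto simp: triple_weight_def)
      also have "\<dots> = r ^ (2 * pair_sum (x, y, z))" by (simp add: power_mult r(3))
      also have "\<dots> \<le> r ^ (x + y + z)"
        using r triple_sum_le[OF False] by (intro power_decreasing) auto
      finally show ?thesis .
    qed
    then show "norm (triple_term (x, yz)) \<le> r ^ x * (case yz of (y, z) \<Rightarrow> r ^ y * r ^ z)"
      by (simp add: yz power_add mult_ac)
  qed (use r in auto)
  then show ?thesis by (rule summable_on_subset_banach) auto
qed

lemma sum_power_sign:
  assumes "N > 0"
  shows "((\<lambda>z. (-1) ^ z * q ^ (N * z)) has_sum (tnh q (int N) - 1) / 2) {1..}"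
proof -
  have "norm (- (q ^ N)) < 1" using q_lt assms by (simp add: norm_power power_less_one_iff)
  from has_sum_geometric_from_1[OF this]
  have sum: "((\<lambda>z. (-1) ^ z * q ^ (N * z)) has_sum (- (q ^ N) / (1 - - (q ^ N)))) {1..}"
    by (simp add: power_mult power_minus[of "q ^ N"])
  have "1 + q ^ N \<noteq> 0" using one_plus_q_powi[of "int N"] by simp
  then have "tnh q (int N) - 1 = 2 * (- (q ^ N) / (1 - - (q ^ N)))"
    by (simp add: hyp_def field_simps)
  moreover have "a = b / 2" if "b = 2 * a" for a b :: complex using that by simp
  ultimately have "- (q ^ N) / (1 - - (q ^ N)) = (tnh q (int N) - 1) / 2" by blast
  with sum show ?thesis by (simp only:)
qed

lemma signed_triple_summable: "(\<lambda>(x, y, z). (-1) ^ z * triple_term (x, y, z)) summable_on A"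
proof -
  have "(\<lambda>t. norm (triple_term t)) summable_on A"
    by (rule summable_on_iff_abs_summable_on_complex[THEN iffD1, OF triple_term_summable])
  note n = abs_summable_summable[OF Infinite_Sum.abs_summable_on_comparison_test'[OF this]]
  show ?thesis by (rule n) (auto simp: norm_mult norm_power)
qed

text \<open>On the slice x + y = N the exponent is x (N - x) + N z: the alternating sum over z is
  geometric and yields tanh, the sum over x yields \<open>trapezoid\<close>. Halving independently
  at z = 0 and at x = 0, N would give exactly half the product; but the two corners with z = 0 have
  weight 0 in place of 1/4, which accounts for the -1.\<close>

lemma slice_sum:
  assumes N: "N > 0"
  shows "(\<Sum>\<^sub>\<infinity>(x, z)\<in>{..N} \<times> UNIV. (-1) ^ z * triple_term (x, N - x, z)) = (tnh q (int N) * trapezoid q (int N) - 1) / 2"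
proof -
  define t where "t = tnh q (int N)"
  have col: "((\<lambda>z. (-1) ^ z * triple_term (x, N - x, z)) has_sum
      (if x = 0 \<or> x = N then (t - 1) / 4 else q ^ (x * (N - x)) * t / 2)) UNIV" if "x \<le> N" for x
  proof -
    have U: "(UNIV :: nat set) = insert 0 {1..}" by auto
    have Q: "pair_sum (x, N - x, z) = x * (N - x) + N * z" for z
    proof -
      obtain y where "N = x + y" using \<open>x \<le> N\<close> by (auto simp: le_iff_add)
      then show ?thesis by (simp add: pair_sum_def algebra_simps)
    qed
    show ?thesis
    proof (cases "x = 0 \<or> x = N")
      case True
      have "((\<lambda>z. (-1) ^ z * triple_term (x, N - x, z)) has_sum (t - 1) / 2 * (1 / 2)) {1..}"
        using has_sum_cmult_left[OF sum_power_sign[OF N], of "1 / 2"] unfolding t_def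
        by (rule has_sum_cong[THEN iffD1, rotated 1]) (use True N in \<open>auto simp: triple_term_def Q triple_weight_def\<close>)
      from has_sum_insert[OF _ this, of 0]
      have "((\<lambda>z. (-1) ^ z * triple_term (x, N - x, z)) has_sum triple_term (x, N - x, 0) + (t - 1) / 4) UNIV"
        unfolding U by simp
      moreover have "triple_term (x, N - x, 0) = 0" using True by (auto simp: triple_term_def triple_weight_def)
      ultimately show ?thesis using True by simp
    next
      case False
      then have x: "0 < x" "0 < N - x" using that by auto
      have "((\<lambda>z. (-1) ^ z * triple_term (x, N - x, z)) has_sum q ^ (x * (N - x)) * ((t - 1) / 2)) {1..}"
        using has_sum_cmult_right[OF sum_power_sign[OF N], of "q ^ (x * (N - x))"]
        unfolding t_def
        by (rule has_sum_cong[THEN iffD1, rotated 1]) (use x in \<open>auto simp: triple_term_def Q triple_weight_def power_add\<close>)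
      from has_sum_insert[OF _ this, of 0]
      have "((\<lambda>z. (-1) ^ z * triple_term (x, N - x, z)) has_sum
          triple_term (x, N - x, 0) + q ^ (x * (N - x)) * ((t - 1) / 2)) UNIV"
        unfolding U by simp
      moreover have "triple_term (x, N - x, 0) = q ^ (x * (N - x)) / 2"
        using x by (auto simp: triple_term_def triple_weight_def Q)
      ultimately show ?thesis using False by (simp add: algebra_simps diff_divide_distrib)
    qed
  qed
  have "(\<lambda>(x, y, z). (-1) ^ z * triple_term (x, y, z)) summable_on (\<lambda>(x, z). (x, N - x, z)) ` ({..N} \<times> UNIV)"
    by (rule signed_triple_summable)
  then have s: "(\<lambda>(x, z). (-1) ^ z * triple_term (x, N - x, z)) summable_on {..N} \<times> UNIV"
    by (subst (asm) summable_on_reindex) (auto simp: inj_on_def o_def case_prod_unfold)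
  have "(\<Sum>\<^sub>\<infinity>(x, z)\<in>{..N} \<times> UNIV. (-1) ^ z * triple_term (x, N - x, z)) =
      (\<Sum>\<^sub>\<infinity>x\<in>{..N}. \<Sum>\<^sub>\<infinity>z. (-1) ^ z * triple_term (x, N - x, z))"
    using infsum_Sigma_banach[OF s] by simp
  also have "\<dots> = (\<Sum>x\<le>N. if x = 0 \<or> x = N then (t - 1) / 4 else q ^ (x * (N - x)) * t / 2)"
    using infsumI[OF col] by simp
  also have "\<dots> = (\<Sum>x\<le>N. q ^ (x * (N - x)) * t / 2 + (if x = 0 \<or> x = N then - (t + 1) / 4 else 0))"
    by (rule sum.cong) (auto simp: field_simps)
  also have "\<dots> = (\<Sum>x\<le>N. q ^ (x * (N - x))) * t / 2 + (\<Sum>x\<in>{0, N}. - (t + 1) / 4)"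
  proof -
    have "(\<Sum>x\<le>N. if x = 0 \<or> x = N then - (t + 1) / 4 else 0) = (\<Sum>x\<in>{0, N}. - (t + 1) / 4)"
      by (rule sum.mono_neutral_cong_right) auto
    then show ?thesis by (simp add: sum.distrib sum_divide_distrib[symmetric] sum_distrib_right[symmetric])
  qed
  also have "\<dots> = (tnh q (int N) * trapezoid q (int N) - 1) / 2"
    using N by (simp add: trapezoid_def t_def field_simps)
  finally show ?thesis .
qed

lemma sliced_triple_sum:
  assumes "0 \<notin> f ` S" "inj_on f S"
  shows "(\<Sum>\<^sub>\<infinity>(x, y, z)\<in>{(x, y, z). x + y \<in> f ` S}. (-1) ^ z * triple_term (x, y, z)) =
    (\<Sum>\<^sub>\<infinity>n\<in>S. (tnh q (int (f n)) * trapezoid q (int (f n)) - 1) / 2)"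
proof -
  define G where "G = (\<lambda>(n, x, z). (-1) ^ z * triple_term (x, f n - x, z))"
  define X where "X = Sigma S (\<lambda>n. {..f n} \<times> (UNIV :: nat set))"
  define g where "g = the_inv_into S f"
  have g: "f (g N) = N" "g N \<in> S" if "N \<in> f ` S" for N
    using that assms(2) unfolding g_def by (auto intro: f_the_inv_into_f the_inv_into_into)
  have gf: "g (f n) = n" if "n \<in> S" for n using that assms(2) by (simp add: g_def the_inv_into_f_f)
  have sw: "(G has_sum s) X \<longleftrightarrow> ((\<lambda>(x, y, z). (-1) ^ z * triple_term (x, y, z)) has_sum s) {(x, y, z). x + y \<in> f ` S}" for s
    by (rule has_sum_reindex_bij_witness[of _ "\<lambda>(x, y, z). (g (x + y), x, z)" "\<lambda>(n, x, z). (x, f n - x, z)"])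
      (auto simp: X_def G_def g gf)
  have G: "G summable_on X"
    using signed_triple_summable[of "{(x, y, z). x + y \<in> f ` S}"] sw by (auto simp: summable_on_def)
  have "(\<Sum>\<^sub>\<infinity>(x, y, z)\<in>{(x, y, z). x + y \<in> f ` S}. (-1) ^ z * triple_term (x, y, z)) = infsum G X"
    using has_sum_infsum[OF G] sw by (auto intro!: infsumI)
  also have "\<dots> = (\<Sum>\<^sub>\<infinity>n\<in>S. \<Sum>\<^sub>\<infinity>xz\<in>{..f n} \<times> UNIV. G (n, xz))"
    using infsum_Sigma_banach[OF G[unfolded X_def]] by (simp add: X_def)
  also have "\<dots> = (\<Sum>\<^sub>\<infinity>n\<in>S. (tnh q (int (f n)) * trapezoid q (int (f n)) - 1) / 2)"
  proof (rule infsum_cong)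
    fix n assume "n \<in> S"
    then have "f n > 0" using assms(1) by (metis gr0I imageI)
    from slice_sum[OF this] show "(\<Sum>\<^sub>\<infinity>xz\<in>{..f n} \<times> UNIV. G (n, xz)) = (tnh q (int (f n)) * trapezoid q (int (f n)) - 1) / 2"
      by (simp add: G_def case_prod_unfold)
  qed
  finally show ?thesis .
qed

text \<open>The theta product delivers summability only after multiplication by \<open>th4\<close>,
  which is not 0.\<close>

lemma tanh_sum_summable: "(\<lambda>n. tnh q (2 * n + a) * trapezoid q (2 * n + a) - 1) summable_on UNIV"
  using theta_times_tanh_sum_tanh(2)[of a] th4_nonzero by (subst (asm) summable_on_cmult_right') auto

lemma tnh_trapezoid_minus: "tnh q (- N) * trapezoid q (- N) = tnh q N * trapezoid q N"
  using hyp_minus[of "-1" N] by (simp add: trapezoid_minus)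

text \<open>The slice N = 0 contains only triples of weight 0, yet its term in V 0 is -1. The factor
  4 combines the evenness in N with the 1/2 of \<open>slice_sum\<close>.\<close>

lemma tanh_sum_0_triples:
  "tanh_sum q 0 = - 1 + 4 * (\<Sum>\<^sub>\<infinity>(x, y, z)\<in>{(x, y, z). even (x + y)}. (-1) ^ z * triple_term (x, y, z))"
proof -
  define f where "f n = tnh q (2 * n + 0) * trapezoid q (2 * n + 0) - 1" for n
  have "tanh_sum q 0 = f 0 + 2 * (\<Sum>\<^sub>\<infinity>n\<in>{1..}. f (int n))"
    unfolding tanh_sum_def f_def[symmetric]
  proof (rule infsum_int_even)
    show "f summable_on UNIV" using tanh_sum_summable[of 0] by (simp add: f_def[abs_def])
    show "f (- n) = f n" for n using tnh_trapezoid_minus[of "2 * n"] by (simp add: f_def)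
  qed
  also have "(\<Sum>\<^sub>\<infinity>n\<in>{1..}. f (int n)) = 2 * (\<Sum>\<^sub>\<infinity>n\<in>{1..}. (tnh q (int (2 * n)) * trapezoid q (int (2 * n)) - 1) / 2)"
    by (subst infsum_cmult_right'[symmetric], rule infsum_cong) (simp add: f_def)
  also have "(\<Sum>\<^sub>\<infinity>n\<in>{1..}. (tnh q (int (2 * n)) * trapezoid q (int (2 * n)) - 1) / 2) =
     (\<Sum>\<^sub>\<infinity>(x, y, z)\<in>{(x, y, z). x + y \<in> (\<lambda>n. 2 * n) ` {1..}}. (-1) ^ z * triple_term (x, y, z))"
    by (rule sliced_triple_sum[symmetric]) (auto simp: inj_on_def)
  also have "\<dots> = (\<Sum>\<^sub>\<infinity>(x, y, z)\<in>{(x, y, z). even (x + y)}. (-1) ^ z * triple_term (x, y, z))"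
  proof (rule infsum_cong_neutral)
    fix t :: "nat \<times> nat \<times> nat"
    assume "t \<in> {(x, y, z). even (x + y)} - {(x, y, z). x + y \<in> (\<lambda>n. 2 * n) ` {1..}}"
    then obtain x y z where xyz: "t = (x, y, z)" "even (x + y)" "x + y \<notin> (\<lambda>n. 2 * n) ` {1..}" by auto
    then obtain k where t: "t = (x, y, z)" "x + y = 2 * k" "x + y \<notin> (\<lambda>n. 2 * n) ` {1..}"
      by (elim evenE) auto
    then have "k = 0" by (metis One_nat_def Suc_leI atLeast_iff gr0I imageI)
    with t(2) have "x + y = 0" by simp
    then show "(case t of (x, y, z) \<Rightarrow> (-1) ^ z * triple_term (x, y, z)) = 0"
      by (simp add: t(1) triple_term_def triple_weight_def)
  qed (auto, presburger+)
  also have "f 0 = - 1" by (simp add: f_def trapezoid_def)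
  finally show ?thesis by simp
qed

lemma tanh_sum_1_triples:
  "tanh_sum q 1 = 4 * (\<Sum>\<^sub>\<infinity>(x, y, z)\<in>{(x, y, z). odd (x + y)}. (-1) ^ z * triple_term (x, y, z))"
proof -
  define f where "f n = tnh q (2 * n + 1) * trapezoid q (2 * n + 1) - 1" for n
  have "tanh_sum q 1 = 2 * (\<Sum>\<^sub>\<infinity>n. f (int n))"
    unfolding tanh_sum_def f_def[symmetric]
  proof (rule infsum_int_even')
    show "f summable_on UNIV" using tanh_sum_summable[of 1] by (simp add: f_def[abs_def])
    have *: "2 * (- n - 1) + 1 = - (2 * n + 1)" for n :: int by simp
    show "f (- n - 1) = f n" for n unfolding f_def * tnh_trapezoid_minus ..
  qed
  also have "(\<Sum>\<^sub>\<infinity>n. f (int n)) = 2 * (\<Sum>\<^sub>\<infinity>n. (tnh q (int (2 * n + 1)) * trapezoid q (int (2 * n + 1)) - 1) / 2)"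
    by (subst infsum_cmult_right'[symmetric], rule infsum_cong) (simp add: f_def add.commute)
  also have "(\<Sum>\<^sub>\<infinity>n. (tnh q (int (2 * n + 1)) * trapezoid q (int (2 * n + 1)) - 1) / 2) =
     (\<Sum>\<^sub>\<infinity>(x, y, z)\<in>{(x, y, z). x + y \<in> range (\<lambda>n. 2 * n + 1)}. (-1) ^ z * triple_term (x, y, z))"
    by (rule sliced_triple_sum[symmetric]) (auto simp: inj_on_def)
  also have "range (\<lambda>n. 2 * n + 1) = {k :: nat. odd k}" by (auto elim: oddE)
  finally show ?thesis by simp
qed

end

lemma infsum_triple_permute:
  "(\<Sum>\<^sub>\<infinity>t\<in>{(x, y, z). P x y z}. F t) = (\<Sum>\<^sub>\<infinity>(x, y, z)\<in>{(x, y, z). P y x z}. F (y, x, z))"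
  "(\<Sum>\<^sub>\<infinity>t\<in>{(x, y, z). P x y z}. F t) = (\<Sum>\<^sub>\<infinity>(x, y, z)\<in>{(x, y, z). P x z y}. F (x, z, y))"
  by (rule infsum_reindex_bij_witness[of _ "\<lambda>(x, y, z). (y, x, z)" "\<lambda>(x, y, z). (y, x, z)"]; auto)
    (rule infsum_reindex_bij_witness[of _ "\<lambda>(x, y, z). (x, z, y)" "\<lambda>(x, y, z). (x, z, y)"]; auto)

context nome
begin

text \<open>At -q the total sign of a triple is (-1)^(y + z) if x + y is even, and 1 if x + y is
  odd. So V 0 counts equal parities positively and the class where z differs negatively, while V 1
  counts the two other mixed classes positively. The three mixed classes have the same sum by
  symmetry, and 2 V 0 + V 1 is the combination in which they cancel.\<close>

lemma tanh_sum_minus_triples: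
  "2 * tanh_sum (- q) 0 + tanh_sum (- q) 1 =
     - 2 + 8 * (\<Sum>\<^sub>\<infinity>t\<in>{(x, y, z). even (x + y) \<and> even (y + z)}. triple_term t)"
proof -
  interpret m: nome "- q" by (rule nome_minus) (rule nome_axioms)
  define I where "I P = (\<Sum>\<^sub>\<infinity>t\<in>{(x, y, z). P x y z}. triple_term t)" for P :: "nat \<Rightarrow> nat \<Rightarrow> nat \<Rightarrow> bool"
  have tt: "m.triple_term (x, y, z) = (-1) ^ (x * y + (x + y) * z) * triple_term (x, y, z)" for x y z
    unfolding m.triple_term_def triple_term_def by (simp add: power_minus[of q] pair_sum_def algebra_simps)
  have E: "(\<Sum>\<^sub>\<infinity>(x, y, z)\<in>{(x, y, z). even (x + y)}. (-1) ^ z * m.triple_term (x, y, z))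
     = I (\<lambda>x y z. even (x + y) \<and> even (y + z)) - I (\<lambda>x y z. even (x + y) \<and> odd (y + z))"
  proof -
    have "(\<Sum>\<^sub>\<infinity>(x, y, z)\<in>{(x, y, z). even (x + y)}. (-1) ^ z * m.triple_term (x, y, z)) =
      (\<Sum>\<^sub>\<infinity>t\<in>{(x, y, z). even (x + y) \<and> even (y + z)} \<union> {(x, y, z). even (x + y) \<and> odd (y + z)}.
         (case t of (x, y, z) \<Rightarrow> (-1) ^ (y + z)) * triple_term t)"
      by (rule infsum_cong_neutral) (auto simp: tt minus_one_power_iff)
    also have "\<dots> = (\<Sum>\<^sub>\<infinity>t\<in>{(x, y, z). even (x + y) \<and> even (y + z)}. (case t of (x, y, z) \<Rightarrow> (-1) ^ (y + z)) * triple_term t) +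
       (\<Sum>\<^sub>\<infinity>t\<in>{(x, y, z). even (x + y) \<and> odd (y + z)}. (case t of (x, y, z) \<Rightarrow> (-1) ^ (y + z)) * triple_term t)"
    proof (rule infsum_Un_disjoint)
      have "(\<lambda>t. norm (triple_term t)) summable_on A" for A
        by (rule summable_on_iff_abs_summable_on_complex[THEN iffD1, OF triple_term_summable])
      note n = abs_summable_summable[OF Infinite_Sum.abs_summable_on_comparison_test'[OF this]]
      have h: "(\<lambda>t. (case t of (x, y, z) \<Rightarrow> (-1) ^ (y + z)) * triple_term t) summable_on A" for A
        by (rule n) (auto simp: norm_mult norm_power)
      show "(\<lambda>t. (case t of (x, y, z) \<Rightarrow> (-1) ^ (y + z)) * triple_term t) summable_on {(x, y, z). even (x + y) \<and> even (y + z)}"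
        "(\<lambda>t. (case t of (x, y, z) \<Rightarrow> (-1) ^ (y + z)) * triple_term t) summable_on {(x, y, z). even (x + y) \<and> odd (y + z)}"
        by (rule h)+
    qed auto
    also have "(\<Sum>\<^sub>\<infinity>t\<in>{(x, y, z). even (x + y) \<and> even (y + z)}. (case t of (x, y, z) \<Rightarrow> (-1) ^ (y + z)) * triple_term t)
        = I (\<lambda>x y z. even (x + y) \<and> even (y + z))"
      unfolding I_def by (rule infsum_cong) (auto simp: minus_one_power_iff)
    also have "(\<Sum>\<^sub>\<infinity>t\<in>{(x, y, z). even (x + y) \<and> odd (y + z)}. (case t of (x, y, z) \<Rightarrow> (-1) ^ (y + z)) * triple_term t)
        = - I (\<lambda>x y z. even (x + y) \<and> odd (y + z))"
      unfolding I_def infsum_uminus[symmetric] by (rule infsum_cong) (auto simp: minus_one_power_iff)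
    finally show ?thesis by simp
  qed
  have p: "triple_term (y, x, z) = triple_term (x, y, z)" "triple_term (x, z, y) = triple_term (x, y, z)" for x y z
    by (simp_all add: triple_term_def triple_weight_swap pair_sum_swap)
  have s12: "I P = I (\<lambda>x y z. P y x z)" and s23: "I P = I (\<lambda>x y z. P x z y)" for P
    unfolding I_def
    by (subst infsum_triple_permute(1), simp add: p case_prod_unfold)
      (subst infsum_triple_permute(2), simp add: p case_prod_unfold)
  have D: "(\<Sum>\<^sub>\<infinity>(x, y, z)\<in>{(x, y, z). odd (x + y)}. (-1) ^ z * m.triple_term (x, y, z))
     = I (\<lambda>x y z. odd (x + y) \<and> even (y + z)) + I (\<lambda>x y z. odd (x + y) \<and> even (x + z))"
  proof -
    have "(\<Sum>\<^sub>\<infinity>(x, y, z)\<in>{(x, y, z). odd (x + y)}. (-1) ^ z * m.triple_term (x, y, z)) =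
      (\<Sum>\<^sub>\<infinity>t\<in>{(x, y, z). odd (x + y) \<and> even (y + z)} \<union> {(x, y, z). odd (x + y) \<and> even (x + z)}. triple_term t)"
      by (rule infsum_cong_neutral) (auto simp: tt minus_one_power_iff)
    also have "\<dots> = I (\<lambda>x y z. odd (x + y) \<and> even (y + z)) + I (\<lambda>x y z. odd (x + y) \<and> even (x + z))"
      unfolding I_def by (rule infsum_Un_disjoint) (auto intro: triple_term_summable)
    finally show ?thesis .
  qed
  have "I (\<lambda>x y z. odd (x + y) \<and> even (x + z)) = I (\<lambda>x y z. odd (x + z) \<and> even (x + y))" by (rule s23)
  moreover have "I (\<lambda>x y z. odd (x + y) \<and> even (y + z)) = I (\<lambda>x y z. odd (y + x) \<and> even (x + z))" by (rule s12)
  moreover have "I (\<lambda>x y z. odd (x + z) \<and> even (x + y)) = I (\<lambda>x y z. even (x + y) \<and> odd (y + z))"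
    unfolding I_def by (rule arg_cong2[where f = infsum]) auto
  moreover have "I (\<lambda>x y z. odd (y + x) \<and> even (x + z)) = I (\<lambda>x y z. odd (x + y) \<and> even (x + z))"
    by (simp add: add.commute)
  ultimately have "I (\<lambda>x y z. odd (x + y) \<and> even (y + z)) + I (\<lambda>x y z. odd (x + y) \<and> even (x + z))
     = 2 * I (\<lambda>x y z. even (x + y) \<and> odd (y + z))" by simp
  then show ?thesis unfolding m.tanh_sum_0_triples m.tanh_sum_1_triples E D by (simp add: I_def)
qed

text \<open>Entries of equal parity force the exponent to be 0 or 3 modulo 4, according to whether
  they are even or odd, so grouping by exponent stays inside the index set of the series. Exponent 0
  occurs only with weight 0 and is removed first.\<close>

lemma triples_hurwitz_series:
  "(\<Sum>\<^sub>\<infinity>t\<in>{(x, y, z). even (x + y) \<and> even (y + z)}. triple_term t) =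
     3 * (\<Sum>\<^sub>\<infinity>n\<in>{n. n \<ge> 1 \<and> (n mod 4 = 0 \<or> n mod 4 = 3)}. complex_of_real (hurwitz_class_number n) * q ^ n)"
proof -
  define S where "S = {n::nat. n \<ge> 1 \<and> (n mod 4 = 0 \<or> n mod 4 = 3)}"
  define X where "X = {(x, y, z). even (x + y) \<and> even (y + z) \<and> pair_sum (x, y, z) > 0}"
  have mod: "pair_sum (x, y, z) mod 4 = 0 \<or> pair_sum (x, y, z) mod 4 = 3" if "even (x + y)" "even (y + z)" for x y z
  proof (cases "even y")
    case True
    then have "x = 2 * (x div 2)" "y = 2 * (y div 2)" "z = 2 * (z div 2)" using that by auto
    then obtain a b c where "x = 2 * a" "y = 2 * b" "z = 2 * c" by blast
    then have "pair_sum (x, y, z) = 4 * (a * b + b * c + c * a)" by (simp add: pair_sum_def)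
    then show ?thesis by simp
  next
    case False
    then have "x = 2 * (x div 2) + 1" "y = 2 * (y div 2) + 1" "z = 2 * (z div 2) + 1"
      using that by (auto simp: odd_two_times_div_two_succ)
    then obtain a b c where "x = 2 * a + 1" "y = 2 * b + 1" "z = 2 * c + 1" by blast
    then have "pair_sum (x, y, z) = 4 * (a * b + b * c + c * a + a + b + c) + 3" by (simp add: pair_sum_def algebra_simps)
    moreover have "(4 * k + 3) mod 4 = (3 :: nat)" for k by presburger
    ultimately show ?thesis by (simp only:) simp
  qed
  have "(\<Sum>\<^sub>\<infinity>t\<in>{(x, y, z). even (x + y) \<and> even (y + z)}. triple_term t) = infsum triple_term X"
  proof (rule infsum_cong_neutral)
    fix t assume tX: "t \<in> {(x, y, z). even (x + y) \<and> even (y + z)} - X"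
    obtain x y z where t: "t = (x, y, z)" by (cases t)
    have s: "pair_sum (x, y, z) = 0" using tX by (simp add: X_def t) blast
    have "triple_weight (x, y, z) = 0"
    proof (rule ccontr)
      assume triple_weight: "triple_weight (x, y, z) \<noteq> 0"
      from triple_sum_le[OF this] have "x + y + z = 0" unfolding s by simp
      then have "x = 0" "y = 0" by simp_all
      with triple_weight show False by (simp add: triple_weight_def)
    qed
    then show "triple_term t = 0" by (simp add: t triple_term_def)
  qed (auto simp: X_def)
  also have "infsum triple_term X = (\<Sum>\<^sub>\<infinity>(n, t)\<in>Sigma S triples. triple_term t)"
    by (rule infsum_reindex_bij_witness[of _ snd "\<lambda>t. (pair_sum t, t)"])
      (use mod in \<open>auto simp: X_def S_def triples_def\<close>)
  also have "\<dots> = (\<Sum>\<^sub>\<infinity>n\<in>S. \<Sum>\<^sub>\<infinity>t\<in>triples n. triple_term t)"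
  proof -
    have "(\<lambda>(n, t). triple_term t) summable_on Sigma S triples \<longleftrightarrow> triple_term summable_on X"
      by (rule summable_on_reindex_bij_witness[of _ "\<lambda>t. (pair_sum t, t)" snd])
        (use mod in \<open>auto simp: X_def S_def triples_def\<close>)
    then have "(\<lambda>(n, t). triple_term t) summable_on Sigma S triples" using triple_term_summable by simp
    from infsum_Sigma_banach[OF this] show ?thesis by simp
  qed
  also have "\<dots> = (\<Sum>\<^sub>\<infinity>n\<in>S. 3 * (complex_of_real (hurwitz_class_number n) * q ^ n))"
  proof (rule infsum_cong)
    fix n assume "n \<in> S"
    then have n: "n > 0" by (simp add: S_def)
    have "(\<Sum>\<^sub>\<infinity>t\<in>triples n. triple_term t) = (\<Sum>t\<in>triples n. triple_term t)" by (rule infsum_finite[OF finite_triples[OF n]])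
    also have "\<dots> = (\<Sum>t\<in>triples n. complex_of_real (triple_weight t) * q ^ n)"
      by (rule sum.cong) (auto simp: triples_def triple_term_def)
    also have "\<dots> = complex_of_real (\<Sum>t\<in>triples n. triple_weight t) * q ^ n" by (simp add: sum_distrib_right)
    finally show "(\<Sum>\<^sub>\<infinity>t\<in>triples n. triple_term t) = 3 * (complex_of_real (hurwitz_class_number n) * q ^ n)"
      unfolding sum_triples_hurwitz[OF n] by simp
  qed
  also have "\<dots> = 3 * (\<Sum>\<^sub>\<infinity>n\<in>S. complex_of_real (hurwitz_class_number n) * q ^ n)" by (rule infsum_cmult_right')
  finally show ?thesis by (simp add: S_def)
qed

lemma hurwitz_series_eq: "24 * hurwitz_series q = 2 * tanh_sum (- q) 0 + tanh_sum (- q) 1"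
  unfolding tanh_sum_minus_triples triples_hurwitz_series hurwitz_series_def by simp

text \<open>By \<open>triangular_product\<close> at Q = q^2 the product is the reciprocal of \<psi>,
  and \<open>gtheta q 1 1\<close> is 2 \<psi>; multiplying by the product thus divides by the theta
  series. As n^2 + 3 n + 1 is odd, \<open>V1_D_eq\<close> at -q gives \<open>ser_D\<close> with the
  opposite sign.\<close>

lemma triangular_product_ser_D:
  "4 * (\<Prod>n. (1 - q ^ (4 * Suc n - 2)) / (1 - q ^ (4 * Suc n))) * ser_D q = tanh_sum (- q) 1"
proof -
  interpret m: nome "- q" by (rule nome_minus) (rule nome_axioms)
  define \<psi> where "\<psi> = (\<Sum>\<^sub>\<infinity>n::nat. (q ^ 2) ^ (n * (n + 1) div 2))"
  define P where "P = (\<Prod>n. (1 - q ^ (4 * Suc n - 2)) / (1 - q ^ (4 * Suc n)))"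
  have "norm (q ^ 2) < 1" using q_lt by (simp add: norm_power power_less_one_iff)
  have P: "P * \<psi> = 1"
  proof -
    have "(q ^ 2) ^ (2 * n + 1) = q ^ (4 * Suc n - 2)" "(q ^ 2) ^ (2 * n + 2) = q ^ (4 * Suc n)" for n
      unfolding power_mult[symmetric] by (rule arg_cong[where f = "\<lambda>k. q ^ k"], simp)+
    then show ?thesis using triangular_product[OF \<open>norm (q ^ 2) < 1\<close>] unfolding P_def \<psi>_def by (simp only:)
  qed
  have t: "theta_char 1 1" by (simp add: theta_char_def)
  have "gtheta q 1 1 = infsum (theta_term q 1 1) UNIV" using theta_term_has_sum[OF t] by (simp add: infsumI)
  also have "\<dots> = 2 * (\<Sum>\<^sub>\<infinity>n. theta_term q 1 1 (int n))"
    using theta_term_has_sum[OF t] theta_term_reflect[OF t] by (intro infsum_int_even') (auto simp: summable_on_def)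
  also have "(\<Sum>\<^sub>\<infinity>n. theta_term q 1 1 (int n)) = \<psi>"
    unfolding \<psi>_def
  proof (rule infsum_cong)
    fix n :: nat
    have "(int n)\<^sup>2 + 1 * int n = int (2 * (n * (n + 1) div 2))" by (simp add: power2_eq_square algebra_simps)
    then show "theta_term q 1 1 (int n) = (q ^ 2) ^ (n * (n + 1) div 2)"
      unfolding theta_term_def power_mult[symmetric] by (simp only: power_int_of_nat power_int_1_left power_one mult_1_left)
  qed
  finally have G: "gtheta q 1 1 = 2 * \<psi>" .
  have "gtheta q 1 1 * tanh_sum (- q) 1 = - 8 * (\<Sum>\<^sub>\<infinity>n. (- q) ^ (n\<^sup>2 + 3 * n + 1) / (1 + (- q) ^ (2 * n + 1))\<^sup>2)"
    using m.V1_D_eq by (simp only: gtheta_minus_1_1)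
  also have "(\<Sum>\<^sub>\<infinity>n. (- q) ^ (n\<^sup>2 + 3 * n + 1) / (1 + (- q) ^ (2 * n + 1))\<^sup>2) = - ser_D q"
    unfolding ser_D_def infsum_uminus[symmetric] by (rule infsum_cong) (simp add: power_minus_odd)
  finally have "2 * \<psi> * tanh_sum (- q) 1 = 8 * ser_D q" by (simp add: G)
  then have "4 * ser_D q = \<psi> * tanh_sum (- q) 1" by simp
  then have "P * (4 * ser_D q) = P * \<psi> * tanh_sum (- q) 1" by (simp only: mult.assoc)
  then have "4 * P * ser_D q = tanh_sum (- q) 1" unfolding P by (simp only: mult.left_commute mult.assoc mult_1_left)
  then show ?thesis unfolding P_def .
qed

end

section \<open>Assembly of the four identities\<close>

theorem corollary1p6:
  fixes z q :: complex
  assumes "Im z > 0"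
    and "q = exp (2 * complex_of_real pi * \<i> * z)"
  shows
    "(4 / theta (z + 1/2) *
        (\<Sum>\<^sub>\<infinity>n\<in>(UNIV :: int set). (-1) powi n * q powi (n\<^sup>2 + n) / (1 + q powi n)\<^sup>2)
      - 8 / theta z *
        (\<Sum>\<^sub>\<infinity>n\<in>(UNIV :: nat set). of_nat n * q ^ (n\<^sup>2) * (1 - q ^ (2 * n)) / (1 + q ^ (2 * n)))
      = theta (z + 1/2) ^ 3)
      \<and>
     (4 / theta (z + 1/2) *
        (\<Sum>\<^sub>\<infinity>n\<in>(UNIV :: int set). (-1) powi n * q powi (n\<^sup>2 + 2 * n) / (1 + q powi (2 * n))\<^sup>2)
      + 4 * (\<Prod>n. (1 - q ^ (4 * Suc n - 2)) / (1 - q ^ (4 * Suc n))) *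
        (\<Sum>\<^sub>\<infinity>n\<in>(UNIV :: nat set). q ^ (n\<^sup>2 + 3 * n + 1) / (1 - q ^ (2 * n + 1))\<^sup>2)
      = theta z ^ 3)
      \<and>
     (4 / theta z *
        (\<Sum>\<^sub>\<infinity>n\<in>(UNIV :: int set). (-1) powi n * q powi (n\<^sup>2 + n) / (1 + (- q) powi n)\<^sup>2)
      - 8 / theta (z + 1/2) *
        (\<Sum>\<^sub>\<infinity>n\<in>(UNIV :: int set). (-1) powi n * q powi (n\<^sup>2 + 2 * n) / (1 + q powi (2 * n))\<^sup>2)
      = - (theta z ^ 3))
      \<and>
     (1 / theta z *
        (\<Sum>\<^sub>\<infinity>n\<in>(UNIV :: int set). (-1) powi n * q powi (n\<^sup>2 + n) / (1 + (- q) powi n)\<^sup>2)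
      + 1 / theta (z + 1/2) *
        (\<Sum>\<^sub>\<infinity>n\<in>(UNIV :: int set). (-1) powi n * q powi (n\<^sup>2 + 2 * n) / (1 + q powi (2 * n))\<^sup>2)
      = - 6 * hurwitz_series q)"
proof -
  have "norm q = exp (- (2 * pi * Im z))" by (simp add: assms(2) norm_exp_eq_Re)
  then have "norm q < 1" using assms(1) by simp
  then interpret nome q by unfold_locales (auto simp: assms(2))
  interpret m: nome "- q" by (rule nome_minus) (rule nome_axioms)
  have th: "theta z = th"
    unfolding theta_def gtheta_def assms(2) by simp
  have "exp (2 * complex_of_real pi * \<i> * (z + 1/2)) = - q"
    by (simp add: assms(2) distrib_left exp_add)
  then have th4: "theta (z + 1/2) = th4"
    unfolding theta_def gtheta_minus_1_0[symmetric] by (simp add: gtheta_def)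
  note nz = th_nonzero th4_nonzero
  define P where "P = (\<Prod>n. (1 - q ^ (4 * Suc n - 2)) / (1 - q ^ (4 * Suc n)))"
  have A: "4 * ser_A q = - th4 * (tanh_sum q 0 + tanh_sum q 1)" by (rule ser_A_eq)
  have A': "4 * ser_A (- q) = - th * (tanh_sum (- q) 0 + tanh_sum (- q) 1)"
    using m.ser_A_eq gtheta_minus_1_0[of "- q"] by simp
  have B: "4 * ser_B q = - th4 * tanh_sum (- q) 0"
  proof -
    have "(\<Sum>\<^sub>\<infinity>n. (- q) powi (n\<^sup>2 + 2 * n) / (1 + (- q) powi (2 * n))\<^sup>2) = ser_B q"
      unfolding ser_B_def by (rule infsum_cong) (simp add: power_int_minus_left)
    then show ?thesis using m.V0_eq by (simp add: gtheta_minus_1_0)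
  qed
  have C: "4 * ser_C q = - th * tanh_sum q 1" using V1_C_eq by simp
  have D: "4 * P * ser_D q = tanh_sum (- q) 1" unfolding P_def by (rule triangular_product_ser_D)
  have T: "th4 ^ 3 = tanh_sum q 1 - tanh_sum q 0" by (rule th4_cubed)
  have T': "th ^ 3 = tanh_sum (- q) 1 - tanh_sum (- q) 0"
    using m.th4_cubed gtheta_minus_1_0[of "- q"] by simp
  have A'_eq: "(\<Sum>\<^sub>\<infinity>n. (-1) powi n * q powi (n\<^sup>2 + n) / (1 + (- q) powi n)\<^sup>2) = ser_A (- q)"
    unfolding ser_A_def by (rule infsum_cong) (simp add: power_int_minus_left)
  have i: "4 / th4 * ser_A q - 8 / th * ser_C q = th4 ^ 3"
  proof -
    have "4 / th4 * ser_A q - 8 / th * ser_C q = (4 * ser_A q) / th4 - 2 * (4 * ser_C q) / th" by simp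
    also have "\<dots> = th4 ^ 3" unfolding A C T using nz by simp
    finally show ?thesis .
  qed
  have ii: "4 / th4 * ser_B q + 4 * P * ser_D q = th ^ 3"
  proof -
    have "4 / th4 * ser_B q + 4 * P * ser_D q = (4 * ser_B q) / th4 + 4 * P * ser_D q" by simp
    also have "(4 * ser_B q) / th4 + 4 * P * ser_D q = th ^ 3" unfolding B D T' using nz by simp
    finally show ?thesis .
  qed
  have iii: "4 / th * ser_A (- q) - 8 / th4 * ser_B q = - (th ^ 3)"
  proof -
    have "4 / th * ser_A (- q) - 8 / th4 * ser_B q = (4 * ser_A (- q)) / th - 2 * (4 * ser_B q) / th4" by simp
    also have "\<dots> = - (th ^ 3)" unfolding A' B T' using nz by simp
    finally show ?thesis .
  qed
  have iv: "1 / th * ser_A (- q) + 1 / th4 * ser_B q = - 6 * hurwitz_series q"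
  proof -
    have "4 * (1 / th * ser_A (- q) + 1 / th4 * ser_B q) = (4 * ser_A (- q)) / th + (4 * ser_B q) / th4"
      by (simp add: field_simps)
    also have "\<dots> = - (2 * tanh_sum (- q) 0 + tanh_sum (- q) 1)" unfolding A' B using nz by simp
    also have "\<dots> = 4 * (- 6 * hurwitz_series q)" unfolding hurwitz_series_eq[symmetric] by simp
    finally show ?thesis by (simp only: mult_cancel_left) simp
  qed
  note u = ser_A_def[of q] ser_B_def ser_C_def ser_D_def P_def
  show ?thesis unfolding th th4 A'_eq
    by (intro conjI i[unfolded u] ii[unfolded u] iii[unfolded u] iv[unfolded u])
qed

end
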